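(* Let $k$ be an algebraically closed field, let $A$ be a connected monomial $k$-algebra and let $B$ be a monomial subalgebra of $A$ such that $Q_B$ is a subquiver of $Q_A$. Then $\beta_1(Q_{A|B})=\beta_1(Q_A)-\beta_1(Q_B)$. Consequently $$\pi_1(Q_{A|B})^{\mathrm{ab}}\cong\pi_1(Q_A,I_A)^{\mathrm{ab}}/\pi_1(Q_B,I_B)^{\mathrm{ab}}$$ and $$\dim_k\big(\mathrm{Hom}(\pi_1(Q_{A|B}),k)\big)=\pi_1\text{-}\mathrm{rank}(A)-\pi_1\text{-}\mathrm{rank}(B).$$
   Context: A monomial algebra is $A=kQ_A/I_A$ with $Q_A$ a finite quiver and $I_A$ an admissible ideal generated by paths; $B=kQ_B/I_B$ is monomial, with $Q_B$ a subquiver of $Q_A$ having the same vertices, the inclusion $B\subseteq A$ being induced by the inclusion of quivers. For a quiver $Q$ with $n$ vertices, $m$ arrows and $c$ connected components, $\beta_1(Q)=m-n+c$. Fundamental group: a walk is a path in the quiver obtained by adding formal inverses of the arrows. For a bound quiver $(Q,I)$ with $Q$ connected and a vertex $*$, $\pi_1(Q,I)$ is the group of walks from $*$ to $*$ modulo the concatenation-compatible equivalence relation generated by $\alpha^{-1}\alpha\sim e_{s(\alpha)}$, $\alpha\alpha^{-1}\sim e_{t(\alpha)}$ for arrows $\alpha$, and $u\sim v$ when the paths $u,v$ occur with nonzero coefficients in a common minimal relation of $I$ (an element of $I$ no proper subsum of which lies in $I$). If $Q$ is not connected, $\pi_1(Q,I)$ is the direct product of the fundamental groups of the connected components. $\pi_1(Q)$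 means $\pi_1(Q,0)$. The superscript $\mathrm{ab}$ denotes abelianisation, and $\pi_1(Q_B,I_B)^{\mathrm{ab}}$ is regarded as a subgroup of $\pi_1(Q_A,I_A)^{\mathrm{ab}}$ via the inclusion of quivers $Q_B\subseteq Q_A$. $\mathrm{Hom}(-,k)$ denotes group homomorphisms to the additive group of $k$. $\pi_1\text{-}\mathrm{rank}(A)=\max\{\dim_k\mathrm{Hom}(\pi_1(Q,I),k) : A\cong kQ/I,\ I \text{ an admissible ideal}\}$. The quiver $Q_{A|B}$: choose a maximal tree in each connected component of $Q_B$, and extend this maximal forest to a maximal tree $T$ of $Q_A$. Then $Q_{A|B}=Q_{A|B,T}$ has vertex set $(Q_A)_0$ and arrow set $((Q_A)_1\setminus(Q_B)_1)\cup T$; up to isomorphism, $\pi_1(Q_{A|B,T})$ does not depend on $T$. *)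

theory Defs
  imports
    "Graph_Theory.Digraph_Component"
    "HOL-Algebra.QuotRing"
    "HOL-Algebra.Module"
    "HOL-Algebra.Product_Groups"
    "HOL-Algebra.Generated_Groups"
    "HOL-Library.Poly_Mapping"
    "HOL-Library.Function_Algebras"
    "HOL-Computational_Algebra.Polynomial"
begin

section \<open>Quivers, paths and walks\<close>

text \<open>
  A finite quiver is a \<^locale>\<open>fin_digraph\<close> (loops and parallel arrows are allowed); an arrow
  \<open>a\<close> goes from \<^term>\<open>tail Q a\<close> to \<^term>\<open>head Q a\<close>.
  A path is a triple (source, arrows, target), so that the trivial paths at different vertices
  are different; the arrows are listed in the order in which they are traversed.
\<close>

type_synonym ('v, 'a) qpath = "'v \<times> 'a list \<times> 'v"

definition src :: "('v, 'a) qpath \<Rightarrow> 'v" where "src p = fst p"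
definition arrs :: "('v, 'a) qpath \<Rightarrow> 'a list" where "arrs p = fst (snd p)"
definition tgt :: "('v, 'a) qpath \<Rightarrow> 'v" where "tgt p = snd (snd p)"

definition trivial_path :: "'v \<Rightarrow> ('v, 'a) qpath" where
  "trivial_path v = (v, [], v)"

text \<open>Paths are composed like functions: in \<open>pcomp p q\<close>, the path \<open>q\<close> comes first.\<close>

definition pcomp :: "('v, 'a) qpath \<Rightarrow> ('v, 'a) qpath \<Rightarrow> ('v, 'a) qpath" where
  "pcomp p q = (src q, arrs q @ arrs p, tgt p)"

definition paths :: "('v, 'a) pre_digraph \<Rightarrow> ('v, 'a) qpath set" where
  "paths Q = {p. pre_digraph.awalk Q (src p) (arrs p) (tgt p)}"

text \<open>
  The quiver with formal inverses: \<open>(a, True)\<close> is the arrow \<open>a\<close> and \<open>(a, False)\<close> its inverse.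
\<close>

definition double_quiver :: "('v, 'a) pre_digraph \<Rightarrow> ('v, 'a \<times> bool) pre_digraph" where
  "double_quiver Q =
    \<lparr>verts = verts Q, arcs = arcs Q \<times> UNIV,
     tail = (\<lambda>(a, b). if b then tail Q a else head Q a),
     head = (\<lambda>(a, b). if b then head Q a else tail Q a)\<rparr>"

definition walks :: "('v, 'a) pre_digraph \<Rightarrow> ('v, 'a \<times> bool) qpath set" where
  "walks Q = paths (double_quiver Q)"

definition path_walk :: "('v, 'a) qpath \<Rightarrow> ('v, 'a \<times> bool) qpath" where
  "path_walk p = (src p, map (\<lambda>a. (a, True)) (arrs p), tgt p)"

definition inv_walk :: "('v, 'a \<times> bool) qpath \<Rightarrow> ('v, 'a \<times> bool) qpath" where
  "inv_walk w = (tgt w, rev (map (\<lambda>(a, b). (a, \<not> b)) (arrs w)), src w)"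

definition arrow_path :: "('v, 'a) pre_digraph \<Rightarrow> 'a \<Rightarrow> ('v, 'a) qpath" where
  "arrow_path Q a = (tail Q a, [a], head Q a)"

text \<open>Components are those of the underlying undirected graph, given by their vertex sets.\<close>

definition component_of :: "('v, 'a) pre_digraph \<Rightarrow> 'v \<Rightarrow> 'v set" where
  "component_of Q u = {v. u \<rightarrow>\<^sup>*\<^bsub>double_quiver Q\<^esub> v}"

definition components :: "('v, 'a) pre_digraph \<Rightarrow> 'v set set" where
  "components Q = component_of Q ` verts Q"

definition component_quiver :: "('v, 'a) pre_digraph \<Rightarrow> 'v set \<Rightarrow> ('v, 'a) pre_digraph" where
  "component_quiver Q C = Q\<lparr>verts := C, arcs := {a \<in> arcs Q. tail Q a \<in> C}\<rparr>"

definition betti :: "('v, 'a) pre_digraph \<Rightarrow> int" where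
  "betti Q = int (card (arcs Q)) - int (card (verts Q)) + int (card (components Q))"


section \<open>Maximal trees and the relative quiver\<close>

text \<open>
  The constants \<^const>\<open>forest\<close> and \<^const>\<open>tree\<close> of the graph library only exclude
  \<^emph>\<open>directed\<close> cycles, so they are not used here. A tree has no cycle
  in the underlying undirected multigraph, that is, no cycle of the double quiver in which no
  arrow occurs twice (in either direction). Loops and pairs of parallel arrows give such cycles.
\<close>

definition quiver_tree :: "('v, 'a) pre_digraph \<Rightarrow> bool" where
  "quiver_tree Q \<longleftrightarrow> Digraph_Component.connected Q \<and>
    \<not> (\<exists>p. pre_digraph.cycle (double_quiver Q) p \<and> distinct (map fst p))"

definition maximal_tree :: "('v, 'a) pre_digraph \<Rightarrow> ('v, 'a) pre_digraph \<Rightarrow> bool" where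
  "maximal_tree Q T \<longleftrightarrow> pre_digraph.max_subgraph Q quiver_tree T"

definition extending_maximal_tree ::
    "('v, 'a) pre_digraph \<Rightarrow> ('v, 'a) pre_digraph \<Rightarrow> ('v, 'a) pre_digraph \<Rightarrow> bool" where
  "extending_maximal_tree QA QB T \<longleftrightarrow>
    maximal_tree QA T \<and>
    (\<forall>C \<in> components QB. \<exists>S. maximal_tree (component_quiver QB C) S \<and> subgraph S T)"

definition relative_quiver ::
    "('v, 'a) pre_digraph \<Rightarrow> ('v, 'a) pre_digraph \<Rightarrow> ('v, 'a) pre_digraph \<Rightarrow> ('v, 'a) pre_digraph"
  where
  "relative_quiver QA QB T = QA\<lparr>arcs := (arcs QA - arcs QB) \<union> arcs T\<rparr>"


section \<open>Algebras given by bound quivers\<close>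

text \<open>
  The locale \<^locale>\<open>algebra\<close> of HOL-Algebra is restricted to commutative algebras, so only the
  underlying record type is used for \<open>k\<close>-algebras.
\<close>

definition path_algebra ::
    "('v, 'a) pre_digraph \<Rightarrow> ('k::field, ('v, 'a) qpath \<Rightarrow>\<^sub>0 'k) module" where
  "path_algebra Q =
    \<lparr>carrier = {f. Poly_Mapping.keys f \<subseteq> paths Q},
     monoid.mult = (\<lambda>f g. \<Sum>p\<in>Poly_Mapping.keys f. \<Sum>q\<in>Poly_Mapping.keys g.
       if src p = tgt q
       then Poly_Mapping.single (pcomp p q) (Poly_Mapping.lookup f p * Poly_Mapping.lookup g q)
       else 0),
     one = (\<Sum>v\<in>verts Q. Poly_Mapping.single (trivial_path v) 1),
     ring.zero = 0, ring.add = (+),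
     module.smult = (\<lambda>c f. Poly_Mapping.map (\<lambda>x. c * x) f)\<rparr>"

definition quotient_algebra ::
    "('k, 'x, 'm) module_scheme \<Rightarrow> 'x set \<Rightarrow> ('k, 'x set) module" where
  "quotient_algebra R I =
    ring.extend (R Quot I) (module.fields (\<lambda>c X. \<Union>x\<in>X. I +>\<^bsub>R\<^esub> (c \<odot>\<^bsub>R\<^esub> x)))"

abbreviation bound_quiver_algebra ::
    "('v, 'a) pre_digraph \<Rightarrow> (('v, 'a) qpath \<Rightarrow>\<^sub>0 'k::field) set
      \<Rightarrow> ('k, (('v, 'a) qpath \<Rightarrow>\<^sub>0 'k) set) module" where
  "bound_quiver_algebra Q I \<equiv> quotient_algebra (path_algebra Q) I"

definition alg_hom ::
    "('k, 'x, 'm) module_scheme \<Rightarrow> ('k, 'y, 'n) module_scheme \<Rightarrow> ('x \<Rightarrow> 'y) set" where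
  "alg_hom R S = {h \<in> ring_hom R S. \<forall>c. \<forall>x \<in> carrier R. h (c \<odot>\<^bsub>R\<^esub> x) = c \<odot>\<^bsub>S\<^esub> h x}"

definition alg_isomorphic ::
    "('k, 'x, 'm) module_scheme \<Rightarrow> ('k, 'y, 'n) module_scheme \<Rightarrow> bool" where
  "alg_isomorphic R S \<longleftrightarrow> (\<exists>h \<in> alg_hom R S. bij_betw h (carrier R) (carrier S))"

text \<open>
  A connected algebra is a nonzero algebra that is not a product of two nonzero algebras; such a
  decomposition is the same thing as a central idempotent different from 0 and 1.
\<close>

definition connected_algebra :: "('x, 'm) ring_scheme \<Rightarrow> bool" where
  "connected_algebra R \<longleftrightarrow> \<one>\<^bsub>R\<^esub> \<noteq> \<zero>\<^bsub>R\<^esub> \<and>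
    (\<forall>e \<in> carrier R. e \<otimes>\<^bsub>R\<^esub> e = e \<and> (\<forall>x \<in> carrier R. e \<otimes>\<^bsub>R\<^esub> x = x \<otimes>\<^bsub>R\<^esub> e)
      \<longrightarrow> e = \<zero>\<^bsub>R\<^esub> \<or> e = \<one>\<^bsub>R\<^esub>)"

text \<open>The \<open>m\<close>-th power of the arrow ideal is spanned by the paths of length at least \<open>m\<close>.\<close>

definition arrow_ideal_power ::
    "('v, 'a) pre_digraph \<Rightarrow> nat \<Rightarrow> (('v, 'a) qpath \<Rightarrow>\<^sub>0 'k::field) set" where
  "arrow_ideal_power Q m =
    {f \<in> carrier (path_algebra Q). \<forall>p \<in> Poly_Mapping.keys f. m \<le> length (arrs p)}"

definition admissible ::
    "('v, 'a) pre_digraph \<Rightarrow> (('v, 'a) qpath \<Rightarrow>\<^sub>0 'k::field) set \<Rightarrow> bool" where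
  "admissible Q I \<longleftrightarrow> ideal I (path_algebra Q) \<and>
    I \<subseteq> arrow_ideal_power Q 2 \<and> (\<exists>m\<ge>2. arrow_ideal_power Q m \<subseteq> I)"

definition generated_by_paths ::
    "('v, 'a) pre_digraph \<Rightarrow> (('v, 'a) qpath \<Rightarrow>\<^sub>0 'k::field) set \<Rightarrow> bool" where
  "generated_by_paths Q I \<longleftrightarrow>
    (\<exists>P \<subseteq> paths Q. I = Idl\<^bsub>path_algebra Q\<^esub> ((\<lambda>p. Poly_Mapping.single p 1) ` P))"

definition monomial ::
    "('v, 'a) pre_digraph \<Rightarrow> (('v, 'a) qpath \<Rightarrow>\<^sub>0 'k::field) set \<Rightarrow> bool" where
  "monomial Q I \<longleftrightarrow> fin_digraph Q \<and> admissible Q I \<and> generated_by_paths Q I"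

text \<open>
  \<open>B = kQB/IB\<close> is a subalgebra of \<open>A = kQA/IA\<close> by way of the inclusion of quivers: the assignment
  \<open>x + IB \<mapsto> x + IA\<close> (on cosets, \<open>X \<mapsto> IA + X\<close>) is an injective algebra homomorphism. That it
  respects 0 forces \<open>IB \<subseteq> IA\<close>, so the assignment is then well defined.
\<close>

definition quiver_subalgebra ::
    "('v, 'a) pre_digraph \<Rightarrow> (('v, 'a) qpath \<Rightarrow>\<^sub>0 'k::field) set
      \<Rightarrow> ('v, 'a) pre_digraph \<Rightarrow> (('v, 'a) qpath \<Rightarrow>\<^sub>0 'k) set \<Rightarrow> bool" where
  "quiver_subalgebra QB IB QA IA \<longleftrightarrow>
    spanning QB QA \<and>
    (\<lambda>X. IA <+>\<^bsub>path_algebra QA\<^esub> X)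
      \<in> alg_hom (bound_quiver_algebra QB IB) (bound_quiver_algebra QA IA) \<and>
    inj_on (\<lambda>X. IA <+>\<^bsub>path_algebra QA\<^esub> X) (carrier (bound_quiver_algebra QB IB))"


section \<open>Fundamental groups\<close>

definition minimal_relation :: "('p \<Rightarrow>\<^sub>0 'k::field) set \<Rightarrow> ('p \<Rightarrow>\<^sub>0 'k) \<Rightarrow> bool" where
  "minimal_relation I r \<longleftrightarrow> r \<in> I \<and>
    (\<forall>S. S \<noteq> {} \<and> S \<subset> Poly_Mapping.keys r
      \<longrightarrow> (\<Sum>p\<in>S. Poly_Mapping.single p (Poly_Mapping.lookup r p)) \<notin> I)"

inductive walk_equiv ::
    "('v, 'a) pre_digraph \<Rightarrow> (('v, 'a) qpath \<Rightarrow>\<^sub>0 'k::field) set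
      \<Rightarrow> ('v, 'a \<times> bool) qpath \<Rightarrow> ('v, 'a \<times> bool) qpath \<Rightarrow> bool"
  for Q I where
  refl: "w \<in> walks Q \<Longrightarrow> walk_equiv Q I w w"
| sym: "walk_equiv Q I u v \<Longrightarrow> walk_equiv Q I v u"
| trans: "walk_equiv Q I u v \<Longrightarrow> walk_equiv Q I v w \<Longrightarrow> walk_equiv Q I u w"
| comp: "walk_equiv Q I u u' \<Longrightarrow> walk_equiv Q I v v' \<Longrightarrow> src u = tgt v
    \<Longrightarrow> walk_equiv Q I (pcomp u v) (pcomp u' v')"
| cancel_left: "a \<in> arcs Q \<Longrightarrow> \<alpha> = path_walk (arrow_path Q a)
    \<Longrightarrow> walk_equiv Q I (pcomp (inv_walk \<alpha>) \<alpha>) (trivial_path (tail Q a))"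
| cancel_right: "a \<in> arcs Q \<Longrightarrow> \<alpha> = path_walk (arrow_path Q a)
    \<Longrightarrow> walk_equiv Q I (pcomp \<alpha> (inv_walk \<alpha>)) (trivial_path (head Q a))"
| relation: "minimal_relation I r \<Longrightarrow> p \<in> Poly_Mapping.keys r \<Longrightarrow> q \<in> Poly_Mapping.keys r
    \<Longrightarrow> walk_equiv Q I (path_walk p) (path_walk q)"

definition walk_class ::
    "('v, 'a) pre_digraph \<Rightarrow> (('v, 'a) qpath \<Rightarrow>\<^sub>0 'k::field) set
      \<Rightarrow> ('v, 'a \<times> bool) qpath \<Rightarrow> ('v, 'a \<times> bool) qpath set" where
  "walk_class Q I w = {w'. walk_equiv Q I w w'}"

definition pi1_at ::
    "('v, 'a) pre_digraph \<Rightarrow> (('v, 'a) qpath \<Rightarrow>\<^sub>0 'k::field) set \<Rightarrow> 'v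
      \<Rightarrow> ('v, 'a \<times> bool) qpath set monoid" where
  "pi1_at Q I x =
    \<lparr>carrier = walk_class Q I ` {w \<in> walks Q. src w = x \<and> tgt w = x},
     monoid.mult = (\<lambda>X Y. \<Union>u\<in>X. \<Union>v\<in>Y. walk_class Q I (pcomp u v)),
     one = walk_class Q I (trivial_path x)\<rparr>"

definition base :: "'v set \<Rightarrow> 'v" where
  "base C = (SOME v. v \<in> C)"

text \<open>
  A walk starting in a component stays in it, so \<open>pi1_at Q I (base C)\<close> is the fundamental group of
  the component \<open>C\<close>. If \<open>Q\<close> is connected, the product has a single factor.
\<close>

definition pi1 ::
    "('v, 'a) pre_digraph \<Rightarrow> (('v, 'a) qpath \<Rightarrow>\<^sub>0 'k::field) set
      \<Rightarrow> ('v set \<Rightarrow> ('v, 'a \<times> bool) qpath set) monoid" where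
  "pi1 Q I = product_group (components Q) (\<lambda>C. pi1_at Q I (base C))"

definition abelianisation :: "('g, 'm) monoid_scheme \<Rightarrow> 'g set monoid" where
  "abelianisation G = G Mod derived G (carrier G)"

abbreviation pi1_ab ::
    "('v, 'a) pre_digraph \<Rightarrow> (('v, 'a) qpath \<Rightarrow>\<^sub>0 'k::field) set
      \<Rightarrow> ('v set \<Rightarrow> ('v, 'a \<times> bool) qpath set) set monoid" where
  "pi1_ab Q I \<equiv> abelianisation (pi1 Q I)"

text \<open>
  The class in the abelianised fundamental group of a closed walk \<open>w\<close> at an arbitrary vertex: \<open>w\<close> is
  conjugated by a walk \<open>\<gamma>\<close> from the base point of its component to the source of \<open>w\<close>; modulo
  commutators the choice of \<open>\<gamma>\<close> is irrelevant.
\<close>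

definition closed_walk_class_ab ::
    "('v, 'a) pre_digraph \<Rightarrow> (('v, 'a) qpath \<Rightarrow>\<^sub>0 'k::field) set
      \<Rightarrow> ('v, 'a \<times> bool) qpath \<Rightarrow> ('v set \<Rightarrow> ('v, 'a \<times> bool) qpath set) set" where
  "closed_walk_class_ab Q I w = the_elem
    {derived (pi1 Q I) (carrier (pi1 Q I)) #>\<^bsub>pi1 Q I\<^esub>
       (\<lambda>D\<in>components Q. if D = component_of Q (src w)
          then walk_class Q I (pcomp (inv_walk \<gamma>) (pcomp w \<gamma>))
          else \<one>\<^bsub>pi1_at Q I (base D)\<^esub>)
     | \<gamma>. \<gamma> \<in> walks Q \<and> src \<gamma> = base (component_of Q (src w)) \<and> tgt \<gamma> = src w}"

text \<open>
  The map on abelianised fundamental groups induced by an inclusion of quivers. The element \<open>t\<close> has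
  one entry, a class of closed walks, for every component of the subquiver.
\<close>

definition pi1_to_pi1_ab ::
    "('v, 'a) pre_digraph \<Rightarrow> ('v, 'a) pre_digraph \<Rightarrow> (('v, 'a) qpath \<Rightarrow>\<^sub>0 'k::field) set
      \<Rightarrow> ('v set \<Rightarrow> ('v, 'a \<times> bool) qpath set)
      \<Rightarrow> ('v set \<Rightarrow> ('v, 'a \<times> bool) qpath set) set" where
  "pi1_to_pi1_ab QB QA IA t =
    (\<Otimes>\<^bsub>pi1_ab QA IA\<^esub> C \<in> components QB. the_elem (closed_walk_class_ab QA IA ` t C))"

definition pi1_ab_inclusion ::
    "('v, 'a) pre_digraph \<Rightarrow> ('v, 'a) pre_digraph \<Rightarrow> (('v, 'a) qpath \<Rightarrow>\<^sub>0 'k::field) set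
      \<Rightarrow> ('v set \<Rightarrow> ('v, 'a \<times> bool) qpath set) set
      \<Rightarrow> ('v set \<Rightarrow> ('v, 'a \<times> bool) qpath set) set" where
  "pi1_ab_inclusion QB QA IA X = the_elem (pi1_to_pi1_ab QB QA IA ` X)"


section \<open>Homomorphisms to the ground field and the rank\<close>

definition additive_group :: "'k::field monoid" where
  "additive_group = \<lparr>carrier = UNIV, monoid.mult = (+), one = 0\<rparr>"

text \<open>Homomorphisms are made unique as functions by the value 0 outside the carrier.\<close>

definition Hom_to_field :: "('g, 'm) monoid_scheme \<Rightarrow> ('g \<Rightarrow> 'k::field) set" where
  "Hom_to_field G = {f \<in> hom G additive_group. \<forall>x. x \<notin> carrier G \<longrightarrow> f x = 0}"

definition fun_dim :: "('g \<Rightarrow> 'k::field) set \<Rightarrow> nat" where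
  "fun_dim V = vector_space.dim (\<lambda>c f x. c * f x) V"

text \<open>
  Every finite quiver is isomorphic to one whose vertices and arrows are natural numbers, so these
  quivers suffice to run through all presentations.
\<close>

definition pi1_rank :: "('k::field, 'x, 'm) module_scheme \<Rightarrow> nat" where
  "pi1_rank A = Max
    {fun_dim (Hom_to_field (pi1 Q I) :: (_ \<Rightarrow> 'k) set)
     | (Q :: (nat, nat) pre_digraph) (I :: ((nat, nat) qpath \<Rightarrow>\<^sub>0 'k) set).
     fin_digraph Q \<and> admissible Q I \<and> alg_isomorphic A (bound_quiver_algebra Q I)}"

end

theory Submission
  imports Defs
begin

text \<open>
  Every minimal relation of a monomial ideal is a multiple of a single path, so the fundamental group
  of a monomial bound quiver is the one of its quiver. Let \<open>F\<close> be the set of arrows of a maximal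
  forest. Counting with signs how often a closed walk passes through the arrows outside \<open>F\<close>
  identifies the abelianised fundamental group with the free abelian group on these arrows, and their
  number is the Betti number. If \<open>F\<close> is the set of arrows of \<open>T\<close>, then \<open>F \<inter> arcs QB\<close> is a maximal
  forest of \<open>QB\<close>, and the inclusion of \<open>QB\<close> into \<open>QA\<close> becomes the inclusion of the free group on
  the arrows of \<open>QB\<close> outside \<open>F\<close> into the one on the arrows of \<open>QA\<close> outside \<open>F\<close>. The quotient is
  free on the remaining arrows, which are exactly the arrows of the relative quiver outside \<open>F\<close>.

  For any admissible ideal the arrows outside a maximal forest still generate the abelianised
  fundamental group, so the space of homomorphisms to the field has at most the dimension of the Betti
  number. The latter depends on the algebra only: the characters of the algebra are its vertices,
  and the twisted derivations between two characters count the arrows. Hence the rank of a monomial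
  algebra is the Betti number of its quiver.
\<close>

text \<open>Different presentations of one algebra can have different fundamental groups, and an
  isomorphism of bound quiver algebras need not send trivial paths to trivial paths or arrows to
  arrows. Hence quivers are compared through linear functionals on the algebra, which every
  isomorphism transports. Characters and twisted derivations are governed by the coefficients at
  paths of length at most one, and these coefficients are well defined modulo an admissible ideal.

  \<open>QB\<close> may be disconnected although \<open>QA\<close> is not, so everything is done for
  forests with one base point per component. Classes are compared only through integer functions on
  arrows; in these coordinates the map induced by the inclusion of quivers is an inclusion of sets
  of functions, and no group element has to be manipulated directly.

  The null-homotopy of closed forest walks is proved once for arbitrary bound quivers and used
  twice: it kills forest walks in fundamental groups, and for the zero ideal it yields the
  combinatorics of forests.\<close>

abbreviation keys :: "('b \<Rightarrow>\<^sub>0 'c::zero) \<Rightarrow> 'b set" where "keys \<equiv> Poly_Mapping.keys"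
abbreviation lookup :: "('b \<Rightarrow>\<^sub>0 'c::zero) \<Rightarrow> 'b \<Rightarrow> 'c" where "lookup \<equiv> Poly_Mapping.lookup"
abbreviation single :: "'b \<Rightarrow> 'c \<Rightarrow> 'b \<Rightarrow>\<^sub>0 'c::zero" where "single \<equiv> Poly_Mapping.single"

section \<open>Walks\<close>

lemma qpath_simps [simp]:
  "src (u, p, v) = u" "arrs (u, p, v) = p" "tgt (u, p, v) = v"
  "pcomp (v', q, w) (u, p, v) = (u, p @ q, w)"
  "inv_walk (u, x, v) = (v, rev (map (\<lambda>(a, b). (a, \<not> b)) x), u)"
  "path_walk (u, p, v) = (u, map (\<lambda>a. (a, True)) p, v)"
  by (simp_all add: src_def arrs_def tgt_def pcomp_def inv_walk_def path_walk_def)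

lemma qpath_collapse [simp]: "(src p, arrs p, tgt p) = p"
  by (simp add: src_def arrs_def tgt_def)

lemma pcomp_sel [simp]:
  "src (pcomp p q) = src q" "arrs (pcomp p q) = arrs q @ arrs p" "tgt (pcomp p q) = tgt p"
  by (simp_all add: pcomp_def)

lemma trivial_path_sel [simp]:
  "src (trivial_path v) = v" "arrs (trivial_path v) = []" "tgt (trivial_path v) = v"
  by (simp_all add: trivial_path_def)

lemma double_quiver_simps [simp]:
  "verts (double_quiver Q) = verts Q" "arcs (double_quiver Q) = arcs Q \<times> UNIV"
  "tail (double_quiver Q) (a, b) = (if b then tail Q a else head Q a)"
  "head (double_quiver Q) (a, b) = (if b then head Q a else tail Q a)"
  by (simp_all add: double_quiver_def)

abbreviation dtail :: "('v, 'a) pre_digraph \<Rightarrow> 'a \<times> bool \<Rightarrow> 'v" where "dtail Q \<equiv> tail (double_quiver Q)"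
abbreviation dhead :: "('v, 'a) pre_digraph \<Rightarrow> 'a \<times> bool \<Rightarrow> 'v" where "dhead Q \<equiv> head (double_quiver Q)"

abbreviation rev_word :: "('a \<times> bool) list \<Rightarrow> ('a \<times> bool) list" where
  "rev_word p \<equiv> rev (map (\<lambda>(a, b). (a, \<not> b)) p)"

lemma rev_word_rev_word [simp]: "rev_word (rev_word p) = p"
  by (induction p) auto

text \<open>Walks of the double quiver restricted to an arrow set \<open>F\<close>, so that forest
  walks and all walks (\<open>F = UNIV\<close>) share one recursion. The empty walk still demands a
  vertex.\<close>

fun walk_on :: "('v, 'a) pre_digraph \<Rightarrow> 'a set \<Rightarrow> 'v \<Rightarrow> ('a \<times> bool) list \<Rightarrow> 'v \<Rightarrow> bool" where
  "walk_on Q F u [] v \<longleftrightarrow> u = v \<and> u \<in> verts Q"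
| "walk_on Q F u (x # p) v \<longleftrightarrow> fst x \<in> arcs Q \<inter> F \<and> u = dtail Q x \<and>
    walk_on Q F (dhead Q x) p v"

abbreviation walk :: "('v, 'a) pre_digraph \<Rightarrow> 'v \<Rightarrow> ('a \<times> bool) list \<Rightarrow> 'v \<Rightarrow> bool" where
  "walk Q \<equiv> walk_on Q UNIV"

locale quiver = wf_digraph Q for Q :: "('v, 'a) pre_digraph"
begin

lemma head_tail_double_quiver [simp]:
  assumes "fst x \<in> arcs Q"
  shows "dtail Q x \<in> verts Q" "dhead Q x \<in> verts Q"
  using assms by (cases x; auto)+

lemma wf_double_quiver: "wf_digraph (double_quiver Q)"
  by unfold_locales (auto split: if_splits)

lemma walk_on_verts:
  "walk_on Q F u p v \<Longrightarrow> u \<in> verts Q \<and> v \<in> verts Q"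
  by (induction p arbitrary: u) auto

lemma walk_on_arcs: "walk_on Q F u p v \<Longrightarrow> fst ` set p \<subseteq> arcs Q \<inter> F"
  by (induction p arbitrary: u) auto

lemma walk_on_append:
  "walk_on Q F u (p @ q) v \<longleftrightarrow> (\<exists>w. walk_on Q F u p w \<and> walk_on Q F w q v)"
  by (induction p arbitrary: u) (auto dest: walk_on_verts)

lemma walk_on_mono:
  "walk_on Q F u p v \<Longrightarrow> fst ` set p \<subseteq> F' \<Longrightarrow> walk_on Q F' u p v"
  by (induction p arbitrary: u) auto

lemma walk_on_mono_set: "walk_on Q F u p v \<Longrightarrow> F \<inter> arcs Q \<subseteq> F' \<Longrightarrow> walk_on Q F' u p v"
  by (induction p arbitrary: u) auto

lemma walk_on_rev: "walk_on Q F u p v \<Longrightarrow> walk_on Q F v (rev_word p) u"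
proof (induction p arbitrary: u)
  case (Cons x p)
  obtain a b where x: "x = (a, b)" by (cases x)
  with Cons show ?case
    by (auto simp: walk_on_append)
qed simp

lemma walk_on_UNIV_iff_awalk:
  "walk Q u p v \<longleftrightarrow> pre_digraph.awalk (double_quiver Q) u p v"
proof -
  interpret D: wf_digraph "double_quiver Q" by (rule wf_double_quiver)
  show ?thesis
    by (induction p arbitrary: u) (auto simp: D.awalk_simps)
qed

lemma in_walks_iff: "(u, p, v) \<in> walks Q \<longleftrightarrow> walk Q u p v"
  by (simp add: walks_def paths_def walk_on_UNIV_iff_awalk)

lemma in_walks_iff': "w \<in> walks Q \<longleftrightarrow> walk Q (src w) (arrs w) (tgt w)"
  by (metis in_walks_iff qpath_collapse)

lemma path_walk_in_walks: "p \<in> paths Q \<Longrightarrow> path_walk p \<in> walks Q"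
proof -
  have *: "awalk u p v \<Longrightarrow> walk Q u (map (\<lambda>a. (a, True)) p) v" for u p v
    by (induction p arbitrary: u) (auto simp: awalk_simps)
  assume "p \<in> paths Q"
  then show ?thesis by (cases p) (auto simp: paths_def in_walks_iff *)
qed

lemma in_component_of_iff: "v \<in> component_of Q u \<longleftrightarrow> (\<exists>p. walk Q u p v)"
proof -
  interpret D: wf_digraph "double_quiver Q" by (rule wf_double_quiver)
  show ?thesis
    by (simp add: component_of_def D.reachable_awalk walk_on_UNIV_iff_awalk)
qed

lemma component_of_refl [simp]: "u \<in> verts Q \<Longrightarrow> u \<in> component_of Q u"
  unfolding in_component_of_iff by (rule exI[of _ "[]"]) simp

lemma component_of_eq:
  assumes "v \<in> component_of Q u"
  shows "component_of Q v = component_of Q u"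
proof -
  obtain p where p: "walk Q u p v" using assms by (auto simp: in_component_of_iff)
  show ?thesis
    using p walk_on_rev[OF p] unfolding set_eq_iff in_component_of_iff
    by (metis walk_on_append)
qed

lemma component_of_walk: "walk_on Q F u p v \<Longrightarrow> component_of Q v = component_of Q u"
  by (rule component_of_eq) (auto simp: in_component_of_iff intro: walk_on_mono)

lemma component_of_subset: "component_of Q u \<subseteq> verts Q"
  by (auto simp: in_component_of_iff dest: walk_on_verts)

lemma in_components_iff:
  "C \<in> components Q \<Longrightarrow> v \<in> C \<longleftrightarrow> v \<in> verts Q \<and> component_of Q v = C"
  unfolding components_def using component_of_eq component_of_subset component_of_refl by blast

lemma base_in: "C \<in> components Q \<Longrightarrow> base C \<in> C"
  unfolding base_def components_def by (rule someI_ex) (use component_of_refl in blast)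

lemma base_in_verts: "C \<in> components Q \<Longrightarrow> base C \<in> verts Q"
  using base_in in_components_iff by blast

lemma component_of_base: "C \<in> components Q \<Longrightarrow> component_of Q (base C) = C"
  using base_in in_components_iff by blast

text \<open>The vertex list of a closed walk repeats its start, and the cycle condition drops the
  first entry. What remains is the list of heads, so simplicity becomes distinctness of the
  heads.\<close>

lemma cycle_double_quiver_iff:
  "pre_digraph.cycle (double_quiver Q) p \<longleftrightarrow>
    (\<exists>u. walk Q u p u) \<and> distinct (map (dhead Q) p) \<and> p \<noteq> []"
proof -
  interpret D: wf_digraph "double_quiver Q" by (rule wf_double_quiver)
  have "tl (D.awalk_verts u p) = map (dhead Q) p" if "walk Q u p u" for u
    using that D.awalk_verts_conv'[of u p u] unfolding walk_on_UNIV_iff_awalk by (auto simp: D.awalk_def)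
  then show ?thesis
    unfolding D.cycle_def walk_on_UNIV_iff_awalk[symmetric] by auto
qed

end

section \<open>Fundamental groups of bound quivers\<close>

text \<open>The assumption makes \<open>walk_equiv\<close> preserve end points, which lets
  composition descend to classes. Admissible ideals satisfy it because they are two-sided, the zero
  ideal vacuously.\<close>

locale bound_quiver = quiver Q for Q :: "('v, 'a) pre_digraph" +
  fixes I :: "(('v, 'a) qpath \<Rightarrow>\<^sub>0 'k::field) set"
  assumes minimal_relation_parallel:
    "\<lbrakk>minimal_relation I r; p \<in> keys r; q \<in> keys r\<rbrakk>
      \<Longrightarrow> p \<in> paths Q \<and> src p = src q \<and> tgt p = tgt q"
begin

abbreviation weq (infix "\<sim>" 50) where "weq \<equiv> walk_equiv Q I"
abbreviation wclass where "wclass \<equiv> walk_class Q I"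

lemma walk_equivD:
  "u \<sim> v \<Longrightarrow> u \<in> walks Q \<and> v \<in> walks Q \<and> src u = src v \<and> tgt u = tgt v"
proof (induction rule: walk_equiv.induct)
  case (comp u u' v v')
  then show ?case by (cases u; cases u'; cases v; cases v') (auto simp: in_walks_iff walk_on_append)
next
  case (relation r p q)
  then show ?case using minimal_relation_parallel[OF relation] minimal_relation_parallel[OF relation(1,3,2)]
    by (auto simp: path_walk_in_walks) (auto simp: path_walk_def)
qed (auto simp: in_walks_iff in_walks_iff' arrow_path_def trivial_path_def)

lemma wclass_eq: "u \<sim> v \<Longrightarrow> wclass u = wclass v"
  unfolding walk_class_def using walk_equiv.trans walk_equiv.sym by blast

lemma in_wclass_iff: "v \<in> wclass u \<longleftrightarrow> u \<sim> v"
  by (simp add: walk_class_def)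

lemma weq_comp_word:
  assumes "(v, q, w) \<sim> (v, q', w)" "(u, p, v) \<sim> (u, p', v)"
  shows "(u, p @ q, w) \<sim> (u, p' @ q', w)"
  using walk_equiv.comp[OF assms] by simp

lemma weq_refl: "walk Q u p v \<Longrightarrow> (u, p, v) \<sim> (u, p, v)"
  by (simp add: in_walks_iff walk_equiv.refl)

lemma weq_delete:
  assumes "walk Q u p v" "(v, c, v) \<sim> (v, [], v)" "walk Q v q w"
  shows "(u, p @ c @ q, w) \<sim> (u, p @ q, w)"
  using weq_comp_word[OF weq_comp_word[OF weq_refl[OF assms(3)] assms(2)] weq_refl[OF assms(1)]]
  by simp

lemma cancel_arrow:
  assumes "a \<in> arcs Q"
  shows "(dtail Q (a, b), [(a, b), (a, \<not> b)], dtail Q (a, b))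
    \<sim> (dtail Q (a, b), [], dtail Q (a, b))"
  using walk_equiv.cancel_left[OF assms HOL.refl, of I] walk_equiv.cancel_right[OF assms HOL.refl, of I]
  by (cases b) (auto simp: arrow_path_def trivial_path_def)

lemma rev_cancel:
  "walk Q u p v \<Longrightarrow> (u, p @ rev_word p, u) \<sim> (u, [], u)"
proof (induction p arbitrary: u)
  case Nil
  then show ?case by (auto intro: weq_refl)
next
  case (Cons x p)
  obtain a b where x: "x = (a, b)" by (cases x)
  let ?w = "dhead Q x"
  from Cons.prems have p: "walk Q ?w p v" and u: "u = dtail Q x" and a: "a \<in> arcs Q"
    by (auto simp: x)
  have 1: "walk Q u [x] ?w" "walk Q ?w [(a, \<not> b)] u" using u a by (auto simp: x)
  have "(u, [x] @ (p @ rev_word p) @ [(a, \<not> b)], u) \<sim> (u, [x] @ [(a, \<not> b)], u)"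
    by (rule weq_delete[OF 1(1) Cons.IH[OF p] 1(2)])
  moreover have "(u, [x] @ [(a, \<not> b)], u) \<sim> (u, [], u)"
    using cancel_arrow[OF a, of b] unfolding u x by simp
  ultimately show ?case using walk_equiv.trans by (fastforce simp: x)
qed

lemma pi1_at_carrier:
  "X \<in> carrier (pi1_at Q I x) \<longleftrightarrow> (\<exists>p. X = wclass (x, p, x) \<and> walk Q x p x)"
proof
  assume "X \<in> carrier (pi1_at Q I x)"
  then show "\<exists>p. X = wclass (x, p, x) \<and> walk Q x p x"
    by (force simp: pi1_at_def in_walks_iff)
next
  assume "\<exists>p. X = wclass (x, p, x) \<and> walk Q x p x"
  then show "X \<in> carrier (pi1_at Q I x)"
    by (force simp: pi1_at_def in_walks_iff image_iff)
qed

text \<open>All the classes in the union coincide, since \<open>walk_equiv\<close> is a congruence.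
  The order of the words is reversed because \<open>pcomp\<close> traverses its second argument
  first.\<close>

lemma pi1_at_mult:
  assumes "walk Q x p x" "walk Q x q x"
  shows "wclass (x, q, x) \<otimes>\<^bsub>pi1_at Q I x\<^esub> wclass (x, p, x) = wclass (x, p @ q, x)"
proof -
  have "wclass (pcomp u v) = wclass (x, p @ q, x)" if "(x, q, x) \<sim> u" "(x, p, x) \<sim> v" for u v
    using walk_equiv.comp[OF that] by (simp add: wclass_eq)
  then have "(\<Union>u\<in>wclass (x, q, x). \<Union>v\<in>wclass (x, p, x). wclass (pcomp u v))
      = (\<Union>u\<in>wclass (x, q, x). \<Union>v\<in>wclass (x, p, x). wclass (x, p @ q, x))"
    by (intro SUP_cong refl) (auto simp: in_wclass_iff)
  moreover have "(x, q, x) \<in> wclass (x, q, x)" "(x, p, x) \<in> wclass (x, p, x)"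
    by (simp_all add: in_wclass_iff weq_refl assms)
  ultimately show ?thesis
    unfolding pi1_at_def by auto
qed

lemma pi1_at_one: "\<one>\<^bsub>pi1_at Q I x\<^esub> = wclass (x, [], x)"
  by (simp add: pi1_at_def trivial_path_def)

lemma group_pi1_at:
  assumes "x \<in> verts Q"
  shows "group (pi1_at Q I x)"
proof (rule groupI)
  fix X assume "X \<in> carrier (pi1_at Q I x)"
  then obtain p where p: "X = wclass (x, p, x)" "walk Q x p x"
    by (auto simp: pi1_at_carrier)
  show "\<one>\<^bsub>pi1_at Q I x\<^esub> \<otimes>\<^bsub>pi1_at Q I x\<^esub> X = X"
    using p assms by (simp add: pi1_at_one pi1_at_mult)
  show "\<exists>Y\<in>carrier (pi1_at Q I x). Y \<otimes>\<^bsub>pi1_at Q I x\<^esub> X = \<one>\<^bsub>pi1_at Q I x\<^esub>"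
    using p walk_on_rev[OF p(2)] wclass_eq[OF rev_cancel[OF p(2)]]
    by (intro bexI[of _ "wclass (x, rev_word p, x)"]) (auto simp: pi1_at_carrier pi1_at_one pi1_at_mult)
next
  fix X Y assume "X \<in> carrier (pi1_at Q I x)" "Y \<in> carrier (pi1_at Q I x)"
  then show "X \<otimes>\<^bsub>pi1_at Q I x\<^esub> Y \<in> carrier (pi1_at Q I x)"
    by (auto simp: pi1_at_carrier pi1_at_mult) (use walk_on_append in blast)
next
  fix X Y Z assume "X \<in> carrier (pi1_at Q I x)" "Y \<in> carrier (pi1_at Q I x)" "Z \<in> carrier (pi1_at Q I x)"
  then obtain p q r where *: "X = wclass (x, p, x)" "walk Q x p x"
    "Y = wclass (x, q, x)" "walk Q x q x" "Z = wclass (x, r, x)" "walk Q x r x"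
    by (auto simp: pi1_at_carrier)
  moreover have "walk Q x (q @ p) x" "walk Q x (r @ q) x"
    using * by (auto simp: walk_on_append)
  ultimately show "X \<otimes>\<^bsub>pi1_at Q I x\<^esub> Y \<otimes>\<^bsub>pi1_at Q I x\<^esub> Z = X \<otimes>\<^bsub>pi1_at Q I x\<^esub> (Y \<otimes>\<^bsub>pi1_at Q I x\<^esub> Z)"
    by (simp add: pi1_at_mult)
qed (auto simp: pi1_at_carrier pi1_at_one assms intro!: exI[of _ "[]"])

lemma group_pi1: "group (pi1 Q I)"
  unfolding pi1_def by (intro product_group group_pi1_at base_in_verts)

end

section \<open>Signed arrow counts\<close>

text \<open>The exponent sum of \<open>c\<close> in a word of the free group on the arrows.\<close>

fun signed_count :: "('a \<times> bool) list \<Rightarrow> 'a \<Rightarrow> int" where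
  "signed_count [] c = 0"
| "signed_count (x # p) c = (if fst x = c then if snd x then 1 else -1 else 0) + signed_count p c"

lemma signed_count_append [simp]: "signed_count (p @ q) c = signed_count p c + signed_count q c"
  by (induction p) auto

lemma signed_count_rev_word [simp]: "signed_count (rev_word p) c = - signed_count p c"
  by (induction p) auto

lemma signed_count_eq_0: "c \<notin> fst ` set p \<Longrightarrow> signed_count p c = 0"
  by (induction p) auto

text \<open>With one-term minimal relations the clause \<open>relation\<close> identifies a path
  only with itself. The equivalence is then free reduction of walks, so exponent sums are
  invariants. Monomial ideals and the zero ideal are the instances.\<close>

locale free_bound_quiver = bound_quiver +
  assumes minimal_relation_unique:
    "\<lbrakk>minimal_relation I r; p \<in> keys r; q \<in> keys r\<rbrakk> \<Longrightarrow> p = q"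
begin

lemma walk_equiv_signed_count: "u \<sim> v \<Longrightarrow> signed_count (arrs u) = signed_count (arrs v)"
proof (induction rule: walk_equiv.induct)
  case (relation r p q)
  then show ?case using minimal_relation_unique by blast
qed (auto simp: arrow_path_def)

end

lemma (in quiver) free_bound_quiver_zero:
  "free_bound_quiver Q {0 :: ('v, 'a) qpath \<Rightarrow>\<^sub>0 'k::field}"
  by unfold_locales (auto simp: minimal_relation_def)

section \<open>Spanning forests\<close>

text \<open>Distinct heads make the closed walk simple. Distinct arrows are required as well,
  because an arrow between two vertices followed by its inverse is also a simple closed
  walk.\<close>

definition acyclic_arcs :: "('v, 'a) pre_digraph \<Rightarrow> 'a set \<Rightarrow> bool" where
  "acyclic_arcs Q F \<longleftrightarrow> (\<forall>u p. walk_on Q F u p u \<and> distinct (map (dhead Q) p) \<and>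
    distinct (map fst p) \<longrightarrow> p = [])"

definition spanning_forest :: "('v, 'a) pre_digraph \<Rightarrow> 'a set \<Rightarrow> bool" where
  "spanning_forest Q F \<longleftrightarrow> F \<subseteq> arcs Q \<and> acyclic_arcs Q F \<and>
    (\<forall>u p v. walk Q u p v \<longrightarrow> (\<exists>q. walk_on Q F u q v))"

lemma not_distinct_map_decomp:
  assumes "\<not> distinct (map f p)"
  obtains xs x ys y zs where "p = xs @ x # ys @ y # zs" "f x = f y"
proof -
  obtain as bs cs y where "map f p = as @ [y] @ bs @ [y] @ cs"
    using not_distinct_decomp[OF assms] by blast
  then show ?thesis using that by (auto simp: map_eq_append_conv map_eq_Cons_conv Cons_eq_map_conv append_eq_map_conv)
qed

context bound_quiver
begin

text \<open>
  A closed walk in which an arrow or a vertex is repeated contains a shorter closed walk, which is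
  null-homotopic by induction and can be deleted; without repetitions it would be a cycle.
\<close>

lemma forest_null:
  assumes "acyclic_arcs Q F" "walk_on Q F u p u"
  shows "(u, p, u) \<sim> (u, [], u)"
  using assms(2)
proof (induction "length p" arbitrary: u p rule: less_induct)
  case less
  have weq: "walk Q x q y" if "walk_on Q F x q y" for x q y
    using that walk_on_mono by blast
  have shorten: "(u, p, u) \<sim> (u, [], u)"
    if "p = xs @ ys @ zs" "ys \<noteq> []" "walk_on Q F u xs t" "walk_on Q F t ys t" "walk_on Q F t zs u"
      and null: "(t, ys, t) \<sim> (t, [], t)" for xs ys zs t
  proof -
    have "(u, p, u) \<sim> (u, xs @ zs, u)"
      unfolding that(1) by (rule weq_delete[OF _ null]) (use that weq in blast)+
    moreover have "(u, xs @ zs, u) \<sim> (u, [], u)"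
      by (rule less.hyps) (use that in \<open>auto simp: walk_on_append\<close>)
    ultimately show ?thesis by (rule walk_equiv.trans)
  qed
  consider "p = []" | "p \<noteq> []" "\<not> distinct (map fst p)"
    | "p \<noteq> []" "\<not> distinct (map (dhead Q) p)"
    using less.prems assms(1) unfolding acyclic_arcs_def by blast
  then show ?case
  proof cases
    case 1
    then show ?thesis using weq_refl less.prems by auto
  next
    case 2
    obtain xs x ys y zs where p: "p = xs @ x # ys @ y # zs" "fst x = fst y"
      using not_distinct_map_decomp[OF 2(2)] by blast
    let ?t = "dtail Q" and ?h = "dhead Q"
    have w: "walk_on Q F u xs (?t x)" "walk_on Q F (?h x) ys (?t y)" "walk_on Q F (?h y) zs u"
      and x: "fst x \<in> arcs Q" "fst x \<in> F"
      using less.prems unfolding p by (auto simp: walk_on_append)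
    show ?thesis
    \<comment> \<open>Two traversals of the arrow in the same direction enclose the closed walk
      \<open>x # ys\<close>. In opposite directions they enclose a closed walk \<open>ys\<close> at
      the far end of \<open>x\<close>; once it is deleted, \<open>x\<close> and \<open>y\<close>
      cancel.\<close>
    proof (cases "snd x = snd y")
      case True
      then have xy: "y = x" using p(2) by (simp add: prod_eq_iff)
      have c: "walk_on Q F (?t x) (x # ys) (?t x)" using w x by (auto simp: xy)
      have nc: "(?t x, x # ys, ?t x) \<sim> (?t x, [], ?t x)"
        by (rule less.hyps[OF _ c]) (simp add: p)
      have p': "p = xs @ (x # ys) @ (x # zs)" by (simp add: p xy)
      have z: "walk_on Q F (?t x) (x # zs) u" using w(3) x by (simp add: xy)
      show ?thesis by (rule shorten[OF p' _ w(1) c z nc]) simp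
    next
      case False
      then have xy: "y = (fst x, \<not> snd x)" using p(2) by (auto simp: prod_eq_iff)
      then have th: "?t y = ?h x" "?h y = ?t x" by (cases x; simp)+
      have nys: "(?h x, ys, ?h x) \<sim> (?h x, [], ?h x)"
        by (rule less.hyps) (use w th p in auto)
      have c2: "(?t x, [x, y], ?t x) \<sim> (?t x, [], ?t x)"
        using cancel_arrow[OF x(1), of "snd x"] xy by simp
      have "(?t x, [x] @ ys @ [y], ?t x) \<sim> (?t x, [x] @ [y], ?t x)"
        by (rule weq_delete[OF _ nys]) (use x th xy in auto)
      then have c: "(?t x, x # ys @ [y], ?t x) \<sim> (?t x, [], ?t x)"
        using walk_equiv.trans c2 by fastforce
      show ?thesis
        by (rule shorten[of xs "x # ys @ [y]" zs "?t x"])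
          (use w x th p c in \<open>auto simp: walk_on_append\<close>)
    qed
  next
    case 3
    obtain xs x ys y zs where p: "p = xs @ x # ys @ y # zs"
      and xy: "dhead Q x = dhead Q y"
      using not_distinct_map_decomp[OF 3(2)] by blast
    let ?h = "dhead Q x"
    have w: "walk_on Q F u (xs @ [x]) ?h" "walk_on Q F ?h (ys @ [y]) ?h" "walk_on Q F ?h zs u"
      using less.prems unfolding p by (auto simp: walk_on_append xy)
    show ?thesis
      by (rule shorten[of "xs @ [x]" "ys @ [y]" zs ?h]) (use w p less.hyps[OF _ w(2)] in auto)
  qed
qed

end

context quiver
begin

text \<open>A closed forest walk is null-homotopic, and for the zero ideal equivalence preserves
  signed counts. The field \<open>rat\<close> is an arbitrary choice that gives the zero ideal a
  coefficient type.\<close>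

lemma forest_signed_count:
  assumes "acyclic_arcs Q F" "walk_on Q F u p u"
  shows "signed_count p a = 0"
proof -
  interpret free_bound_quiver Q "{0 :: ('v, 'a) qpath \<Rightarrow>\<^sub>0 rat}" by (rule free_bound_quiver_zero)
  show ?thesis using walk_equiv_signed_count[OF forest_null[OF assms]] by simp
qed

definition forest_walk :: "'a set \<Rightarrow> 'v \<Rightarrow> ('a \<times> bool) list" where
  "forest_walk F v = (SOME p. walk_on Q F (base (component_of Q v)) p v)"

lemma forest_walk:
  assumes "spanning_forest Q F" "v \<in> verts Q"
  shows "walk_on Q F (base (component_of Q v)) (forest_walk F v) v"
proof -
  let ?C = "component_of Q v"
  have "?C \<in> components Q" using assms by (simp add: components_def)
  then have "v \<in> component_of Q (base ?C)" using component_of_base assms component_of_refl by simp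
  then have "\<exists>p. walk_on Q F (base ?C) p v"
    using assms(1) unfolding spanning_forest_def in_component_of_iff by blast
  then show ?thesis
    unfolding forest_walk_def by (rule someI_ex)
qed

text \<open>The forest walk to the tail, the arrow and the reversed forest walk to the head close up
  inside \<open>F\<close>, so their signed counts add up to zero.\<close>

lemma forest_walk_signed_count:
  assumes F: "spanning_forest Q F" and a: "a \<in> F"
  shows "signed_count (forest_walk F (head Q a)) c
    = signed_count (forest_walk F (tail Q a)) c + (if c = a then 1 else 0)"
proof -
  have arc: "a \<in> arcs Q" using F a by (auto simp: spanning_forest_def)
  let ?h = "head Q a" and ?t = "tail Q a"
  have "walk_on Q F ?t [(a, True)] ?h" using arc a by simp
  then have "component_of Q ?h = component_of Q ?t" by (rule component_of_walk)
  then have "walk_on Q F (base (component_of Q ?t)) (forest_walk F ?t @ (a, True) # rev_word (forest_walk F ?h))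
      (base (component_of Q ?t))"
    using forest_walk[OF F, of ?t] walk_on_rev[OF forest_walk[OF F, of ?h]] arc a
    by (auto simp: walk_on_append)
  then have "signed_count (forest_walk F ?t @ (a, True) # rev_word (forest_walk F ?h)) c = 0"
    by (rule forest_signed_count[rotated]) (use F in \<open>simp add: spanning_forest_def\<close>)
  then show ?thesis by (auto split: if_splits)
qed

text \<open>
  Over the field with two elements, a set \<open>X\<close> of vertices is determined by its trace on the base
  points and its coboundary on \<open>F\<close>, and both can be prescribed; so \<open>2 ^ n = 2 ^ c * 2 ^ card F\<close>.
\<close>

lemma spanning_forest_card:
  assumes fin: "finite (verts Q)" "finite (arcs Q)" and F: "spanning_forest Q F"
  shows "card (verts Q) = card (components Q) + card F"
proof -
  define R where "R = base ` components Q"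
  define \<delta> where "\<delta> X = (X \<inter> R, {a \<in> F. (head Q a \<in> X) \<noteq> (tail Q a \<in> X)})" for X
  have Fsub: "F \<subseteq> arcs Q" using F by (simp add: spanning_forest_def)
  have finF: "finite F" using Fsub fin finite_subset by blast
  have finC: "finite (components Q)" using fin by (simp add: components_def)
  have RV: "R \<subseteq> verts Q" using base_in_verts by (auto simp: R_def)
  have "inj_on \<delta> (Pow (verts Q))"
  proof (rule inj_onI)
    fix X Y assume XY: "X \<in> Pow (verts Q)" "Y \<in> Pow (verts Q)" "\<delta> X = \<delta> Y"
    \<comment> \<open>Equal coboundaries on \<open>F\<close> carry agreement of \<open>X\<close> and
      \<open>Y\<close> across each arrow of \<open>F\<close>, hence from the base point along the
      whole forest walk.\<close>
    have step: "v \<in> X \<longleftrightarrow> v \<in> Y" if "walk_on Q F u p v" "u \<in> X \<longleftrightarrow> u \<in> Y" for u p v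
      using that
    proof (induction p arbitrary: u)
      case (Cons x p)
      obtain a b where x: "x = (a, b)" by (cases x)
      have "(head Q a \<in> X) \<noteq> (tail Q a \<in> X) \<longleftrightarrow> (head Q a \<in> Y) \<noteq> (tail Q a \<in> Y)"
        using XY(3) Cons.prems(1) by (auto simp: \<delta>_def x set_eq_iff)
      then show ?case using Cons by (auto simp: x split: if_splits)
    qed auto
    have "v \<in> X \<longleftrightarrow> v \<in> Y" if v: "v \<in> verts Q" for v
    proof (rule step[OF forest_walk[OF F v]])
      have "base (component_of Q v) \<in> R" using v by (simp add: R_def components_def)
      then show "base (component_of Q v) \<in> X \<longleftrightarrow> base (component_of Q v) \<in> Y"
        using XY(3) by (auto simp: \<delta>_def)
    qed
    then show "X = Y" using XY by auto
  qed
  moreover have "\<delta> ` Pow (verts Q) = Pow R \<times> Pow F"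
  proof
    show "\<delta> ` Pow (verts Q) \<subseteq> Pow R \<times> Pow F" by (auto simp: \<delta>_def)
    show "Pow R \<times> Pow F \<subseteq> \<delta> ` Pow (verts Q)"
    proof clarify
      fix Y G assume Y: "Y \<subseteq> R" and G: "G \<subseteq> F"
      \<comment> \<open>Integration of the prescribed coboundary \<open>G\<close> along the forest
        walk to \<open>v\<close>. Only the parity matters, and membership of the base point in
        \<open>Y\<close> is the constant of integration.\<close>
      define n where "n v = (\<Sum>a\<in>G. signed_count (forest_walk F v) a)" for v
      define X where "X = {v \<in> verts Q. (base (component_of Q v) \<in> Y) \<noteq> odd (n v)}"
      have "r \<in> X \<longleftrightarrow> r \<in> Y" if r: "r \<in> R" for r
      proof -
        have rr: "base (component_of Q r) = r" using r component_of_base by (auto simp: R_def)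
        have "r \<in> verts Q" using r RV by blast
        then have "walk_on Q F r (forest_walk F r) r" using forest_walk[OF F, of r] rr by simp
        then have "signed_count (forest_walk F r) a = 0" for a
          by (rule forest_signed_count[rotated]) (use F in \<open>simp add: spanning_forest_def\<close>)
        then show ?thesis using \<open>r \<in> verts Q\<close> by (simp add: X_def rr n_def)
      qed
      moreover have "a \<in> G \<longleftrightarrow> (head Q a \<in> X) \<noteq> (tail Q a \<in> X)" if a: "a \<in> F" for a
      proof -
        have "walk_on Q F (tail Q a) [(a, True)] (head Q a)" using a Fsub by auto
        then have "component_of Q (head Q a) = component_of Q (tail Q a)" by (rule component_of_walk)
        moreover have "n (head Q a) = n (tail Q a) + (if a \<in> G then 1 else 0)"
          using finite_subset[OF G finF]
          by (simp add: n_def forest_walk_signed_count[OF F a] sum.distrib)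
        moreover have "head Q a \<in> verts Q" "tail Q a \<in> verts Q" using a Fsub by auto
        ultimately show ?thesis by (auto simp: X_def)
      qed
      ultimately have "\<delta> X = (Y, G)" using Y G by (auto simp: \<delta>_def)
      moreover have "X \<in> Pow (verts Q)" by (auto simp: X_def)
      ultimately show "(Y, G) \<in> \<delta> ` Pow (verts Q)" by (metis image_eqI)
    qed
  qed
  ultimately have "bij_betw \<delta> (Pow (verts Q)) (Pow R \<times> Pow F)" by (simp add: bij_betw_def)
  then have "card (Pow (verts Q)) = card (Pow R \<times> Pow F)" by (rule bij_betw_same_card)
  moreover have "finite R" using finC by (simp add: R_def)
  ultimately have "(2::nat) ^ card (verts Q) = 2 ^ (card R + card F)"
    using fin finF by (simp add: card_Pow card_cartesian_product power_add)
  moreover have "card R = card (components Q)"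
    unfolding R_def by (intro card_image inj_on_inverseI[of _ "component_of Q"] component_of_base)
  ultimately show ?thesis by simp
qed

lemma betti_eq_card:
  assumes fin: "finite (verts Q)" "finite (arcs Q)" and F: "spanning_forest Q F"
  shows "betti Q = int (card (arcs Q - F))"
proof -
  have "F \<subseteq> arcs Q" using F by (simp add: spanning_forest_def)
  moreover then have "card F \<le> card (arcs Q)" using fin by (simp add: card_mono)
  ultimately show ?thesis
    unfolding betti_def spanning_forest_card[OF assms]
    using fin by (simp add: card_Diff_subset finite_subset of_nat_diff)
qed

section \<open>Enlarging acyclic arrow sets\<close>

lemma walk_on_insertD:
  "walk_on Q (insert a F) u p v \<Longrightarrow> a \<notin> fst ` set p \<Longrightarrow> walk_on Q F u p v"
  by (induction p arbitrary: u) auto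

text \<open>A cycle through \<open>a\<close> uses it exactly once, since its arrows are distinct.
  Cutting it open there leaves a walk in \<open>F\<close> between the ends of
  \<open>a\<close>.\<close>

lemma acyclic_insert:
  assumes F: "acyclic_arcs Q F" and no: "\<nexists>q. walk_on Q F (tail Q a) q (head Q a)"
  shows "acyclic_arcs Q (insert a F)"
  unfolding acyclic_arcs_def
proof (intro allI impI)
  fix u p assume p: "walk_on Q (insert a F) u p u \<and> distinct (map (dhead Q) p) \<and>
      distinct (map fst p)"
  show "p = []"
  proof (cases "a \<in> fst ` set p")
    case False
    then have "walk_on Q F u p u" using p walk_on_insertD by blast
    then show ?thesis using F p unfolding acyclic_arcs_def by blast
  next
    case True
    then obtain x xs ys where x: "p = xs @ x # ys" "a = fst x" by (auto simp: in_set_conv_decomp)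
    then have "walk_on Q (insert a F) u xs (dtail Q x)"
        "walk_on Q (insert a F) (dhead Q x) ys u"
        "a \<notin> fst ` set xs" "a \<notin> fst ` set ys"
      using p by (auto simp: walk_on_append)
    then have "walk_on Q F u xs (dtail Q x)" "walk_on Q F (dhead Q x) ys u"
      by (blast intro: walk_on_insertD)+
    then have w: "walk_on Q F (dhead Q x) (ys @ xs) (dtail Q x)"
      by (auto simp: walk_on_append)
    have False
    proof (cases "snd x")
      case True
      then have "walk_on Q F (head Q a) (ys @ xs) (tail Q a)" using w x by (cases x) auto
      then show False using no walk_on_rev by blast
    next
      case False
      then have "walk_on Q F (tail Q a) (ys @ xs) (head Q a)" using w x by (cases x) auto
      then show False using no by blast
    qed
    then show ?thesis ..
  qed
qed

lemma walk_on_if_arcs_connected: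
  assumes "\<And>a. a \<in> arcs Q \<Longrightarrow> \<exists>q. walk_on Q F (tail Q a) q (head Q a)"
  shows "walk Q u p v \<Longrightarrow> \<exists>q. walk_on Q F u q v"
proof (induction p arbitrary: u)
  case Nil
  then show ?case by (auto intro!: exI[of _ "[]"])
next
  case (Cons x p)
  obtain a b where x: "x = (a, b)" by (cases x)
  obtain q where q: "walk_on Q F (dhead Q x) q v" using Cons by auto
  obtain r where "walk_on Q F (tail Q a) r (head Q a)" using assms Cons.prems x by auto
  moreover from this have "walk_on Q F (head Q a) (rev_word r) (tail Q a)" by (rule walk_on_rev)
  ultimately have "\<exists>r. walk_on Q F u r (dhead Q x)"
    using Cons.prems by (cases b) (auto simp: x)
  with q show ?case using walk_on_append by metis
qed

text \<open>A maximal acyclic set spans: an arrow whose ends it does not connect could be added by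
  \<open>acyclic_insert\<close>.\<close>

lemma exists_spanning_forest:
  assumes "finite (arcs Q)"
  shows "\<exists>F. spanning_forest Q F"
proof -
  define S where "S = {F. F \<subseteq> arcs Q \<and> acyclic_arcs Q F}"
  have "p = []" if "walk_on Q {} u p v" for u p v using that by (cases p) auto
  then have "{} \<in> S" by (auto simp: S_def acyclic_arcs_def)
  moreover have "finite S" using assms by (simp add: S_def)
  ultimately obtain F where F: "F \<in> S" "\<And>G. G \<in> S \<Longrightarrow> F \<subseteq> G \<Longrightarrow> F = G"
    using finite_has_maximal[of S] by blast
  have "\<exists>q. walk_on Q F (tail Q a) q (head Q a)" if a: "a \<in> arcs Q" for a
  proof (rule ccontr)
    assume no: "\<nexists>q. walk_on Q F (tail Q a) q (head Q a)"
    then have "insert a F \<in> S" using acyclic_insert[OF _ no] F(1) a by (auto simp: S_def)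
    then have "a \<in> F" using F(2) by blast
    then have "walk_on Q F (tail Q a) [(a, True)] (head Q a)" using a by simp
    then show False using no by blast
  qed
  then have "spanning_forest Q F"
    using F(1) walk_on_if_arcs_connected unfolding spanning_forest_def S_def by blast
  then show ?thesis ..
qed

end

section \<open>Maximal trees\<close>

lemma subgraphD:
  assumes "subgraph S Q"
  shows "wf_digraph S" "verts S \<subseteq> verts Q" "arcs S \<subseteq> arcs Q" "tail S = tail Q" "head S = head Q"
    "dtail S = dtail Q" "dhead S = dhead Q"
  using assms by (auto simp: subgraph_def compatible_def double_quiver_def)

text \<open>The vertex condition matters for the empty walk only; a nonempty walk along arrows of
  \<open>S\<close> stays in \<open>S\<close> by well-formedness.\<close>

lemma walk_on_subgraph:
  assumes "subgraph S Q"
  shows "walk_on S F u p v \<longleftrightarrow> u \<in> verts S \<and> walk_on Q (F \<inter> arcs S) u p v"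
proof -
  note S = subgraphD[OF assms] and dq = subgraphD(6,7)[OF assms]
  interpret S: quiver S using S(1) by (simp add: quiver_def)
  show ?thesis
  proof (induction p arbitrary: u)
    case (Cons x p)
    show ?case
      using Cons[of "dhead Q x"] S(3) S.head_tail_double_quiver[of x]
      by (auto simp: dq)
  qed (use S in auto)
qed

lemma connected_iff_walk_on:
  assumes "wf_digraph T"
  shows "Digraph_Component.connected T \<longleftrightarrow>
    verts T \<noteq> {} \<and> (\<forall>u\<in>verts T. \<forall>v\<in>verts T. \<exists>p. walk T u p v)"
proof -
  interpret T: quiver T using assms by (simp add: quiver_def)
  interpret D: wf_digraph "double_quiver T" by (rule T.wf_double_quiver)
  \<comment> \<open>Reachability sees only the pairs of end points of arrows, and the symmetric
    closure and the double quiver have the same pairs.\<close>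
  have ends: "arcs_ends (with_proj (mk_symmetric T)) = arcs_ends (double_quiver T)"
  proof (rule Set.set_eqI)
    fix e :: "'a \<times> 'a"
    obtain x y where e: "e = (x, y)" by (cases e)
    have "(x, y) \<in> arcs_ends (double_quiver T) \<longleftrightarrow>
        (\<exists>a\<in>arcs T. (x = tail T a \<and> y = head T a) \<or> (x = head T a \<and> y = tail T a))"
    proof -
      have "arcs_ends (double_quiver T) = (\<Union>a\<in>arcs T. {(tail T a, head T a), (head T a, tail T a)})"
        unfolding arcs_ends_conv
        by (auto simp: image_iff split: if_splits) (metis (full_types))+
      then show ?thesis by auto
    qed
    then show "e \<in> arcs_ends (with_proj (mk_symmetric T)) \<longleftrightarrow> e \<in> arcs_ends (double_quiver T)"
      unfolding e by (auto simp: arcs_ends_conv mk_symmetric_def)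
  qed
  have "u \<rightarrow>\<^sup>*\<^bsub>with_proj (mk_symmetric T)\<^esub> v \<longleftrightarrow> (\<exists>p. walk T u p v)" for u v
    unfolding T.walk_on_UNIV_iff_awalk D.reachable_awalk[symmetric] reachable_def ends
    by (simp add: mk_symmetric_def)
  then show ?thesis
    unfolding Digraph_Component.connected_def strongly_connected_def
    by (simp add: mk_symmetric_def)
qed

lemma quiver_tree_iff:
  assumes "wf_digraph T"
  shows "quiver_tree T \<longleftrightarrow> verts T \<noteq> {} \<and>
    (\<forall>u\<in>verts T. \<forall>v\<in>verts T. \<exists>p. walk T u p v) \<and> acyclic_arcs T UNIV"
proof -
  interpret T: quiver T using assms by (simp add: quiver_def)
  show ?thesis
    unfolding quiver_tree_def connected_iff_walk_on[OF assms] T.cycle_double_quiver_iff acyclic_arcs_def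
    by blast
qed

context quiver
begin

lemma acyclic_arcs_subgraph:
  assumes "subgraph S Q"
  shows "acyclic_arcs S F \<longleftrightarrow> acyclic_arcs Q (F \<inter> arcs S)"
proof -
  note S = subgraphD[OF assms] and dq = subgraphD(6,7)[OF assms]
  interpret S: quiver S using S(1) by (simp add: quiver_def)
  have "p \<noteq> [] \<Longrightarrow> walk_on Q (F \<inter> arcs S) u p u \<Longrightarrow> u \<in> verts S" for u p
    using S.head_tail_double_quiver(1)[of "hd p"] unfolding dq by (cases p) auto
  then show ?thesis
    unfolding acyclic_arcs_def walk_on_subgraph[OF assms] dq by blast
qed

lemma walk_on_leaves:
  assumes "walk_on Q F u p v" "u \<in> X" "v \<notin> X"
  shows "\<exists>x. fst x \<in> arcs Q \<and> dtail Q x \<in> X \<and> dhead Q x \<notin> X"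
  using assms
proof (induction p arbitrary: u)
  case (Cons x p)
  show ?case
  proof (cases "dhead Q x \<in> X")
    case True
    then show ?thesis using Cons.IH[of "dhead Q x"] Cons.prems by simp
  next
    case False
    then show ?thesis using Cons.prems by (intro exI[of _ x]) simp
  qed
qed auto

text \<open>If a tree misses a vertex, connectedness of \<open>Q\<close> provides an arrow between
  the tree and its complement. This arrow together with its outer end enlarges the tree,
  contradicting maximality.\<close>

lemma maximal_tree_spans:
  assumes conn: "\<forall>u\<in>verts Q. \<forall>v\<in>verts Q. \<exists>p. walk Q u p v"
    and max: "maximal_tree Q S"
  shows "acyclic_arcs Q (arcs S)" "verts S = verts Q"
    "\<And>u v. u \<in> verts Q \<Longrightarrow> v \<in> verts Q \<Longrightarrow> \<exists>p. walk_on Q (arcs S) u p v"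
proof -
  have sub: "subgraph S Q" and tree: "quiver_tree S"
    and maxi: "\<And>S'. subgraph S S' \<Longrightarrow> subgraph S' Q \<Longrightarrow> quiver_tree S' \<Longrightarrow> S' = S"
    using max unfolding maximal_tree_def max_subgraph_def by blast+
  note S = subgraphD[OF sub]
  interpret S: quiver S using S(1) by (simp add: quiver_def)
  have ne: "verts S \<noteq> {}"
    and connS: "\<And>u v. u \<in> verts S \<Longrightarrow> v \<in> verts S \<Longrightarrow> \<exists>p. walk_on Q (arcs S) u p v"
    and ac: "acyclic_arcs Q (arcs S)"
    using tree unfolding quiver_tree_iff[OF S(1)] acyclic_arcs_subgraph[OF sub] walk_on_subgraph[OF sub]
    by auto
  show "acyclic_arcs Q (arcs S)" by (rule ac)
  show VS: "verts S = verts Q"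
  proof (rule ccontr)
    assume "verts S \<noteq> verts Q"
    then obtain v where v: "v \<in> verts Q" "v \<notin> verts S" using S by blast
    obtain u where u: "u \<in> verts S" using ne by blast
    obtain p where "walk Q u p v" using conn u v S by blast
    then obtain x where x: "fst x \<in> arcs Q" "dtail Q x \<in> verts S"
        "dhead Q x \<notin> verts S"
      using walk_on_leaves u v by blast
    define a where "a = fst x"
    define w where "w = dhead Q x"
    define S' where "S' = S\<lparr>verts := insert w (verts S), arcs := insert a (arcs S)\<rparr>"
    have S': "verts S' = insert w (verts S)" "arcs S' = insert a (arcs S)" "tail S' = tail Q" "head S' = head Q"
      by (simp_all add: S'_def S)
    have ends: "tail Q a \<in> insert w (verts S)" "head Q a \<in> insert w (verts S)"
      using x by (cases x; auto simp: a_def w_def split: if_splits)+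
    have wfS': "wf_digraph S'"
      using ends S.wellformed by unfold_locales (auto simp: S' S)
    have subS: "subgraph S S'" and subQ: "subgraph S' Q"
      using S wfS' x head_tail_double_quiver(2)[OF x(1)]
      by (auto simp: subgraph_def compatible_def S' a_def w_def intro: wf_digraph_axioms)
    have inS: "v \<in> verts S" if "walk_on Q (arcs S) u p v" "u \<in> verts S" for u p v
      using S.walk_on_verts[of UNIV u p v] that walk_on_subgraph[OF sub, of UNIV u p v] by simp
    \<comment> \<open>The new vertex \<open>w\<close> is outside \<open>S\<close>, so no walk inside
      \<open>S\<close> joins the ends of \<open>a\<close>; this is the hypothesis of
      \<open>acyclic_insert\<close>.\<close>
    have "\<nexists>q. walk_on Q (arcs S) (tail Q a) q (head Q a)"
    proof
      assume "\<exists>q. walk_on Q (arcs S) (tail Q a) q (head Q a)"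
      then obtain q where q: "walk_on Q (arcs S) (tail Q a) q (head Q a)" ..
      show False
      proof (cases "snd x")
        case True
        then show False using inS[OF q] x by (cases x) (auto simp: a_def)
      next
        case False
        then show False using inS[OF walk_on_rev[OF q]] x by (cases x) (auto simp: a_def)
      qed
    qed
    then have "acyclic_arcs Q (insert a (arcs S))" by (rule acyclic_insert[OF ac])
    then have acS': "acyclic_arcs S' UNIV" unfolding acyclic_arcs_subgraph[OF subQ] S' by simp
    have to: "\<exists>p. walk_on Q (arcs S') (dtail Q x) p z" if "z \<in> verts S'" for z
    proof (cases "z = w")
      case True
      have "walk_on Q (arcs S') (dtail Q x) [x] z"
        using x by (simp add: True S' w_def a_def)
      then show ?thesis by blast
    next
      case False
      then have "z \<in> verts S" using that S'(1) by simp
      from connS[OF x(2) this] obtain p where "walk_on Q (arcs S) (dtail Q x) p z" ..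
      then have "walk_on Q (arcs S') (dtail Q x) p z"
        by (rule walk_on_mono_set) (auto simp: S')
      then show ?thesis by blast
    qed
    have "\<exists>p. walk_on Q (arcs S') y p z" if y: "y \<in> verts S'" and z: "z \<in> verts S'" for y z
    proof -
      obtain p q where "walk_on Q (arcs S') (dtail Q x) p y"
          "walk_on Q (arcs S') (dtail Q x) q z"
        using to[OF y] to[OF z] by blast
      then have "walk_on Q (arcs S') y (rev_word p @ q) z"
        unfolding walk_on_append by (blast intro: walk_on_rev)
      then show ?thesis ..
    qed
    then have "quiver_tree S'"
      unfolding quiver_tree_iff[OF wfS'] walk_on_subgraph[OF subQ] using acS' by (simp add: S')
    from maxi[OF subS subQ this] have "w \<in> verts S" using S'(1) by auto
    then show False using x by (simp add: w_def)
  qed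
  show "\<exists>p. walk_on Q (arcs S) u p v" if "u \<in> verts Q" "v \<in> verts Q" for u v
    using connS that VS by simp
qed

text \<open>A walk that starts in a component never leaves it. So arrows selected by their tails
  have their heads in \<open>C\<close> too, and connecting walks of \<open>Q\<close> are walks of
  the component.\<close>

lemma component_quiver_walk:
  assumes C: "C \<in> components Q"
  shows "subgraph (component_quiver Q C) Q"
    "\<forall>u\<in>C. \<forall>v\<in>C. \<exists>p. walk (component_quiver Q C) u p v"
proof -
  let ?Q = "component_quiver Q C"
  have eq: "verts ?Q = C" "arcs ?Q = {a \<in> arcs Q. tail Q a \<in> C}" "tail ?Q = tail Q" "head ?Q = head Q"
    by (simp_all add: component_quiver_def)
  have step: "dhead Q x \<in> C" if "fst x \<in> arcs Q" "dtail Q x \<in> C" for x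
  proof -
    have "walk Q (dtail Q x) [x] (dhead Q x)" using that by simp
    then show ?thesis
      using component_of_walk that in_components_iff[OF C] head_tail_double_quiver(2) by metis
  qed
  have hd: "head Q a \<in> C" if "a \<in> arcs Q" "tail Q a \<in> C" for a
    using step[of "(a, True)"] that by simp
  have tl: "tail Q a \<in> C" if "a \<in> arcs Q" "head Q a \<in> C" for a
    using step[of "(a, False)"] that by simp
  have "wf_digraph ?Q" by unfold_locales (auto simp: eq hd)
  then show sub: "subgraph ?Q Q"
    using in_components_iff[OF C] by (auto simp: subgraph_def compatible_def eq intro: wf_digraph_axioms)
  have "\<exists>p. walk ?Q u p v" if u: "u \<in> C" and v: "v \<in> C" for u v
  proof -
    from u v have "v \<in> component_of Q u" using in_components_iff[OF C] component_of_refl by metis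
  then obtain p where p: "walk Q u p v" by (auto simp: in_component_of_iff)
  then have "fst ` set p \<subseteq> {a \<in> arcs Q. tail Q a \<in> C}" using u
  proof (induction p arbitrary: u)
    case (Cons x p)
    then show ?case using step[of x] tl by (cases x) (auto split: if_splits)
  qed simp
  then have "walk ?Q u p v"
    unfolding walk_on_subgraph[OF sub] eq by (auto intro: u walk_on_mono[OF p])
  then show ?thesis ..
  qed
  then show "\<forall>u\<in>C. \<forall>v\<in>C. \<exists>p. walk ?Q u p v" by blast
qed

end

text \<open>All three forests are cut out of the one tree \<open>T\<close>, so the coordinates they
  define are compatible. In \<open>QA\<close> and in the relative quiver \<open>T\<close> itself
  reaches every vertex; in \<open>QB\<close> two vertices of a component are joined by the maximal
  tree of that component, which lies in \<open>T\<close>.\<close>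

lemma extending_maximal_tree_forests:
  assumes A: "wf_digraph QA" and AB: "spanning QB QA"
    and conn: "\<forall>u\<in>verts QA. \<forall>v\<in>verts QA. \<exists>p. walk QA u p v"
    and T: "extending_maximal_tree QA QB T"
  shows "spanning_forest QA (arcs T)"
    "spanning_forest QB (arcs T \<inter> arcs QB)"
    "wf_digraph (relative_quiver QA QB T)"
    "spanning_forest (relative_quiver QA QB T) (arcs T)"
proof -
  interpret A: quiver QA using A by (simp add: quiver_def)
  have sub: "subgraph QB QA" and VB: "verts QA = verts QB" using AB by (auto simp: spanning_def)
  interpret B: quiver QB using subgraphD(1)[OF sub] by (simp add: quiver_def)
  have maxT: "maximal_tree QA T" using T by (simp add: extending_maximal_tree_def)
  have arcsT: "arcs T \<subseteq> arcs QA"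
    using maxT by (auto simp: maximal_tree_def pre_digraph.max_subgraph_def subgraph_def)
  note spans = A.maximal_tree_spans[OF conn maxT]
  show forestA: "spanning_forest QA (arcs T)"
    unfolding spanning_forest_def using arcsT spans A.walk_on_verts by blast
  let ?R = "relative_quiver QA QB T"
  have R: "verts ?R = verts QA" "arcs ?R = arcs QA - arcs QB \<union> arcs T" "tail ?R = tail QA" "head ?R = head QA"
    by (simp_all add: relative_quiver_def)
  show wfR: "wf_digraph ?R" by unfold_locales (use arcsT in \<open>auto simp: R\<close>)
  then have subR: "subgraph ?R QA"
    using arcsT A.wf_digraph_axioms by (auto simp: subgraph_def compatible_def R)
  have iR: "arcs T \<inter> arcs ?R = arcs T" by (auto simp: R)
  interpret R: quiver ?R using wfR by (simp add: quiver_def)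
  have "acyclic_arcs ?R (arcs T)" using spans(1) unfolding A.acyclic_arcs_subgraph[OF subR] iR .
  moreover have "\<exists>q. walk_on ?R (arcs T) u q v" if "walk ?R u p v" for u p v
    unfolding walk_on_subgraph[OF subR] iR using R.walk_on_verts[OF that] spans(3) by (auto simp: R)
  ultimately show "spanning_forest ?R (arcs T)" by (auto simp: spanning_forest_def R)
  have "acyclic_arcs QA (arcs T \<inter> arcs QB \<inter> arcs QB)"
    using spans(1) A.walk_on_mono_set[of "arcs T \<inter> arcs QB \<inter> arcs QB" _ _ _ "arcs T"]
    unfolding acyclic_arcs_def by blast
  then have "acyclic_arcs QB (arcs T \<inter> arcs QB)"
    unfolding A.acyclic_arcs_subgraph[OF sub] .
  moreover have "\<exists>q. walk_on QB (arcs T \<inter> arcs QB) u q v" if p: "walk QB u p v" for u p v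
  proof -
    define C where "C = component_of QB u"
    have C: "C \<in> components QB" using B.walk_on_verts[OF p] by (simp add: C_def components_def)
    have uv: "u \<in> C" "v \<in> C"
      using p B.walk_on_verts[OF p] B.component_of_refl[of u] B.in_component_of_iff[of v u]
      by (auto simp: C_def)
    obtain S where S: "maximal_tree (component_quiver QB C) S" "subgraph S T"
      using T C by (auto simp: extending_maximal_tree_def)
    note subC = B.component_quiver_walk(1)[OF C]
    have VC: "verts (component_quiver QB C) = C" by (simp add: component_quiver_def)
    interpret C: quiver "component_quiver QB C" using subC by (simp add: quiver_def subgraph_def)
    have "\<exists>p. walk_on (component_quiver QB C) (arcs S) u p v"
      using C.maximal_tree_spans(3)[OF _ S(1)] B.component_quiver_walk(2)[OF C] uv unfolding VC by blast
    then obtain q where "walk_on QB (arcs S \<inter> arcs (component_quiver QB C)) u q v"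
      unfolding walk_on_subgraph[OF subC] by blast
    moreover have "arcs S \<subseteq> arcs T" using S by (simp add: subgraph_def)
    moreover have "arcs (component_quiver QB C) \<subseteq> arcs QB" by (auto simp: component_quiver_def)
    ultimately have "walk_on QB (arcs T \<inter> arcs QB) u q v"
      using B.walk_on_mono_set[of "arcs S \<inter> arcs (component_quiver QB C)" u q v "arcs T \<inter> arcs QB"] by blast
    then show ?thesis ..
  qed
  ultimately show "spanning_forest QB (arcs T \<inter> arcs QB)" by (auto simp: spanning_forest_def)
qed

section \<open>The abelianised fundamental group\<close>

locale forested_quiver = bound_quiver Q I + fin_digraph Q
  for Q :: "('v, 'a) pre_digraph" and I :: "(('v, 'a) qpath \<Rightarrow>\<^sub>0 'k::field) set" +
  fixes F :: "'a set"
  assumes forest: "spanning_forest Q F"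
begin

abbreviation bs :: "'v \<Rightarrow> 'v" where "bs u \<equiv> base (component_of Q u)"
abbreviation \<gamma> :: "'v \<Rightarrow> ('a \<times> bool) list" where "\<gamma> \<equiv> forest_walk F"
abbreviation PI where "PI \<equiv> pi1 Q I"
abbreviation K where "K \<equiv> arcs Q - F"

text \<open>The embedding of the factor that belongs to \<open>C\<close> into the product
  group.\<close>

definition lift :: "'v set \<Rightarrow> ('v, 'a \<times> bool) qpath set \<Rightarrow> 'v set \<Rightarrow> ('v, 'a \<times> bool) qpath set" where
  "lift C X = (\<lambda>D\<in>components Q. if D = C then X else \<one>\<^bsub>pi1_at Q I (base D)\<^esub>)"

text \<open>Forest walks at both ends close up an arbitrary walk at the base point. For single
  arrows these are the classical generators of the fundamental group relative to a maximal
  tree.\<close>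

definition loop_class ::
    "'v \<Rightarrow> ('a \<times> bool) list \<Rightarrow> 'v \<Rightarrow> 'v set \<Rightarrow> ('v, 'a \<times> bool) qpath set" where
  "loop_class u p v = lift (component_of Q u) (wclass (bs u, \<gamma> u @ p @ rev_word (\<gamma> v), bs u))"

abbreviation arrow_loop where
  "arrow_loop a \<equiv> loop_class (tail Q a) [(a, True)] (head Q a)"

lemma forest_acyclic: "acyclic_arcs Q F"
  using forest by (auto simp: spanning_forest_def)

lemma finite_components: "finite (components Q)"
  by (simp add: components_def)

lemma carrier_pi1: "t \<in> carrier PI \<longleftrightarrow> t \<in> (\<Pi>\<^sub>E C\<in>components Q. carrier (pi1_at Q I (base C)))"
  by (simp add: pi1_def)

lemma one_pi1: "\<one>\<^bsub>PI\<^esub> = (\<lambda>C\<in>components Q. \<one>\<^bsub>pi1_at Q I (base C)\<^esub>)"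
  by (simp add: pi1_def)

lemma mult_pi1: "s \<otimes>\<^bsub>PI\<^esub> t = (\<lambda>C\<in>components Q. s C \<otimes>\<^bsub>pi1_at Q I (base C)\<^esub> t C)"
  by (simp add: pi1_def)

lemma group_base: "C \<in> components Q \<Longrightarrow> group (pi1_at Q I (base C))"
  by (intro group_pi1_at base_in_verts)

lemma lift_closed:
  assumes "C \<in> components Q" "X \<in> carrier (pi1_at Q I (base C))"
  shows "lift C X \<in> carrier PI"
proof -
  have "\<one>\<^bsub>pi1_at Q I (base D)\<^esub> \<in> carrier (pi1_at Q I (base D))" if "D \<in> components Q" for D
    using group_base[OF that] by (simp add: group.is_monoid)
  then show ?thesis using assms by (auto simp: carrier_pi1 lift_def)
qed

lemma lift_mult:
  assumes "C \<in> components Q"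
  shows "lift C (X \<otimes>\<^bsub>pi1_at Q I (base C)\<^esub> Y) = lift C X \<otimes>\<^bsub>PI\<^esub> lift C Y"
proof -
  have "\<one>\<^bsub>pi1_at Q I (base D)\<^esub> \<otimes>\<^bsub>pi1_at Q I (base D)\<^esub> \<one>\<^bsub>pi1_at Q I (base D)\<^esub>
      = \<one>\<^bsub>pi1_at Q I (base D)\<^esub>" if "D \<in> components Q" for D
    using group_base[OF that] by (simp add: group.is_monoid)
  then show ?thesis by (auto simp: lift_def mult_pi1 fun_eq_iff)
qed

lemma lift_one: "lift C \<one>\<^bsub>pi1_at Q I (base C)\<^esub> = \<one>\<^bsub>PI\<^esub>"
  by (auto simp: lift_def one_pi1 fun_eq_iff)

lemma forest_walk_UNIV: "v \<in> verts Q \<Longrightarrow> walk Q (bs v) (\<gamma> v) v"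
  using walk_on_mono_set[OF forest_walk[OF forest], of v UNIV] by simp

lemma forest_loop:
  assumes "walk Q u p v"
  shows "walk Q (bs u) (\<gamma> u @ p @ rev_word (\<gamma> v)) (bs u)"
proof -
  have "walk Q (bs u) (\<gamma> u) u" "walk Q v (rev_word (\<gamma> v)) (bs v)"
    using walk_on_verts[OF assms] forest_walk_UNIV walk_on_rev by blast+
  moreover have "bs v = bs u" using component_of_walk[OF assms] by simp
  ultimately show ?thesis using assms by (auto simp: walk_on_append)
qed

lemma loop_class_closed: "walk Q u p v \<Longrightarrow> loop_class u p v \<in> carrier PI"
  unfolding loop_class_def using forest_loop[of u p v]
  by (intro lift_closed) (auto simp: components_def pi1_at_carrier dest: walk_on_verts)

lemma loop_class_cong:
  assumes "(u, p, v) \<sim> (u, p', v)"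
  shows "loop_class u p v = loop_class u p' v"
proof -
  have w: "walk Q u p v" using walk_equivD[OF assms] by (simp add: in_walks_iff)
  then have uv: "u \<in> verts Q" "v \<in> verts Q" using walk_on_verts by blast+
  have "bs v = bs u" using component_of_walk[OF w] by simp
  then have "walk Q v (rev_word (\<gamma> v)) (bs u)"
    using walk_on_rev[OF forest_walk_UNIV[OF uv(2)]] by simp
  then have "(bs u, \<gamma> u @ p @ rev_word (\<gamma> v), bs u) \<sim> (bs u, \<gamma> u @ p' @ rev_word (\<gamma> v), bs u)"
    by (intro weq_comp_word[of v] weq_comp_word[of u, where q = "p @ _"] weq_comp_word[OF weq_comp_word[OF weq_refl assms] weq_refl[OF forest_walk_UNIV[OF uv(1)]], simplified])
  then show ?thesis unfolding loop_class_def using wclass_eq by simp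
qed

text \<open>The two forest walks that meet at \<open>v\<close> cancel. Closing up is thus
  multiplicative even on open walks, which allows a loop to be evaluated arrow by arrow.\<close>

lemma loop_class_append:
  assumes p: "walk Q u p v" and q: "walk Q v q w"
  shows "loop_class u (p @ q) w = loop_class v q w \<otimes>\<^bsub>PI\<^esub> loop_class u p v"
proof -
  have comp: "component_of Q v = component_of Q u" using component_of_walk[OF p] by simp
  have C: "component_of Q u \<in> components Q" using walk_on_verts[OF p] by (auto simp: components_def)
  note lp = forest_loop[OF p] and lq = forest_loop[OF q, unfolded comp]
  have v: "v \<in> verts Q" using walk_on_verts[OF p] by simp
  note fw = forest_walk_UNIV
  have "(v, rev_word (\<gamma> v) @ rev_word (rev_word (\<gamma> v)), v) \<sim> (v, [], v)"
    by (rule rev_cancel[OF walk_on_rev[OF fw[OF v]]])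
  then have null: "(v, rev_word (\<gamma> v) @ \<gamma> v, v) \<sim> (v, [], v)" by simp
  have "(bs u, (\<gamma> u @ p) @ (rev_word (\<gamma> v) @ \<gamma> v) @ (q @ rev_word (\<gamma> w)), bs u)
      \<sim> (bs u, (\<gamma> u @ p) @ (q @ rev_word (\<gamma> w)), bs u)"
  proof (rule weq_delete[OF _ null])
    show "walk Q (bs u) (\<gamma> u @ p) v"
      using fw[of u] walk_on_verts[OF p] p by (auto simp: walk_on_append)
    show "walk Q v (q @ rev_word (\<gamma> w)) (bs u)"
      using walk_on_rev[OF fw[of w]] walk_on_verts[OF q] q component_of_walk[OF q] comp
      by (auto simp: walk_on_append)
  qed
  then show ?thesis
    unfolding loop_class_def comp lift_mult[OF C, symmetric] pi1_at_mult[OF lp lq]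
    using wclass_eq by simp
qed

lemma loop_class_forest:
  assumes "walk_on Q F u p v"
  shows "loop_class u p v = \<one>\<^bsub>PI\<^esub>"
proof -
  have fw: "walk_on Q F (bs x) (\<gamma> x) x" if "x \<in> verts Q" for x
    using forest_walk[OF forest that] .
  have "bs v = bs u" using component_of_walk[OF assms] by simp
  then have "walk_on Q F (bs u) (\<gamma> u @ p @ rev_word (\<gamma> v)) (bs u)"
    using walk_on_verts[OF assms] assms fw[of u] walk_on_rev[OF fw[of v]] by (auto simp: walk_on_append)
  from forest_null[OF forest_acyclic this] show ?thesis
    using wclass_eq lift_one[of "component_of Q u"] by (simp add: loop_class_def pi1_at_one)
qed

text \<open>The forest walk chosen for the base point may be nonempty, but it is a closed forest
  walk and hence null-homotopic.\<close>

lemma loop_class_base: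
  assumes C: "C \<in> components Q" and p: "walk Q (base C) p (base C)"
  shows "loop_class (base C) p (base C) = lift C (wclass (base C, p, base C))"
proof -
  let ?b = "base C"
  have bb: "component_of Q ?b = C" using component_of_base[OF C] .
  have fw: "walk_on Q F ?b (\<gamma> ?b) ?b" using forest_walk[OF forest base_in_verts[OF C]] bb by simp
  note n1 = forest_null[OF forest_acyclic fw] and n2 = forest_null[OF forest_acyclic walk_on_rev[OF fw]]
  have "(?b, p @ rev_word (\<gamma> ?b), ?b) \<sim> (?b, p @ [], ?b)"
    by (rule weq_comp_word[OF n2 weq_refl[OF p]])
  from weq_comp_word[OF this n1]
  have "(?b, \<gamma> ?b @ p @ rev_word (\<gamma> ?b), ?b) \<sim> (?b, p, ?b)" by simp
  then show ?thesis unfolding loop_class_def bb using wclass_eq by simp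
qed

definition word :: "('v set \<Rightarrow> ('v, 'a \<times> bool) qpath set) \<Rightarrow> 'v set \<Rightarrow> ('a \<times> bool) list" where
  "word t C = (SOME p. t C = wclass (base C, p, base C) \<and> walk Q (base C) p (base C))"

text \<open>For a general ideal this depends on the representatives chosen by \<open>word\<close>.
  The formula \<open>hom_eq_prod\<close> is true of them all the same; independence of the choice is
  gained in \<open>total_count_eq\<close>.\<close>

definition total_count :: "('v set \<Rightarrow> ('v, 'a \<times> bool) qpath set) \<Rightarrow> 'a \<Rightarrow> int" where
  "total_count t a = (\<Sum>C\<in>components Q. signed_count (word t C) a)"

lemma word:
  assumes "t \<in> carrier PI" "C \<in> components Q"
  shows "t C = wclass (base C, word t C, base C)" "walk Q (base C) (word t C) (base C)"
proof -
  have "t C \<in> carrier (pi1_at Q I (base C))" using assms by (auto simp: carrier_pi1)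
  then have "\<exists>p. t C = wclass (base C, p, base C) \<and> walk Q (base C) p (base C)"
    by (simp add: pi1_at_carrier)
  from someI_ex[OF this] show "t C = wclass (base C, word t C, base C)"
    "walk Q (base C) (word t C) (base C)" unfolding word_def by auto
qed

section \<open>Homomorphisms from the fundamental group to a commutative group\<close>

context
  fixes M :: "('m, 'n) monoid_scheme" and h
  assumes M: "comm_group M" and h: "h \<in> hom PI M"
begin

interpretation M: comm_group M by (rule M)
interpretation h: group_hom PI M h
  by (intro group_hom.intro group_pi1 M.is_group group_hom_axioms.intro h)

abbreviation gen where "gen a \<equiv> h (arrow_loop a)"

lemma gen_closed: "a \<in> arcs Q \<Longrightarrow> gen a \<in> carrier M"
  by (intro h.hom_closed loop_class_closed) simp

lemma prod_gen_add:
  "(\<Otimes>\<^bsub>M\<^esub>a\<in>K. gen a [^]\<^bsub>M\<^esub> (f a + g a :: int))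
    = (\<Otimes>\<^bsub>M\<^esub>a\<in>K. gen a [^]\<^bsub>M\<^esub> f a) \<otimes>\<^bsub>M\<^esub> (\<Otimes>\<^bsub>M\<^esub>a\<in>K. gen a [^]\<^bsub>M\<^esub> g a)"
proof -
  have "(\<Otimes>\<^bsub>M\<^esub>a\<in>K. gen a [^]\<^bsub>M\<^esub> (f a + g a :: int))
      = (\<Otimes>\<^bsub>M\<^esub>a\<in>K. gen a [^]\<^bsub>M\<^esub> f a \<otimes>\<^bsub>M\<^esub> gen a [^]\<^bsub>M\<^esub> g a)"
    by (intro M.finprod_cong') (auto simp: gen_closed M.int_pow_mult)
  also have "\<dots> = (\<Otimes>\<^bsub>M\<^esub>a\<in>K. gen a [^]\<^bsub>M\<^esub> f a) \<otimes>\<^bsub>M\<^esub> (\<Otimes>\<^bsub>M\<^esub>a\<in>K. gen a [^]\<^bsub>M\<^esub> g a)"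
    by (intro M.finprod_multf) (auto simp: gen_closed)
  finally show ?thesis .
qed

lemma prod_gen_closed: "(\<Otimes>\<^bsub>M\<^esub>a\<in>K. gen a [^]\<^bsub>M\<^esub> (f a :: int)) \<in> carrier M"
  by (intro M.finprod_closed) (auto simp: gen_closed)

lemma hom_arrow:
  assumes "fst x \<in> arcs Q"
  shows "h (loop_class (dtail Q x) [x] (dhead Q x))
    = (\<Otimes>\<^bsub>M\<^esub>c\<in>K. gen c [^]\<^bsub>M\<^esub> signed_count [x] c)"
proof (cases "fst x \<in> F")
  case True
  have "loop_class (dtail Q x) [x] (dhead Q x) = \<one>\<^bsub>PI\<^esub>"
    by (rule loop_class_forest) (use True assms in simp)
  then have "h (loop_class (dtail Q x) [x] (dhead Q x)) = \<one>\<^bsub>M\<^esub>" by simp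
  also have "\<one>\<^bsub>M\<^esub> = (\<Otimes>\<^bsub>M\<^esub>c\<in>K. gen c [^]\<^bsub>M\<^esub> signed_count [x] c)"
    by (rule M.finprod_one_eqI[symmetric]) (use True in auto)
  finally show ?thesis .
next
  case False
  obtain a b where x: "x = (a, b)" by (cases x)
  let ?g = "if b then gen a else inv\<^bsub>M\<^esub> (gen a)"
  have a: "a \<in> K" "a \<in> arcs Q" using False assms by (auto simp: x)
  have "h (loop_class (dtail Q x) [x] (dhead Q x)) = ?g"
  proof (cases b)
    case False
    have w: "walk Q (tail Q a) [(a, True)] (head Q a)" "walk Q (head Q a) [(a, False)] (tail Q a)"
      using a by auto
    \<comment> \<open>The arrow followed by its inverse cancels, so the inverse arrow is sent to the
      inverse of the generator.\<close>
    have "loop_class (tail Q a) ([(a, True)] @ [(a, False)]) (tail Q a) = loop_class (tail Q a) [] (tail Q a)"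
      using loop_class_cong cancel_arrow[OF a(2), of True] by simp
    also have "\<dots> = \<one>\<^bsub>PI\<^esub>" by (rule loop_class_forest) (use a in simp)
    finally have "h (loop_class (head Q a) [(a, False)] (tail Q a) \<otimes>\<^bsub>PI\<^esub> arrow_loop a) = \<one>\<^bsub>M\<^esub>"
      unfolding loop_class_append[OF w] by simp
    then have "h (loop_class (head Q a) [(a, False)] (tail Q a)) \<otimes>\<^bsub>M\<^esub> gen a = \<one>\<^bsub>M\<^esub>"
      using loop_class_closed w by simp
    then show ?thesis
      using False loop_class_closed w M.inv_equality[symmetric] by (simp add: x)
  qed (simp add: x)
  also have "?g = (\<Otimes>\<^bsub>M\<^esub>c\<in>K. if c = a then ?g else \<one>\<^bsub>M\<^esub>)"
    using M.finprod_singleton_swap[OF a(1), of "\<lambda>_. ?g"] gen_closed[OF a(2)] by simp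
  also have "\<dots> = (\<Otimes>\<^bsub>M\<^esub>c\<in>K. gen c [^]\<^bsub>M\<^esub> signed_count [x] c)"
    by (rule M.finprod_cong') (auto simp: x gen_closed a(2) M.int_pow_neg)
  finally show ?thesis .
qed

lemma hom_loop_class:
  "walk Q u p v \<Longrightarrow> h (loop_class u p v) = (\<Otimes>\<^bsub>M\<^esub>a\<in>K. gen a [^]\<^bsub>M\<^esub> signed_count p a)"
proof (induction p arbitrary: u)
  case Nil
  then have "loop_class u [] v = \<one>\<^bsub>PI\<^esub>" by (intro loop_class_forest) auto
  then show ?case by simp
next
  case (Cons x p)
  let ?w = "dhead Q x"
  have u: "u = dtail Q x" and x: "fst x \<in> arcs Q" and p: "walk Q ?w p v"
    using Cons.prems by auto
  have wx: "walk Q u [x] ?w" using u x by simp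
  have "h (loop_class u (x # p) v) = h (loop_class ?w p v) \<otimes>\<^bsub>M\<^esub> h (loop_class u [x] ?w)"
    using loop_class_append[OF wx p] loop_class_closed[OF wx] loop_class_closed[OF p] by simp
  also have "\<dots> = (\<Otimes>\<^bsub>M\<^esub>a\<in>K. gen a [^]\<^bsub>M\<^esub> signed_count [x] a) \<otimes>\<^bsub>M\<^esub> (\<Otimes>\<^bsub>M\<^esub>a\<in>K. gen a [^]\<^bsub>M\<^esub> signed_count p a)"
    unfolding Cons.IH[OF p] u hom_arrow[OF x] by (intro M.m_comm prod_gen_closed)
  also have "\<dots> = (\<Otimes>\<^bsub>M\<^esub>a\<in>K. gen a [^]\<^bsub>M\<^esub> signed_count (x # p) a)"
    unfolding prod_gen_add[symmetric] by simp
  finally show ?case .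
qed

text \<open>The element is the product of its embedded components, each the class of a loop that is
  evaluated arrow by arrow; as \<open>M\<close> is commutative, only exponent sums survive. Two
  targets are used: the quotient by the derived subgroup, where the formula says that the arrow
  loops generate, and the additive group of a field.\<close>

lemma hom_eq_prod:
  assumes t: "t \<in> carrier PI"
  shows "h t = (\<Otimes>\<^bsub>M\<^esub>a\<in>K. gen a [^]\<^bsub>M\<^esub> total_count t a)"
proof -
  define part where "part L = (\<lambda>C\<in>components Q. if C \<in> L then t C else \<one>\<^bsub>pi1_at Q I (base C)\<^esub>)" for L
  have tC: "t C \<in> carrier (pi1_at Q I (base C))" if "C \<in> components Q" for C
    using t that by (auto simp: carrier_pi1)
  have part: "part L \<in> carrier PI" for L
    using tC group.is_monoid[OF group_base] by (auto simp: carrier_pi1 part_def)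
  have *: "h (part L) = (\<Otimes>\<^bsub>M\<^esub>a\<in>K. gen a [^]\<^bsub>M\<^esub> (\<Sum>C\<in>L. signed_count (word t C) a))"
    if "finite L" "L \<subseteq> components Q" for L
    using that
  proof (induction L)
    case empty
    have "part {} = \<one>\<^bsub>PI\<^esub>" by (auto simp: part_def one_pi1)
    then show ?case by simp
  next
    case (insert C L)
    then have C: "C \<in> components Q" by simp
    have "part (insert C L) = lift C (t C) \<otimes>\<^bsub>PI\<^esub> part L"
    proof (rule ext)
      fix D
      show "part (insert C L) D = (lift C (t C) \<otimes>\<^bsub>PI\<^esub> part L) D"
        using insert.hyps(2) tC group.is_monoid[OF group_base]
        by (cases "D \<in> components Q") (auto simp: part_def lift_def mult_pi1)
    qed
    moreover have "lift C (t C) = loop_class (base C) (word t C) (base C)"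
      using loop_class_base[OF C word(2)[OF t C]] word(1)[OF t C] by simp
    ultimately have "h (part (insert C L)) = h (loop_class (base C) (word t C) (base C)) \<otimes>\<^bsub>M\<^esub> h (part L)"
      using loop_class_closed[OF word(2)[OF t C]] part by simp
    also have "\<dots> = (\<Otimes>\<^bsub>M\<^esub>a\<in>K. gen a [^]\<^bsub>M\<^esub> (\<Sum>C\<in>insert C L. signed_count (word t C) a))"
      using insert unfolding hom_loop_class[OF word(2)[OF t C]] by (simp add: prod_gen_add)
    finally show ?case .
  qed
  have "part (components Q) = t"
    using t by (auto simp: part_def carrier_pi1 fun_eq_iff)
  from *[OF finite_components order_refl] show ?thesis
    unfolding total_count_def \<open>part (components Q) = t\<close> .
qed

end

end

section \<open>Coordinates on the abelianised fundamental group\<close>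

text \<open>For finite \<open>K\<close> this is the free abelian group on \<open>K\<close>. Taking
  functions that vanish outside \<open>K\<close> lets the groups of different arrow sets share a
  type, so that inclusions of arrow sets become inclusions of carriers.\<close>

definition int_functions :: "'a set \<Rightarrow> ('a \<Rightarrow> int) monoid" where
  "int_functions K = \<lparr>carrier = {f. \<forall>a. a \<notin> K \<longrightarrow> f a = 0}, monoid.mult = (\<lambda>f g a. f a + g a), one = (\<lambda>_. 0)\<rparr>"

lemma int_functions_simps [simp]:
  "f \<in> carrier (int_functions K) \<longleftrightarrow> (\<forall>a. a \<notin> K \<longrightarrow> f a = 0)"
  "f \<otimes>\<^bsub>int_functions K\<^esub> g = (\<lambda>a. f a + g a)"
  "\<one>\<^bsub>int_functions K\<^esub> = (\<lambda>_. 0)"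
  by (simp_all add: int_functions_def)

lemma comm_group_int_functions: "comm_group (int_functions K)"
  by (rule comm_groupI) (auto intro!: bexI[of _ "\<lambda>a. - _ a"])

locale free_forested_quiver = free_bound_quiver Q I + forested_quiver Q I F
  for Q :: "('v, 'a) pre_digraph" and I :: "(('v, 'a) qpath \<Rightarrow>\<^sub>0 'k::field) set" and F
begin

abbreviation Z where "Z \<equiv> int_functions K"

definition coords :: "('v set \<Rightarrow> ('v, 'a \<times> bool) qpath set) \<Rightarrow> 'a \<Rightarrow> int" where
  "coords t = (\<lambda>a. if a \<in> K then total_count t a else 0)"

text \<open>Signed counts are invariants of walk classes here, so the choice made by
  \<open>word\<close> has no effect and convenient representatives may be used.\<close>

lemma total_count_eq:
  assumes "t \<in> carrier PI" "\<And>C. C \<in> components Q \<Longrightarrow> (base C, p C, base C) \<in> t C"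
  shows "total_count t a = (\<Sum>C\<in>components Q. signed_count (p C) a)"
  unfolding total_count_def
proof (rule sum.cong[OF HOL.refl])
  fix C assume C: "C \<in> components Q"
  have "(base C, word t C, base C) \<sim> (base C, p C, base C)"
    using assms(2)[OF C] word(1)[OF assms(1) C] by (simp add: in_wclass_iff)
  from walk_equiv_signed_count[OF this]
  show "signed_count (word t C) a = signed_count (p C) a" by simp
qed

lemma total_count_mult:
  assumes s: "s \<in> carrier PI" and t: "t \<in> carrier PI"
  shows "total_count (s \<otimes>\<^bsub>PI\<^esub> t) a = total_count s a + total_count t a"
proof -
  have st: "s \<otimes>\<^bsub>PI\<^esub> t \<in> carrier PI" using s t group_pi1 by (simp add: group.is_monoid monoid.m_closed)
  have "(base C, word t C @ word s C, base C) \<in> (s \<otimes>\<^bsub>PI\<^esub> t) C" if C: "C \<in> components Q" for C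
  proof -
    have "walk Q (base C) (word t C @ word s C) (base C)"
      using word(2)[OF s C] word(2)[OF t C] by (auto simp: walk_on_append)
    then show ?thesis
      using C pi1_at_mult[OF word(2)[OF t C] word(2)[OF s C]] word(1)[OF s C] word(1)[OF t C]
      by (simp add: mult_pi1 in_wclass_iff weq_refl)
  qed
  from total_count_eq[OF st this] show ?thesis
    by (simp add: total_count_def sum.distrib)
qed

lemma coords_hom: "coords \<in> hom PI Z"
  by (rule homI) (auto simp: coords_def total_count_mult)

sublocale coords: group_hom PI Z coords
  by (intro group_hom.intro group_hom_axioms.intro group_pi1 coords_hom comm_group.axioms(2) comm_group_int_functions)

lemma lift_total_count:
  assumes C: "C \<in> components Q" and p: "walk Q (base C) p (base C)"
  shows "total_count (lift C (wclass (base C, p, base C))) a = signed_count p a"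
proof -
  have "lift C (wclass (base C, p, base C)) \<in> carrier PI"
    using C p by (intro lift_closed) (auto simp: pi1_at_carrier)
  then have "total_count (lift C (wclass (base C, p, base C))) a
    = (\<Sum>D\<in>components Q. signed_count (if D = C then p else []) a)"
    by (rule total_count_eq) (use p in \<open>auto simp: lift_def pi1_at_one in_wclass_iff weq_refl base_in_verts\<close>)
  also have "\<dots> = (\<Sum>D\<in>components Q. if D = C then signed_count p a else 0)"
    by (rule sum.cong) auto
  finally show ?thesis using C finite_components by simp
qed

lemma coords_lift:
  assumes "C \<in> components Q" "walk Q (base C) p (base C)"
  shows "coords (lift C (wclass (base C, p, base C))) = (\<lambda>a. if a \<in> K then signed_count p a else 0)"
  using lift_total_count[OF assms] by (auto simp: coords_def)

text \<open>The attached forest walks use arrows of \<open>F\<close> only, which the coordinates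
  ignore.\<close>

lemma coords_loop_class:
  assumes "walk Q u p v"
  shows "coords (loop_class u p v) = (\<lambda>a. if a \<in> K then signed_count p a else 0)"
proof -
  have uv: "u \<in> verts Q" "v \<in> verts Q" using walk_on_verts[OF assms] by auto
  have "signed_count (\<gamma> x) a = 0" if "x \<in> verts Q" "a \<notin> F" for x a
    using walk_on_arcs[OF forest_walk[OF forest that(1)]] that(2) by (intro signed_count_eq_0) auto
  then show ?thesis
    unfolding loop_class_def using uv
    by (subst coords_lift) (auto simp: components_def forest_loop[OF assms])
qed

text \<open>The loop of an arrow \<open>c\<close> outside \<open>F\<close> has the unit vector at
  \<open>c\<close> as its coordinates. Products of powers of these loops reach every function,
  because \<open>K\<close> is finite.\<close>

lemma coords_surj: "coords ` carrier PI = carrier Z"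
proof
  show "coords ` carrier PI \<subseteq> carrier Z" using coords.hom_closed by blast
  show "carrier Z \<subseteq> coords ` carrier PI"
  proof
    fix f :: "'a \<Rightarrow> int" assume f: "f \<in> carrier Z"
    have pow: "x [^]\<^bsub>Z\<^esub> (n::nat) = (\<lambda>a. int n * x a)" for x n
      by (induction n) (auto simp: algebra_simps)
    have ipow: "x [^]\<^bsub>Z\<^esub> (n::int) = (\<lambda>a. n * x a)" if "x \<in> carrier Z" for x n
    proof (cases n)
      case (nonneg m)
      then show ?thesis by (simp add: int_pow_int pow)
    next
      case (neg m)
      have "inv\<^bsub>Z\<^esub> (\<lambda>a. int (Suc m) * x a) = (\<lambda>a. - (int (Suc m) * x a))"
        by (rule coords.H.inv_equality) (use that in auto)
      then show ?thesis using that unfolding neg by (simp only: coords.H.int_pow_neg_int pow) (simp add: algebra_simps)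
    qed
    have "\<exists>t\<in>carrier PI. coords t = (\<lambda>a. if a \<in> L then f a else 0)" if "finite L" "L \<subseteq> K" for L
      using that
    proof (induction L)
      case empty
      then show ?case using coords.hom_one by (intro bexI[of _ "\<one>\<^bsub>PI\<^esub>"]) auto
    next
      case (insert c L)
      then obtain t where t: "t \<in> carrier PI" "coords t = (\<lambda>a. if a \<in> L then f a else 0)" by auto
      have c: "walk Q (tail Q c) [(c, True)] (head Q c)" using insert by auto
      note cc = loop_class_closed[OF c]
      have "coords (arrow_loop c [^]\<^bsub>PI\<^esub> f c) = coords (arrow_loop c) [^]\<^bsub>Z\<^esub> f c"
        using cc by (rule coords.hom_int_pow)
      also have "\<dots> = (\<lambda>a. if a = c then f c else 0)"
        using insert.prems ipow[OF coords.hom_closed[OF cc]] unfolding coords_loop_class[OF c] by auto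
      finally have "coords (arrow_loop c [^]\<^bsub>PI\<^esub> f c) = (\<lambda>a. if a = c then f c else 0)" .
      then have "coords (arrow_loop c [^]\<^bsub>PI\<^esub> f c \<otimes>\<^bsub>PI\<^esub> t) = (\<lambda>a. if a \<in> insert c L then f a else 0)"
        using t cc insert.hyps by (auto simp: coords.hom_mult coords.G.int_pow_closed fun_eq_iff)
      then show ?case using t cc coords.G.int_pow_closed coords.G.m_closed by blast
    qed
    from this[of K] have "\<exists>t\<in>carrier PI. coords t = (\<lambda>a. if a \<in> K then f a else 0)" by simp
    moreover have "(\<lambda>a. if a \<in> K then f a else 0) = f" using f by auto
    ultimately show "f \<in> coords ` carrier PI" by (auto simp: image_iff)
  qed
qed

text \<open>
  An element with vanishing coordinates is trivial in the abelianisation, since there it is the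
  product of the arrow loops raised to its coordinates.
\<close>

lemma kernel_coords: "kernel PI Z coords = derived PI (carrier PI)"
proof
  let ?D = "derived PI (carrier PI)"
  interpret D: normal ?D PI by (rule coords.G.derived_self_is_normal)
  \<comment> \<open>The derived subgroup lies in every normal subgroup with commutative quotient,
    and the quotient by this kernel is a copy of \<open>Z\<close>.\<close>
  have "comm_group (PI Mod kernel PI Z coords)"
  proof -
    have "PI Mod kernel PI Z coords \<cong> Z" by (rule coords.FactGroup_iso[OF coords_surj])
    then have "Z \<cong> PI Mod kernel PI Z coords"
      by (rule group.iso_sym[OF normal.factorgroup_is_group[OF coords.normal_kernel]])
    then show ?thesis
      using comm_group.iso_imp_comm_group[OF comm_group_int_functions]
        group.is_monoid[OF normal.factorgroup_is_group[OF coords.normal_kernel]] by blast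
  qed
  then show "?D \<subseteq> kernel PI Z coords"
    by (rule coords.G.derived_minimal[OF coords.normal_kernel])
  show "kernel PI Z coords \<subseteq> ?D"
  proof
    fix t assume "t \<in> kernel PI Z coords"
    then have t: "t \<in> carrier PI" "coords t = (\<lambda>_. 0)" by (auto simp: kernel_def)
    have M: "comm_group (PI Mod ?D)" by (rule coords.G.derived_quot_is_comm_group)
    interpret M: comm_group "PI Mod ?D" by (rule M)
    have "?D #>\<^bsub>PI\<^esub> t = (\<Otimes>\<^bsub>PI Mod ?D\<^esub>a\<in>K. (?D #>\<^bsub>PI\<^esub> arrow_loop a) [^]\<^bsub>PI Mod ?D\<^esub> total_count t a)"
      by (rule hom_eq_prod[OF M D.r_coset_hom_Mod t(1)])
    also have "\<dots> = \<one>\<^bsub>PI Mod ?D\<^esub>"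
    proof (rule M.finprod_one_eqI)
      fix a assume "a \<in> K"
      then have "total_count t a = 0" using t(2) by (auto simp: coords_def dest: fun_cong[of _ _ a])
      then show "(?D #>\<^bsub>PI\<^esub> arrow_loop a) [^]\<^bsub>PI Mod ?D\<^esub> total_count t a = \<one>\<^bsub>PI Mod ?D\<^esub>" by simp
    qed
    finally have "?D #>\<^bsub>PI\<^esub> t = ?D" by simp
    then show "t \<in> ?D" using coords.G.rcos_self[OF t(1) D.subgroup_axioms] by simp
  qed
qed

definition coords_ab where "coords_ab X = the_elem (coords ` X)"

lemma coords_ab_iso: "coords_ab \<in> iso (pi1_ab Q I) Z"
  using coords.FactGroup_iso_set[OF coords_surj]
  unfolding kernel_coords abelianisation_def coords_ab_def .

lemma coords_ab_coset:
  assumes "t \<in> carrier PI"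
  shows "coords_ab (derived PI (carrier PI) #>\<^bsub>PI\<^esub> t) = coords t"
    "derived PI (carrier PI) #>\<^bsub>PI\<^esub> t \<in> carrier (pi1_ab Q I)"
proof -
  let ?D = "derived PI (carrier PI)"
  have D: "?D = kernel PI Z coords" by (rule kernel_coords[symmetric])
  show "?D #>\<^bsub>PI\<^esub> t \<in> carrier (pi1_ab Q I)"
    using assms by (auto simp: abelianisation_def FactGroup_def RCOSETS_def)
  have "coords ` (?D #>\<^bsub>PI\<^esub> t) = {coords t}"
    using assms coords.G.rcos_self[OF assms] coords.subgroup_kernel
    unfolding D r_coset_def kernel_def
    by (auto simp: coords.hom_mult image_iff intro!: bexI[of _ "\<one>\<^bsub>PI\<^esub>"])
  then show "coords_ab (?D #>\<^bsub>PI\<^esub> t) = coords t" by (simp add: coords_ab_def)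
qed

lemma coords_ab_in:
  assumes X: "X \<in> carrier (pi1_ab Q I)" and t: "t \<in> X"
  shows "t \<in> carrier PI" "coords_ab X = coords t"
proof -
  let ?D = "derived PI (carrier PI)"
  interpret D: normal ?D PI by (rule coords.G.derived_self_is_normal)
  obtain s where s: "s \<in> carrier PI" "X = ?D #>\<^bsub>PI\<^esub> s"
    using X by (auto simp: abelianisation_def FactGroup_def RCOSETS_def)
  show tc: "t \<in> carrier PI" using t s D.subset coords.G.r_coset_subset_G by blast
  have "X = ?D #>\<^bsub>PI\<^esub> t" using coords.G.repr_independence[OF _ s(1) D.subgroup_axioms] t s by simp
  then show "coords_ab X = coords t" using coords_ab_coset[OF tc] by simp
qed

text \<open>The definition takes the only element of a set indexed by all connecting walks.
  Conjugation by such a walk cancels in the signed counts, so all members have the same coordinates;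
  as coordinates are injective on the abelianisation, the set is a singleton.\<close>

lemma closed_walk_class_ab:
  assumes w: "w \<in> walks Q" "src w = tgt w"
  shows "closed_walk_class_ab Q I w \<in> carrier (pi1_ab Q I)"
    "coords_ab (closed_walk_class_ab Q I w) = (\<lambda>a. if a \<in> K then signed_count (arrs w) a else 0)"
proof -
  obtain v p where vp: "w = (v, p, v)" using w(2) by (metis qpath_collapse)
  have p: "walk Q v p v" using w(1) vp by (simp add: in_walks_iff)
  have v: "v \<in> verts Q" using walk_on_verts[OF p] by simp
  let ?C = "component_of Q v" and ?D = "derived PI (carrier PI)"
  let ?f = "\<lambda>a. if a \<in> K then signed_count p a else 0"
  have C: "?C \<in> components Q" using v by (simp add: components_def)
  define S where "S = {?D #>\<^bsub>PI\<^esub> (\<lambda>D\<in>components Q. if D = component_of Q (src w)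
          then wclass (pcomp (inv_walk g) (pcomp w g))
          else \<one>\<^bsub>pi1_at Q I (base D)\<^esub>)
     | g. g \<in> walks Q \<and> src g = base (component_of Q (src w)) \<and> tgt g = src w}"
  have S: "X \<in> carrier (pi1_ab Q I) \<and> coords_ab X = ?f" if XS: "X \<in> S" for X
  proof -
    obtain g0 where g0: "g0 \<in> walks Q" "src g0 = base ?C" "tgt g0 = v"
        "X = ?D #>\<^bsub>PI\<^esub> lift ?C (wclass (pcomp (inv_walk g0) (pcomp w g0)))"
      using XS unfolding S_def vp lift_def qpath_simps(1) by blast
    define g where "g = arrs g0"
    have g0_eq: "g0 = (base ?C, g, v)" using g0 by (metis g_def qpath_collapse)
    have g: "(base ?C, g, v) \<in> walks Q"
        "X = ?D #>\<^bsub>PI\<^esub> lift ?C (wclass (base ?C, (g @ p) @ rev_word g, base ?C))"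
      using g0 unfolding g0_eq vp by simp_all
    have gw: "walk Q (base ?C) g v" using g by (simp add: in_walks_iff)
    have cl: "walk Q (base ?C) ((g @ p) @ rev_word g) (base ?C)"
      using gw p walk_on_rev[OF gw] by (auto simp: walk_on_append)
    have t: "lift ?C (wclass (base ?C, (g @ p) @ rev_word g, base ?C)) \<in> carrier PI"
      using C cl by (intro lift_closed) (auto simp: pi1_at_carrier)
    show ?thesis
      using coords_ab_coset[OF t] coords_lift[OF C cl] unfolding g(2) by auto
  qed
  have "S \<noteq> {}"
  proof -
    have "(base ?C, \<gamma> v, v) \<in> walks Q" using forest_walk_UNIV[OF v] by (simp add: in_walks_iff)
    then show ?thesis unfolding S_def vp by force
  qed
  then obtain X where X: "X \<in> S" by blast
  have inj: "inj_on coords_ab (carrier (pi1_ab Q I))"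
    using coords_ab_iso by (simp add: iso_def bij_betw_def)
  have "Y = X" if "Y \<in> S" for Y
    using inj_onD[OF inj, of Y X] S[OF that] S[OF X] by simp
  then have "S = {X}" using X by blast
  then have "closed_walk_class_ab Q I w = X"
    unfolding closed_walk_class_ab_def S_def[symmetric] by simp
  then show "closed_walk_class_ab Q I w \<in> carrier (pi1_ab Q I)"
    "coords_ab (closed_walk_class_ab Q I w) = (\<lambda>a. if a \<in> K then signed_count (arrs w) a else 0)"
    using S[OF X] by (auto simp: vp)
qed

end

section \<open>Dimensions of function spaces\<close>

interpretation fun_vs: vector_space "\<lambda>(c::'k::field) (f :: 'g \<Rightarrow> 'k) x. c * f x"
  by unfold_locales (auto simp: fun_eq_iff algebra_simps)

lemma fun_subspaceI:
  fixes V :: "('g \<Rightarrow> 'k::field) set"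
  assumes "(\<lambda>_. 0) \<in> V" "\<And>f g. f \<in> V \<Longrightarrow> g \<in> V \<Longrightarrow> (\<lambda>x. f x + g x) \<in> V"
    "\<And>c f. f \<in> V \<Longrightarrow> (\<lambda>x. c * f x) \<in> V"
  shows "fun_vs.subspace V"
  using assms by (simp add: fun_vs.subspace_def zero_fun_def plus_fun_def)

lemma sum_fun_apply: "sum f A x = (\<Sum>a\<in>A. f a x)"
  for f :: "'i \<Rightarrow> 'g \<Rightarrow> 'k::comm_monoid_add"
  by (induction A rule: infinite_finite_induct) auto

lemma finite_support_in_span:
  fixes f :: "'i \<Rightarrow> 'k::field"
  assumes "finite K" "\<And>i. i \<notin> K \<Longrightarrow> f i = 0"
  shows "f \<in> fun_vs.span ((\<lambda>i j. if j = i then 1 else 0) ` K)"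
proof -
  have "f = (\<Sum>i\<in>K. (\<lambda>x. f i * (if x = i then 1 else 0)))"
  proof (rule ext)
    fix x
    have "(\<Sum>i\<in>K. f i * (if x = i then 1 else 0)) = (\<Sum>i\<in>K. if i = x then f i else 0)"
      by (rule sum.cong) auto
    then show "f x = (\<Sum>i\<in>K. (\<lambda>x. f i * (if x = i then 1 else 0))) x"
      using assms by (simp add: sum_fun_apply)
  qed
  moreover have "\<dots> \<in> fun_vs.span ((\<lambda>i j. if j = i then 1 else 0) ` K)"
    by (intro fun_vs.span_sum fun_vs.span_scale fun_vs.span_base) auto
  ultimately show ?thesis by simp
qed

lemma fun_dim_image:
  fixes L :: "('g \<Rightarrow> 'k::field) \<Rightarrow> 'h \<Rightarrow> 'k"
  assumes lin: "Vector_Spaces.linear (\<lambda>c f x. c * f x) (\<lambda>c f x. c * f x) L"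
    and V: "fun_vs.subspace V" and inj: "inj_on L V"
  shows "fun_dim (L ` V) = fun_dim V"
proof -
  interpret p: vector_space_pair "\<lambda>(c::'k) (f :: 'g \<Rightarrow> 'k) x. c * f x" "\<lambda>(c::'k) (f :: 'h \<Rightarrow> 'k) x. c * f x" ..
  obtain B where B: "B \<subseteq> V" "fun_vs.independent B" "V \<subseteq> fun_vs.span B" "card B = fun_vs.dim V"
    using fun_vs.basis_exists by blast
  have span: "fun_vs.span B = V" using B V fun_vs.span_minimal by blast
  have "fun_vs.independent (L ` B)"
    using p.linear_independent_injective_image[OF lin B(2)] inj by (simp add: span)
  moreover have "L ` V \<subseteq> fun_vs.span (L ` B)"
    using p.linear_span_image[OF lin, of B] span by simp
  ultimately have "card (L ` B) = fun_vs.dim (L ` V)"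
    using B by (intro fun_vs.basis_card_eq_dim) auto
  moreover have "card (L ` B) = card B" using B inj inj_on_subset card_image by metis
  ultimately show ?thesis using B(4) by (simp add: fun_dim_def)
qed

text \<open>Evaluation at the points \<open>x i\<close> embeds \<open>V\<close> into the functions
  supported on \<open>K\<close>.\<close>

lemma fun_dim_le:
  fixes V :: "('g \<Rightarrow> 'k::field) set" and x :: "'i \<Rightarrow> 'g"
  assumes K: "finite K" and V: "fun_vs.subspace V"
    and separating: "\<And>f. f \<in> V \<Longrightarrow> (\<And>i. i \<in> K \<Longrightarrow> f (x i) = 0) \<Longrightarrow> f = (\<lambda>_. 0)"
  shows "fun_dim V \<le> card K"
proof -
  define L :: "('g \<Rightarrow> 'k) \<Rightarrow> 'i \<Rightarrow> 'k" where "L f = (\<lambda>i. if i \<in> K then f (x i) else 0)" for f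
  have lin: "Vector_Spaces.linear (\<lambda>(c::'k) (f :: 'g \<Rightarrow> 'k) x. c * f x) (\<lambda>c f x. c * f x) L"
    by unfold_locales (auto simp: L_def fun_eq_iff)
  have "inj_on L V"
  proof (rule inj_onI)
    fix f g assume fg: "f \<in> V" "g \<in> V" "L f = L g"
    then have "f - g \<in> V" using V fun_vs.subspace_diff by blast
    moreover have "(f - g) (x i) = 0" if "i \<in> K" for i
      using fun_cong[OF fg(3), of i] that by (simp add: L_def)
    ultimately have "f - g = (\<lambda>_. 0)" by (rule separating)
    then show "f = g" by (auto simp: fun_eq_iff)
  qed
  then have "fun_dim V = fun_dim (L ` V)" by (rule fun_dim_image[OF lin V, symmetric])
  also have "L ` V \<subseteq> fun_vs.span ((\<lambda>i j. if j = i then 1 else 0) ` K)"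
    by (intro image_subsetI finite_support_in_span[OF K]) (simp add: L_def)
  then have "fun_dim (L ` V) \<le> card ((\<lambda>i j. if j = i then 1 else (0::'k)) ` K)"
    unfolding fun_dim_def using K by (intro fun_vs.dim_le_card) simp_all
  also have "\<dots> \<le> card K" using K by (rule card_image_le)
  finally show ?thesis .
qed

text \<open>The functions \<open>b i\<close> form a basis dual to evaluation at the points
  \<open>x i\<close>: duality gives independence, the expansion gives spanning.\<close>

lemma fun_dim_eq:
  fixes V :: "('g \<Rightarrow> 'k::field) set" and x :: "'i \<Rightarrow> 'g"
  assumes K: "finite K" and b: "\<And>i. i \<in> K \<Longrightarrow> b i \<in> V"
    and dual: "\<And>i j. i \<in> K \<Longrightarrow> j \<in> K \<Longrightarrow> b i (x j) = (if i = j then 1 else 0)"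
    and expand: "\<And>f y. f \<in> V \<Longrightarrow> f y = (\<Sum>i\<in>K. f (x i) * b i y)"
  shows "fun_dim V = card K"
proof -
  have inj: "inj_on b K"
  proof (rule inj_onI)
    fix i j assume ij: "i \<in> K" "j \<in> K" "b i = b j"
    show "i = j"
    proof (rule ccontr)
      assume "i \<noteq> j"
      then have "b i (x i) = 1" "b j (x i) = 0" using dual ij(1,2) by simp_all
      then show False using ij(3) by simp
    qed
  qed
  have "fun_vs.independent (b ` K)"
  proof (rule fun_vs.independent_if_scalars_zero)
    fix c f assume 0: "(\<Sum>f\<in>b ` K. (\<lambda>x. c f * f x)) = 0" and "f \<in> b ` K"
    then obtain i where i: "i \<in> K" "f = b i" by blast
    have "0 = (\<Sum>f\<in>b ` K. c f * f (x i))" using fun_cong[OF 0, of "x i"] by (simp add: sum_fun_apply)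
    also have "\<dots> = (\<Sum>j\<in>K. c (b j) * b j (x i))" by (rule sum.reindex[OF inj, unfolded o_def])
    also have "\<dots> = (\<Sum>j\<in>K. if j = i then c (b j) else 0)"
      by (intro sum.cong) (simp_all add: dual i(1))
    also have "\<dots> = c f" using i K by simp
    finally show "c f = 0" by simp
  qed (use K in simp)
  moreover have "V \<subseteq> fun_vs.span (b ` K)"
  proof
    fix f assume "f \<in> V"
    then have eq: "f = (\<Sum>i\<in>K. (\<lambda>y. f (x i) * b i y))"
      unfolding fun_eq_iff sum_fun_apply using expand by blast
    show "f \<in> fun_vs.span (b ` K)"
      by (subst eq) (intro fun_vs.span_sum fun_vs.span_scale fun_vs.span_base imageI)
  qed
  ultimately have "card (b ` K) = fun_vs.dim V"
    using b by (intro fun_vs.basis_card_eq_dim) auto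
  then show ?thesis by (simp add: fun_dim_def card_image[OF inj])
qed

section \<open>Homomorphisms to the ground field\<close>

lemma additive_group_simps [simp]:
  "x \<in> carrier additive_group" "x \<otimes>\<^bsub>additive_group\<^esub> y = x + y" "\<one>\<^bsub>additive_group\<^esub> = 0"
  by (simp_all add: additive_group_def)

lemma comm_group_additive_group: "comm_group (additive_group :: 'k::field monoid)"
proof (rule comm_groupI)
  show "\<exists>y\<in>carrier additive_group. y \<otimes>\<^bsub>additive_group\<^esub> x = \<one>\<^bsub>additive_group\<^esub>" for x :: 'k
    by (rule bexI[of _ "- x"]) auto
qed auto

lemma additive_group_int_pow: "x [^]\<^bsub>additive_group\<^esub> (n::int) = of_int n * (x :: 'k::field)"
proof -
  interpret A: comm_group "additive_group :: 'k monoid" by (rule comm_group_additive_group)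
  have nat: "x [^]\<^bsub>additive_group\<^esub> (m::nat) = of_nat m * x" for m
    by (induction m) (auto simp: algebra_simps)
  have inv: "inv\<^bsub>additive_group\<^esub> y = - y" for y :: 'k
    by (rule A.inv_equality) auto
  show ?thesis
  proof (cases n)
    case (neg m)
    then show ?thesis by (simp only: A.int_pow_neg_int nat inv additive_group_simps) (simp add: algebra_simps)
  qed (simp add: int_pow_int nat)
qed

lemma additive_group_finprod:
  "finite A \<Longrightarrow> finprod additive_group f A = sum (f :: 'i \<Rightarrow> 'k::field) A"
proof (induction A rule: finite_induct)
  case empty
  interpret A: comm_group "additive_group :: 'k monoid" by (rule comm_group_additive_group)
  show ?case by simp
next
  case (insert i A)
  interpret A: comm_group "additive_group :: 'k monoid" by (rule comm_group_additive_group)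
  show ?case using insert by (subst A.finprod_insert) auto
qed

lemma subspace_Hom_to_field:
  assumes "group G"
  shows "fun_vs.subspace (Hom_to_field G :: ('g \<Rightarrow> 'k::field) set)"
proof -
  interpret group G by (rule assms)
  show ?thesis by (rule fun_subspaceI) (auto simp: Hom_to_field_def hom_def algebra_simps)
qed

context forested_quiver
begin

lemma Hom_to_field_expand:
  assumes f: "(f :: _ \<Rightarrow> 'c::field) \<in> Hom_to_field PI" and t: "t \<in> carrier PI"
  shows "f t = (\<Sum>a\<in>K. f (arrow_loop a) * of_int (total_count t a))"
proof -
  have "f \<in> hom PI additive_group" using f by (simp add: Hom_to_field_def)
  from hom_eq_prod[OF comm_group_additive_group this t] show ?thesis
    by (simp add: additive_group_int_pow additive_group_finprod mult.commute)
qed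

text \<open>By the expansion a homomorphism is determined by its values on the arrow loops outside
  the forest. The bound covers presentations by arbitrary admissible ideals, as the maximum in
  \<open>pi1_rank\<close> demands.\<close>

lemma Hom_to_field_dim_le: "fun_dim (Hom_to_field PI :: (_ \<Rightarrow> 'c::field) set) \<le> card K"
proof (rule fun_dim_le)
  fix f :: "_ \<Rightarrow> 'c" assume f: "f \<in> Hom_to_field PI" "\<And>a. a \<in> K \<Longrightarrow> f (arrow_loop a) = 0"
  show "f = (\<lambda>_. 0)"
  proof (rule ext)
    fix t show "f t = 0"
    proof (cases "t \<in> carrier PI")
      case True
      then show ?thesis using Hom_to_field_expand[OF f(1) True] f(2) by simp
    qed (use f in \<open>simp add: Hom_to_field_def\<close>)
  qed
qed (simp_all add: subspace_Hom_to_field group_pi1)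

end

text \<open>The coordinate functions, mapped into the field, are dual to the arrow loops.\<close>

lemma (in free_forested_quiver) Hom_to_field_dim:
  "fun_dim (Hom_to_field PI :: (_ \<Rightarrow> 'c::field) set) = card K"
proof (rule fun_dim_eq[where x = "\<lambda>a. arrow_loop a" and b = "\<lambda>a t. if t \<in> carrier PI then of_int (coords t a) else 0"])
  fix a assume "a \<in> K"
  then show "(\<lambda>t. if t \<in> carrier PI then of_int (coords t a) else 0) \<in> Hom_to_field PI"
    by (auto simp: Hom_to_field_def hom_def coords.hom_mult)
next
  fix a c assume "a \<in> K" "c \<in> K"
  moreover from this have c: "walk Q (tail Q c) [(c, True)] (head Q c)" by simp
  ultimately show "(if arrow_loop c \<in> carrier PI then of_int (coords (arrow_loop c) a) else 0)
      = (if a = c then 1 else (0::'c))"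
    using loop_class_closed[OF c] coords_loop_class[OF c] by auto
next
  fix f :: "_ \<Rightarrow> 'c" and t assume f: "f \<in> Hom_to_field PI"
  show "f t = (\<Sum>a\<in>K. f (arrow_loop a) * (if t \<in> carrier PI then of_int (coords t a) else 0))"
  proof (cases "t \<in> carrier PI")
    case True
    then show ?thesis unfolding Hom_to_field_expand[OF f True] by (auto simp: coords_def intro!: sum.cong)
  qed (use f in \<open>simp add: Hom_to_field_def\<close>)
qed simp

section \<open>Subquivers\<close>

text \<open>The condition on \<open>FB\<close> makes an arrow of \<open>QB\<close> lie outside its
  forest exactly when it lies outside the forest of \<open>QA\<close>. So the coordinates of
  \<open>QB\<close> are those coordinates of \<open>QA\<close> that vanish on all other
  arrows.\<close>

locale forested_subquiver =
  A: free_forested_quiver QA IA FA + B: free_forested_quiver QB IB FB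
  for QA QB :: "('v, 'a) pre_digraph"
    and IA IB :: "(('v, 'a) qpath \<Rightarrow>\<^sub>0 'k::field) set" and FA FB +
  assumes sub: "subgraph QB QA" and FB: "FB = FA \<inter> arcs QB"
begin

lemma KB_subset: "arcs QB - FB \<subseteq> arcs QA - FA"
  using sub FB by (auto simp: subgraph_def)

text \<open>A word of \<open>QB\<close> keeps its signed counts when read in \<open>QA\<close>, and
  they vanish on arrows outside \<open>QB\<close>. So cutting off at the arrows of \<open>QA\<close>
  outside \<open>FA\<close> or at those of \<open>QB\<close> outside \<open>FB\<close> gives the
  same function.\<close>

lemma coords_pi1_to_pi1_ab:
  assumes t: "t \<in> carrier (pi1 QB IB)"
  shows "pi1_to_pi1_ab QB QA IA t \<in> carrier (pi1_ab QA IA)"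
    "A.coords_ab (pi1_to_pi1_ab QB QA IA t) = B.coords t"
proof -
  interpret AB: comm_group "pi1_ab QA IA"
    unfolding abelianisation_def by (rule A.coords.G.derived_quot_is_comm_group)
  have hom: "A.coords_ab \<in> hom (pi1_ab QA IA) A.Z" and inj: "inj_on A.coords_ab (carrier (pi1_ab QA IA))"
    using A.coords_ab_iso by (simp_all add: iso_def bij_betw_def)
  interpret c: group_hom "pi1_ab QA IA" A.Z A.coords_ab
    by (intro group_hom.intro group_hom_axioms.intro hom AB.is_group A.coords.H.is_group)
  define Y where "Y C = the_elem (closed_walk_class_ab QA IA ` t C)" for C
  have Y: "Y C \<in> carrier (pi1_ab QA IA) \<and>
      A.coords_ab (Y C) = (\<lambda>a. if a \<in> A.K then signed_count (B.word t C) a else 0)"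
    if C: "C \<in> components QB" for C
  proof -
    let ?w = "(base C, B.word t C, base C)"
    have img: "closed_walk_class_ab QA IA w \<in> carrier (pi1_ab QA IA)"
      "A.coords_ab (closed_walk_class_ab QA IA w) = (\<lambda>a. if a \<in> A.K then signed_count (B.word t C) a else 0)"
      if w: "w \<in> t C" for w
    proof -
      have weq: "walk_equiv QB IB ?w w" using w B.word(1)[OF t C] B.in_wclass_iff by metis
      note d = B.walk_equivD[OF weq]
      have "walk QB (src w) (arrs w) (tgt w)" using d by (simp add: B.in_walks_iff')
      then have "walk QA (src w) (arrs w) (tgt w)"
        unfolding walk_on_subgraph[OF sub] by (blast intro: A.walk_on_mono_set)
      then have w: "w \<in> walks QA" "src w = tgt w" using d by (auto simp: A.in_walks_iff')
      show "closed_walk_class_ab QA IA w \<in> carrier (pi1_ab QA IA)"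
        "A.coords_ab (closed_walk_class_ab QA IA w) = (\<lambda>a. if a \<in> A.K then signed_count (B.word t C) a else 0)"
        using A.closed_walk_class_ab[OF w] B.walk_equiv_signed_count[OF weq] by (simp_all add: fun_eq_iff)
    qed
    have wt: "?w \<in> t C"
      using B.word[OF t C] B.in_wclass_iff B.weq_refl by metis
    \<comment> \<open>Equivalent walks of \<open>QB\<close> have equal coordinates in
      \<open>QA\<close>, so \<open>t C\<close> has a single image and \<open>the_elem\<close> picks
      it.\<close>
    have "closed_walk_class_ab QA IA w = closed_walk_class_ab QA IA ?w" if "w \<in> t C" for w
      using inj_onD[OF inj] img[OF that] img[OF wt] by simp
    then have "closed_walk_class_ab QA IA ` t C = {closed_walk_class_ab QA IA ?w}" using wt by blast
    then show ?thesis using img[OF wt] by (simp add: Y_def)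
  qed
  have "(\<Otimes>\<^bsub>pi1_ab QA IA\<^esub>C\<in>L. Y C) \<in> carrier (pi1_ab QA IA) \<and>
      A.coords_ab (\<Otimes>\<^bsub>pi1_ab QA IA\<^esub>C\<in>L. Y C) = (\<lambda>a. if a \<in> A.K then (\<Sum>C\<in>L. signed_count (B.word t C) a) else 0)"
    if "finite L" "L \<subseteq> components QB" for L
    using that
  proof (induction L rule: finite_induct)
    case empty
    show ?case using c.hom_one by (simp add: fun_eq_iff)
  next
    case (insert C L)
    then have *: "(\<Otimes>\<^bsub>pi1_ab QA IA\<^esub>C\<in>insert C L. Y C) = Y C \<otimes>\<^bsub>pi1_ab QA IA\<^esub> (\<Otimes>\<^bsub>pi1_ab QA IA\<^esub>C\<in>L. Y C)"
      using Y by (intro AB.finprod_insert) auto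
    show ?case unfolding * using insert Y by (auto simp: c.hom_mult fun_eq_iff)
  qed
  from this[OF B.finite_components order_refl]
  have res: "pi1_to_pi1_ab QB QA IA t \<in> carrier (pi1_ab QA IA)"
    "A.coords_ab (pi1_to_pi1_ab QB QA IA t) = (\<lambda>a. if a \<in> A.K then B.total_count t a else 0)"
    unfolding pi1_to_pi1_ab_def Y_def B.total_count_def by auto
  show "pi1_to_pi1_ab QB QA IA t \<in> carrier (pi1_ab QA IA)" by (rule res)
  have "B.total_count t a = 0" if "a \<notin> arcs QB" for a
    unfolding B.total_count_def
    by (intro sum.neutral ballI signed_count_eq_0) (use that B.walk_on_arcs B.word(2)[OF t] in blast)
  then show "A.coords_ab (pi1_to_pi1_ab QB QA IA t) = B.coords t"
    unfolding res(2) B.coords_def using KB_subset FB by (auto simp: fun_eq_iff)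
qed

text \<open>Members of one coset have equal coordinates and hence one image, so the induced map is
  well defined. Its injectivity, the homomorphism property and its image are all read off from the
  second equation.\<close>

lemma coords_pi1_ab_inclusion:
  assumes X: "X \<in> carrier (pi1_ab QB IB)"
  shows "pi1_ab_inclusion QB QA IA X \<in> carrier (pi1_ab QA IA)"
    "A.coords_ab (pi1_ab_inclusion QB QA IA X) = B.coords_ab X"
proof -
  have inj: "inj_on A.coords_ab (carrier (pi1_ab QA IA))"
    using A.coords_ab_iso by (simp_all add: iso_def bij_betw_def)
  obtain s where s: "s \<in> carrier (pi1 QB IB)" "X = derived (pi1 QB IB) (carrier (pi1 QB IB)) #>\<^bsub>pi1 QB IB\<^esub> s"
    using X by (auto simp: abelianisation_def FactGroup_def RCOSETS_def)
  have sX: "s \<in> X"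
    unfolding s(2) by (intro B.coords.G.rcos_self s normal_imp_subgroup B.coords.G.derived_self_is_normal)
  have *: "pi1_to_pi1_ab QB QA IA t \<in> carrier (pi1_ab QA IA)"
    "A.coords_ab (pi1_to_pi1_ab QB QA IA t) = B.coords_ab X" if "t \<in> X" for t
    using coords_pi1_to_pi1_ab[OF B.coords_ab_in(1)[OF X that]] B.coords_ab_in(2)[OF X that] by simp_all
  have "pi1_to_pi1_ab QB QA IA t = pi1_to_pi1_ab QB QA IA s" if "t \<in> X" for t
    using inj_onD[OF inj] *[OF that] *[OF sX] by simp
  then have "pi1_to_pi1_ab QB QA IA ` X = {pi1_to_pi1_ab QB QA IA s}" using sX by blast
  then have "pi1_ab_inclusion QB QA IA X = pi1_to_pi1_ab QB QA IA s" by (simp add: pi1_ab_inclusion_def)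
  then show "pi1_ab_inclusion QB QA IA X \<in> carrier (pi1_ab QA IA)"
    "A.coords_ab (pi1_ab_inclusion QB QA IA X) = B.coords_ab X" using *[OF sX] by simp_all
qed

lemma pi1_ab_inclusion_mon: "pi1_ab_inclusion QB QA IA \<in> mon (pi1_ab QB IB) (pi1_ab QA IA)"
proof -
  interpret GA: group "pi1_ab QA IA"
    unfolding abelianisation_def by (rule A.coords.G.derived_quot_is_group)
  interpret GB: group "pi1_ab QB IB"
    unfolding abelianisation_def by (rule B.coords.G.derived_quot_is_group)
  have hA: "A.coords_ab \<in> hom (pi1_ab QA IA) A.Z" and iA: "inj_on A.coords_ab (carrier (pi1_ab QA IA))"
    using A.coords_ab_iso by (simp_all add: iso_def bij_betw_def)
  have hB: "B.coords_ab \<in> hom (pi1_ab QB IB) B.Z" and iB: "inj_on B.coords_ab (carrier (pi1_ab QB IB))"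
    using B.coords_ab_iso by (simp_all add: iso_def bij_betw_def)
  note incl = coords_pi1_ab_inclusion
  have "pi1_ab_inclusion QB QA IA (X \<otimes>\<^bsub>pi1_ab QB IB\<^esub> Y)
      = pi1_ab_inclusion QB QA IA X \<otimes>\<^bsub>pi1_ab QA IA\<^esub> pi1_ab_inclusion QB QA IA Y"
    if X: "X \<in> carrier (pi1_ab QB IB)" and Y: "Y \<in> carrier (pi1_ab QB IB)" for X Y
    by (rule inj_onD[OF iA])
      (use incl[OF X] incl[OF Y] incl[OF GB.m_closed[OF X Y]] hom_mult[OF hA] hom_mult[OF hB X Y]
        in simp_all)
  then have "pi1_ab_inclusion QB QA IA \<in> hom (pi1_ab QB IB) (pi1_ab QA IA)"
    using incl(1) by (intro homI)
  moreover have "inj_on (pi1_ab_inclusion QB QA IA) (carrier (pi1_ab QB IB))"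
    using incl(2) inj_onD[OF iB] by (intro inj_onI) metis
  ultimately show ?thesis by (simp add: mon_def)
qed

text \<open>Restricting coordinates to \<open>A.K - B.K\<close> is onto. Its kernel consists of the
  classes with coordinates supported on \<open>B.K\<close>, which is the image of the inclusion; the
  rest is the first isomorphism theorem.\<close>

lemma pi1_ab_quotient_iso:
  "int_functions (A.K - B.K)
    \<cong> pi1_ab QA IA Mod (pi1_ab_inclusion QB QA IA ` carrier (pi1_ab QB IB))"
proof -
  let ?Z = "int_functions (A.K - B.K)"
  interpret GA: group "pi1_ab QA IA"
    unfolding abelianisation_def by (rule A.coords.G.derived_quot_is_group)
  have hA: "A.coords_ab \<in> hom (pi1_ab QA IA) A.Z" and bA: "bij_betw A.coords_ab (carrier (pi1_ab QA IA)) (carrier A.Z)"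
    using A.coords_ab_iso by (simp_all add: iso_def)
  have bB: "bij_betw B.coords_ab (carrier (pi1_ab QB IB)) (carrier B.Z)"
    using B.coords_ab_iso by (simp add: iso_def)
  define \<theta> where "\<theta> X = (\<lambda>a. if a \<in> A.K - B.K then A.coords_ab X a else 0)" for X
  have "\<theta> \<in> hom (pi1_ab QA IA) ?Z"
    by (rule homI) (auto simp: \<theta>_def hom_mult[OF hA])
  then interpret \<theta>: group_hom "pi1_ab QA IA" ?Z \<theta>
    by (intro group_hom.intro group_hom_axioms.intro GA.is_group comm_group.axioms(2) comm_group_int_functions)
  have "\<theta> ` carrier (pi1_ab QA IA) = carrier ?Z"
  proof
    show "\<theta> ` carrier (pi1_ab QA IA) \<subseteq> carrier ?Z" by (auto simp: \<theta>_def)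
    show "carrier ?Z \<subseteq> \<theta> ` carrier (pi1_ab QA IA)"
    proof
      fix f assume f: "f \<in> carrier ?Z"
      then have "f \<in> carrier A.Z" by auto
      then obtain X where X: "X \<in> carrier (pi1_ab QA IA)" "A.coords_ab X = f"
        using bij_betw_imp_surj_on[OF bA] by (metis (no_types, lifting) imageE)
      then have "\<theta> X = f" using f by (auto simp: \<theta>_def)
      then show "f \<in> \<theta> ` carrier (pi1_ab QA IA)" using X by blast
    qed
  qed
  from \<theta>.FactGroup_iso[OF this]
  have "?Z \<cong> pi1_ab QA IA Mod kernel (pi1_ab QA IA) ?Z \<theta>"
    by (rule group.iso_sym[OF normal.factorgroup_is_group[OF \<theta>.normal_kernel]])
  moreover have "kernel (pi1_ab QA IA) ?Z \<theta> = pi1_ab_inclusion QB QA IA ` carrier (pi1_ab QB IB)"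
  proof
    show "pi1_ab_inclusion QB QA IA ` carrier (pi1_ab QB IB) \<subseteq> kernel (pi1_ab QA IA) ?Z \<theta>"
    proof clarify
      fix X assume X: "X \<in> carrier (pi1_ab QB IB)"
      then have "B.coords_ab X \<in> carrier B.Z" using bij_betw_apply[OF bB] by blast
      then show "pi1_ab_inclusion QB QA IA X \<in> kernel (pi1_ab QA IA) ?Z \<theta>"
        using coords_pi1_ab_inclusion[OF X] by (auto simp: kernel_def \<theta>_def)
    qed
    show "kernel (pi1_ab QA IA) ?Z \<theta> \<subseteq> pi1_ab_inclusion QB QA IA ` carrier (pi1_ab QB IB)"
    proof
      fix X assume "X \<in> kernel (pi1_ab QA IA) ?Z \<theta>"
      then have X: "X \<in> carrier (pi1_ab QA IA)" and 0: "\<theta> X = (\<lambda>_. 0)" by (auto simp: kernel_def)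
      have "A.coords_ab X \<in> carrier A.Z" using bij_betw_apply[OF bA X] .
      moreover have "A.coords_ab X a = 0" if "a \<in> A.K" "a \<notin> B.K" for a
        using fun_cong[OF 0, of a] that by (simp add: \<theta>_def)
      ultimately have "A.coords_ab X \<in> carrier B.Z" by auto
      then obtain Y where Y: "Y \<in> carrier (pi1_ab QB IB)" "B.coords_ab Y = A.coords_ab X"
        using bij_betw_imp_surj_on[OF bB] by (metis (no_types, lifting) imageE)
      then have "pi1_ab_inclusion QB QA IA Y = X"
        using coords_pi1_ab_inclusion[OF Y(1)] X bA unfolding bij_betw_def by (auto dest: inj_onD)
      then show "X \<in> pi1_ab_inclusion QB QA IA ` carrier (pi1_ab QB IB)" using Y(1) by blast
    qed
  qed
  ultimately show ?thesis by simp
qed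

end

lemma (in free_forested_quiver) pi1_ab_iso: "pi1_ab Q I \<cong> int_functions K"
  using coords_ab_iso by (auto simp: is_iso_def)

section \<open>Path algebras\<close>

text \<open>The multiplication of \<open>path_algebra\<close> does not mention the quiver, so it is
  named once, without the quiver as a parameter.\<close>

definition pmult ::
    "(('v, 'a) qpath \<Rightarrow>\<^sub>0 'k::field) \<Rightarrow> (('v, 'a) qpath \<Rightarrow>\<^sub>0 'k) \<Rightarrow> (('v, 'a) qpath \<Rightarrow>\<^sub>0 'k)" where
  "pmult f g = (\<Sum>p\<in>keys f. \<Sum>q\<in>keys g.
       if src p = tgt q
       then single (pcomp p q) (lookup f p * lookup g q)
       else 0)"

lemma lookup_single_if: "lookup (single p c) q = (if p = q then c else 0)"
  by (simp add: lookup_single)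

lemma path_algebra_simps [simp]:
  "f \<in> carrier (path_algebra Q) \<longleftrightarrow> keys f \<subseteq> paths Q"
  "\<zero>\<^bsub>path_algebra Q\<^esub> = 0"
  "f \<oplus>\<^bsub>path_algebra Q\<^esub> g = f + g"
  "f \<otimes>\<^bsub>path_algebra Q\<^esub> g = pmult f g"
  "lookup (c \<odot>\<^bsub>path_algebra Q\<^esub> f) p = c * lookup f p"
  by (simp_all add: path_algebra_def pmult_def Poly_Mapping.map.rep_eq when_def)

lemma poly_mapping_sum_single:
  "(\<Sum>p\<in>keys f. single p (lookup f p)) = f"
  by (rule poly_mapping_eqI) (auto simp: lookup_sum lookup_single_if in_keys_iff)

text \<open>Enlarging the ranges of summation beyond the keys only adds zero terms. This makes room
  for the paths at which coefficients are read off.\<close>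

lemma lookup_pmult:
  assumes "finite A" "finite B" "keys f \<subseteq> A" "keys g \<subseteq> B"
  shows "lookup (pmult f g) r = (\<Sum>p\<in>A. \<Sum>q\<in>B.
    if src p = tgt q \<and> pcomp p q = r then lookup f p * lookup g q else 0)"
proof -
  have "lookup (pmult f g) r = (\<Sum>p\<in>keys f. \<Sum>q\<in>keys g.
    if src p = tgt q \<and> pcomp p q = r then lookup f p * lookup g q else 0)"
    unfolding pmult_def lookup_sum by (intro sum.cong) (auto simp: lookup_single_if)
  also have "\<dots> = (\<Sum>p\<in>keys f. \<Sum>q\<in>B.
    if src p = tgt q \<and> pcomp p q = r then lookup f p * lookup g q else 0)"
    by (intro sum.cong HOL.refl sum.mono_neutral_left) (use assms in \<open>auto simp: in_keys_iff\<close>)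
  also have "\<dots> = (\<Sum>p\<in>A. \<Sum>q\<in>B.
    if src p = tgt q \<and> pcomp p q = r then lookup f p * lookup g q else 0)"
    by (intro sum.mono_neutral_left) (use assms in \<open>auto simp: in_keys_iff intro!: sum.neutral\<close>)
  finally show ?thesis .
qed

lemma keys_pmult:
  assumes "r \<in> keys (pmult f g)"
  obtains p q where "p \<in> keys f" "q \<in> keys g" "src p = tgt q" "r = pcomp p q"
proof -
  have "lookup (pmult f g) r \<noteq> 0" using assms by (simp add: in_keys_iff)
  then have "(\<Sum>p\<in>keys f. \<Sum>q\<in>keys g.
    if src p = tgt q \<and> pcomp p q = r then lookup f p * lookup g q else 0) \<noteq> 0"
    using lookup_pmult[of "keys f" "keys g" f g r] by simp
  then obtain p where "p \<in> keys f" "(\<Sum>q\<in>keys g.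
    if src p = tgt q \<and> pcomp p q = r then lookup f p * lookup g q else 0) \<noteq> 0"
    by (rule sum.not_neutral_contains_not_neutral)
  moreover from this(2) obtain q where "q \<in> keys g"
    "(if src p = tgt q \<and> pcomp p q = r then lookup f p * lookup g q else 0) \<noteq> 0"
    by (rule sum.not_neutral_contains_not_neutral)
  ultimately show thesis by (intro that[of p q]) (simp_all split: if_splits)
qed

lemma pmult_single:
  "pmult (single p c) (single q d) =
    (if src p = tgt q then single (pcomp p q) (c * d) else 0)"
proof (rule poly_mapping_eqI)
  fix r
  show "lookup (pmult (single p c) (single q d)) r =
    lookup (if src p = tgt q then single (pcomp p q) (c * d) else 0) r"
    by (subst lookup_pmult[of "{p}" "{q}"]) (auto simp: lookup_single_if)
qed

lemma pmult_smult_left: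
  "pmult (c \<odot>\<^bsub>path_algebra Q\<^esub> f) g = c \<odot>\<^bsub>path_algebra Q\<^esub> pmult f g"
proof (rule poly_mapping_eqI)
  fix r
  let ?A = "keys f" and ?B = "keys g"
  have "keys (c \<odot>\<^bsub>path_algebra Q\<^esub> f) \<subseteq> ?A" by (auto simp: in_keys_iff)
  then show "lookup (pmult (c \<odot>\<^bsub>path_algebra Q\<^esub> f) g) r
      = lookup (c \<odot>\<^bsub>path_algebra Q\<^esub> pmult f g) r"
    by (simp add: lookup_pmult[of ?A ?B] sum_distrib_left mult.assoc if_distrib cong: if_cong)
qed

lemma pcomp_trivial_left: "pcomp (trivial_path (tgt q)) q = q"
  and pcomp_trivial_right: "pcomp q (trivial_path (src q)) = q"
  by (simp_all add: pcomp_def)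

section \<open>Coefficients of products involving short paths\<close>

lemma lookup_trivial_mult_left:
  fixes f :: "('v, 'a) qpath \<Rightarrow>\<^sub>0 'k::field"
  shows "lookup (pmult (single (trivial_path v) c) f) r =
    (if tgt r = v then c * lookup f r else 0)"
proof -
  let ?B = "insert r (keys f)"
  have "lookup (pmult (single (trivial_path v) c) f) r =
    (\<Sum>q\<in>?B. if v = tgt q \<and> pcomp (trivial_path v) q = r then c * lookup f q else 0)"
    by (subst lookup_pmult[of "{trivial_path v}" ?B]) (auto simp: lookup_single_if cong: if_cong)
  also have "\<dots> = (\<Sum>q\<in>?B. if q = r then (if tgt r = v then c * lookup f r else 0) else 0)"
  proof (intro sum.cong HOL.refl)
    fix q :: "('v, 'a) qpath"
    show "(if v = tgt q \<and> pcomp (trivial_path v) q = r then c * lookup f q else 0) =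
      (if q = r then (if tgt r = v then c * lookup f r else 0) else 0)"
      using pcomp_trivial_left[of q] by (cases "v = tgt q"; cases "q = r") simp_all
  qed
  also have "\<dots> = (if tgt r = v then c * lookup f r else 0)"
    by (subst sum.delta) auto
  finally show ?thesis .
qed

lemma lookup_trivial_mult_right:
  fixes f :: "('v, 'a) qpath \<Rightarrow>\<^sub>0 'k::field"
  shows "lookup (pmult f (single (trivial_path v) c)) r =
    (if src r = v then lookup f r * c else 0)"
proof -
  let ?A = "insert r (keys f)"
  have "lookup (pmult f (single (trivial_path v) c)) r =
    (\<Sum>p\<in>?A. if src p = v \<and> pcomp p (trivial_path v) = r then lookup f p * c else 0)"
    by (subst lookup_pmult[of ?A "{trivial_path v}"]) (auto simp: lookup_single_if cong: if_cong)
  also have "\<dots> = (\<Sum>p\<in>?A. if p = r then (if src r = v then lookup f r * c else 0) else 0)"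
  proof (intro sum.cong HOL.refl)
    fix p :: "('v, 'a) qpath"
    show "(if src p = v \<and> pcomp p (trivial_path v) = r then lookup f p * c else 0) =
      (if p = r then (if src r = v then lookup f r * c else 0) else 0)"
      using pcomp_trivial_right[of p] by (cases "src p = v"; cases "p = r") simp_all
  qed
  also have "\<dots> = (if src r = v then lookup f r * c else 0)"
    by (subst sum.delta) auto
  finally show ?thesis .
qed

context wf_digraph
begin

lemma paths_iff: "p \<in> paths G \<longleftrightarrow> awalk (src p) (arrs p) (tgt p)"
  by (simp add: paths_def)

lemma trivial_path_in_paths [simp]: "trivial_path v \<in> paths G \<longleftrightarrow> v \<in> verts G"
  by (simp add: paths_iff awalk_Nil_iff)

lemma arrow_path_in_paths [simp]: "arrow_path G a \<in> paths G \<longleftrightarrow> a \<in> arcs G"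
  by (auto simp: paths_iff arrow_path_def awalk_simps)

lemma pcomp_in_paths: "p \<in> paths G \<Longrightarrow> q \<in> paths G \<Longrightarrow> src p = tgt q \<Longrightarrow> pcomp p q \<in> paths G"
  unfolding paths_iff pcomp_sel by (rule awalk_appendI) simp_all

lemma path_verts: "p \<in> paths G \<Longrightarrow> src p \<in> verts G" "p \<in> paths G \<Longrightarrow> tgt p \<in> verts G"
  by (auto simp: paths_iff)

lemma path_empty_eq: "p \<in> paths G \<Longrightarrow> arrs p = [] \<Longrightarrow> p = trivial_path (src p)"
  by (cases p) (auto simp: paths_iff trivial_path_def awalk_Nil_iff)

lemma path_single_eq: "p \<in> paths G \<Longrightarrow> arrs p = [a] \<Longrightarrow> p = arrow_path G a \<and> a \<in> arcs G"
  by (cases p) (auto simp: paths_iff arrow_path_def awalk_simps)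

text \<open>A trivial path factors only as itself times itself. This makes its coefficient
  multiplicative and is the source of the characters.\<close>

lemma lookup_pmult_trivial:
  assumes f: "keys f \<subseteq> paths G" and g: "keys g \<subseteq> paths G" and v: "v \<in> verts G"
  shows "lookup (pmult f g) (trivial_path v) =
    lookup f (trivial_path v) * lookup g (trivial_path v)"
proof -
  let ?t = "trivial_path v"
  let ?A = "insert ?t (keys f)" and ?B = "insert ?t (keys g)"
  have *: "src p = tgt q \<and> pcomp p q = ?t \<longleftrightarrow> p = ?t \<and> q = ?t" if "p \<in> ?A" "q \<in> ?B" for p q
  proof
    assume h: "src p = tgt q \<and> pcomp p q = ?t"
    have pq: "p \<in> paths G" "q \<in> paths G" using that f g v by auto
    have "arrs p = []" "arrs q = []" "src q = v"
      using h by (auto simp: pcomp_def trivial_path_def)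
    then show "p = ?t \<and> q = ?t"
      using path_empty_eq[OF pq(1)] path_empty_eq[OF pq(2)] h by (metis trivial_path_sel(3))
  qed (simp add: pcomp_def trivial_path_def)
  have "lookup (pmult f g) ?t = (\<Sum>p\<in>?A. \<Sum>q\<in>?B.
      if src p = tgt q \<and> pcomp p q = ?t then lookup f p * lookup g q else 0)"
    by (rule lookup_pmult) auto
  also have "\<dots> = (\<Sum>p\<in>?A. \<Sum>q\<in>?B. if q = ?t then (if p = ?t then
      lookup f ?t * lookup g ?t else 0) else 0)"
    by (intro sum.cong HOL.refl) (simp only: *, simp)
  also have "\<dots> = lookup f ?t * lookup g ?t"
    by (simp only: sum.delta finite_insert finite_keys insertI1 if_True)
  finally show ?thesis .
qed

text \<open>An arrow factors only with a trivial path on one side. The two summands are the Leibniz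
  rule for the coefficient of the arrow and are the source of the derivations.\<close>

lemma lookup_pmult_arrow:
  assumes f: "keys f \<subseteq> paths G" and g: "keys g \<subseteq> paths G" and a: "a \<in> arcs G"
  shows "lookup (pmult f g) (arrow_path G a) =
    lookup f (trivial_path (head G a)) * lookup g (arrow_path G a) +
    lookup f (arrow_path G a) * lookup g (trivial_path (tail G a))"
proof -
  let ?a = "arrow_path G a" and ?h = "trivial_path (head G a)" and ?t = "trivial_path (tail G a)"
  let ?A = "insert ?a (insert ?h (keys f))" and ?B = "insert ?a (insert ?t (keys g))"
  have ne: "?a \<noteq> ?h" "?a \<noteq> ?t" by (simp_all add: arrow_path_def trivial_path_def)
  have *: "src p = tgt q \<and> pcomp p q = ?a \<longleftrightarrow> (p = ?h \<and> q = ?a) \<or> (p = ?a \<and> q = ?t)"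
    if "p \<in> ?A" "q \<in> ?B" for p q
  proof
    assume h: "src p = tgt q \<and> pcomp p q = ?a"
    have pq: "p \<in> paths G" "q \<in> paths G" using that f g a by auto
    have "arrs q @ arrs p = [a]" using h by (auto simp: pcomp_def arrow_path_def)
    then consider "arrs q = [a]" "arrs p = []" | "arrs q = []" "arrs p = [a]"
      by (auto simp: append_eq_Cons_conv)
    then show "(p = ?h \<and> q = ?a) \<or> (p = ?a \<and> q = ?t)"
    proof cases
      case 1
      then have "q = ?a" "p = trivial_path (src p)" using path_single_eq path_empty_eq pq by blast+
      then show ?thesis using h by (simp add: arrow_path_def)
    next
      case 2
      then have "p = ?a" "q = trivial_path (src q)" using path_single_eq path_empty_eq pq by blast+
      moreover from this h have "src q = tail G a" by (metis arrow_path_def qpath_simps(1) trivial_path_sel(3))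
      ultimately show ?thesis by simp
    qed
  qed (auto simp: pcomp_def trivial_path_def arrow_path_def src_def tgt_def arrs_def)
  have "lookup (pmult f g) ?a = (\<Sum>p\<in>?A. \<Sum>q\<in>?B.
      if src p = tgt q \<and> pcomp p q = ?a then lookup f p * lookup g q else 0)"
    by (rule lookup_pmult) auto
  also have "\<dots> = (\<Sum>p\<in>?A. \<Sum>q\<in>?B.
      (if q = ?a then (if p = ?h then lookup f ?h * lookup g ?a else 0) else 0) +
      (if q = ?t then (if p = ?a then lookup f ?a * lookup g ?t else 0) else 0))"
    by (intro sum.cong HOL.refl) (simp only: *, use ne in auto)
  also have "\<dots> = lookup f ?h * lookup g ?a +
      lookup f ?a * lookup g ?t"
    by (simp only: sum.distrib sum.delta finite_insert finite_keys insertI1 insertI2 if_True)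
  finally show ?thesis .
qed

lemma pmult_closed:
  "keys f \<subseteq> paths G \<Longrightarrow> keys g \<subseteq> paths G
    \<Longrightarrow> keys (pmult f g) \<subseteq> paths G"
  by (rule subsetI, erule keys_pmult) (blast intro: pcomp_in_paths)

end

lemma path_algebra_additive_expand:
  fixes \<Phi> :: "(('v, 'a) qpath \<Rightarrow>\<^sub>0 'k::field) \<Rightarrow> 'c::ab_group_add"
  assumes add: "\<And>f g. f \<in> carrier (path_algebra Q) \<Longrightarrow> g \<in> carrier (path_algebra Q) \<Longrightarrow> \<Phi> (f + g) = \<Phi> f + \<Phi> g"
    and f: "f \<in> carrier (path_algebra Q)"
  shows "\<Phi> f = (\<Sum>p\<in>keys f. \<Phi> (single p (lookup f p)))"
proof -
  have 0: "\<Phi> 0 = 0" using add[of 0 0] by simp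
  have "\<Phi> (\<Sum>p\<in>S. single p (c p)) = (\<Sum>p\<in>S. \<Phi> (single p (c p))) \<and>
      (\<Sum>p\<in>S. single p (c p)) \<in> carrier (path_algebra Q)"
    if "finite S" "S \<subseteq> paths Q" for S and c :: "_ \<Rightarrow> 'k"
    using that
  proof (induction S rule: finite_induct)
    case (insert p S)
    let ?s = "single p (c p)" and ?r = "\<Sum>p\<in>S. single p (c p)"
    have "?s \<in> carrier (path_algebra Q)" using insert.prems by simp
    moreover have "keys (?s + ?r) \<subseteq> keys ?s \<union> keys ?r"
      by (rule Poly_Mapping.keys_add)
    ultimately show ?case using insert add[of ?s ?r] by auto
  qed (simp add: 0)
  from this[of "keys f" "lookup f"] f show ?thesis
    by (simp add: poly_mapping_sum_single)
qed

text \<open>For an ideal this means being spanned by the paths it contains, the form in which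
  monomiality enters.\<close>

definition term_closed :: "(('v, 'a) qpath \<Rightarrow>\<^sub>0 'k::field) set \<Rightarrow> bool" where
  "term_closed I \<longleftrightarrow> (\<forall>f\<in>I. \<forall>p\<in>keys f. \<forall>c. single p c \<in> I)"

locale bound_algebra = fin_digraph Q for Q :: "('v, 'a) pre_digraph" +
  fixes I :: "(('v, 'a) qpath \<Rightarrow>\<^sub>0 'k::field) set"
  assumes admissible: "admissible Q I"
begin

sublocale I: ideal I "path_algebra Q"
  using admissible by (simp add: admissible_def)

lemma I_keys: "f \<in> I \<Longrightarrow> keys f \<subseteq> paths Q"
  using I.a_Hcarr[of f] by simp

lemma I_length: "f \<in> I \<Longrightarrow> p \<in> keys f \<Longrightarrow> 2 \<le> length (arrs p)"
  using admissible by (auto simp: admissible_def arrow_ideal_power_def)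

lemma I_lookup: "f \<in> I \<Longrightarrow> length (arrs p) < 2 \<Longrightarrow> lookup f p = 0"
  using I_length[of f p] by (auto simp: in_keys_iff)

lemma I_mult:
  assumes "f \<in> I" "keys g \<subseteq> paths Q"
  shows "pmult f g \<in> I" "pmult g f \<in> I"
  using I.I_r_closed[of f g] I.I_l_closed[of f g] assms by simp_all

text \<open>Multiplying by the trivial paths at the ends of \<open>p\<close> cuts out of
  \<open>r\<close> the subsum of the paths parallel to \<open>p\<close>. It lies in the ideal, so by
  minimality it is all of \<open>r\<close>.\<close>

lemma minimal_relation_parallel:
  assumes r: "minimal_relation I r" and p: "p \<in> keys r" and q: "q \<in> keys r"
  shows "p \<in> paths Q \<and> src p = src q \<and> tgt p = tgt q"
proof -
  have rI: "r \<in> I" using r by (simp add: minimal_relation_def)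
  have pp: "p \<in> paths Q" using I_keys[OF rI] p by blast
  define S where "S = {x \<in> keys r. src x = src p \<and> tgt x = tgt p}"
  let ?s = "pmult (single (trivial_path (tgt p)) 1)
    (pmult r (single (trivial_path (src p)) 1))"
  have "?s \<in> I" using path_verts[OF pp] by (intro I_mult rI) simp_all
  also have "?s = (\<Sum>x\<in>S. single x (lookup r x))"
    by (rule poly_mapping_eqI)
      (auto simp: lookup_trivial_mult_left lookup_trivial_mult_right lookup_sum lookup_single_if S_def in_keys_iff)
  finally have "\<not> (S \<noteq> {} \<and> S \<subset> keys r)"
    using r unfolding minimal_relation_def by blast
  moreover have "p \<in> S" "S \<subseteq> keys r" using p by (auto simp: S_def)
  ultimately have "q \<in> S" using q by blast
  then show ?thesis using pp by (simp add: S_def)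
qed

lemma bound_quiver: "bound_quiver Q I"
  by (intro bound_quiver.intro quiver.intro wf_digraph_axioms bound_quiver_axioms.intro minimal_relation_parallel)

text \<open>Each single term of a relation is again in the ideal, so a minimal relation cannot have
  two terms.\<close>

lemma free_bound_quiver:
  assumes "term_closed I"
  shows "free_bound_quiver Q I"
proof (intro free_bound_quiver.intro bound_quiver free_bound_quiver_axioms.intro)
  fix r p q assume r: "minimal_relation I r" "p \<in> keys r" "q \<in> keys r"
  have "(\<Sum>x\<in>{p}. single x (lookup r x)) \<in> I"
    using assms r by (auto simp: term_closed_def minimal_relation_def)
  then have "\<not> {p} \<subset> keys r" using r(1) unfolding minimal_relation_def by blast
  then show "p = q" using r by (auto simp: psubset_eq)
qed

lemma path_algebra_uminus:
  fixes f :: "('v, 'a) qpath \<Rightarrow>\<^sub>0 'k"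
  assumes "keys f \<subseteq> paths Q"
  shows "\<ominus>\<^bsub>path_algebra Q\<^esub> f = - f"
  by (rule I.minus_equality) (use assms in simp_all)

text \<open>The elements all of whose terms lie in \<open>I\<close> form an ideal that contains the
  generators, hence all of \<open>I\<close>.\<close>

lemma term_closed:
  assumes "generated_by_paths Q I"
  shows "term_closed I"
proof -
  let ?A = "path_algebra Q :: ('k, _) module"
  obtain P where P: "P \<subseteq> paths Q" "I = Idl\<^bsub>?A\<^esub> ((\<lambda>p. single p 1) ` P)"
    using assms by (auto simp: generated_by_paths_def)
  have gens: "(\<lambda>p. single p 1) ` P \<subseteq> carrier ?A" using P by auto
  define M where "M = {f \<in> carrier ?A. \<forall>p\<in>keys f. \<forall>c. single p c \<in> I}"
  have keysM: "keys f \<subseteq> paths Q" if "f \<in> M" for f using that by (simp add: M_def)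
  have mult: "single (pcomp p q) c \<in> I"
    if "p \<in> paths Q" "q \<in> paths Q" "src p = tgt q" "\<forall>c. single q c \<in> I \<or> single p c \<in> I" for p q c
  proof (cases "single q c \<in> I")
    case True
    have "pmult (single p 1) (single q c) \<in> I"
      by (rule I_mult(2)[OF True]) (use that in simp)
    then show ?thesis using that by (simp add: pmult_single)
  next
    case False
    then have pI: "single p c \<in> I" using that by blast
    have "pmult (single p c) (single q 1) \<in> I"
      by (rule I_mult(1)[OF pI]) (use that in simp)
    then show ?thesis using that by (simp add: pmult_single)
  qed
  have prod: "pmult x y \<in> M"
    if k: "keys x \<subseteq> paths Q" "keys y \<subseteq> paths Q" and M: "x \<in> M \<or> y \<in> M" for x y
  proof -
    have "single r c \<in> I" if "r \<in> keys (pmult x y)" for r c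
    proof -
      from that obtain p q where "p \<in> keys x" "q \<in> keys y" "src p = tgt q" "r = pcomp p q"
        by (rule keys_pmult)
      then show ?thesis using mult[of p q c] k M by (auto simp: M_def)
    qed
    then show ?thesis using pmult_closed[OF k] by (simp add: M_def)
  qed
  have "ideal M ?A"
  proof (rule idealI[OF I.ring_axioms])
    show "subgroup M (add_monoid ?A)"
    proof (rule group.subgroupI[OF I.a_group])
      show "M \<subseteq> carrier (add_monoid ?A)" by (auto simp: M_def)
      have "0 \<in> M" by (simp add: M_def)
      then show "M \<noteq> {}" by blast
      show "inv\<^bsub>add_monoid ?A\<^esub> f \<in> M" if "f \<in> M" for f
      proof -
        have "inv\<^bsub>add_monoid ?A\<^esub> f = - f"
          using path_algebra_uminus[OF keysM[OF that]] by (simp add: a_inv_def)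
        then show ?thesis using that by (simp add: M_def)
      qed
      show "f \<otimes>\<^bsub>add_monoid ?A\<^esub> g \<in> M" if "f \<in> M" "g \<in> M" for f g
        using that Poly_Mapping.keys_add[of f g] by (auto simp: M_def)
    qed
    fix a x assume a: "a \<in> M" and x: "x \<in> carrier ?A"
    then show "x \<otimes>\<^bsub>?A\<^esub> a \<in> M" "a \<otimes>\<^bsub>?A\<^esub> x \<in> M"
      using prod[of x a] prod[of a x] keysM[OF a] by simp_all
  qed
  moreover have "(\<lambda>p. single p 1) ` P \<subseteq> M"
  proof clarify
    fix p assume p: "p \<in> P"
    have pI: "single p 1 \<in> I" using I.genideal_self[OF gens] P(2) p by auto
    \<comment> \<open>Ideals are closed under ring multiplication, so the scalar \<open>c\<close>
      enters as the multiple of a trivial path.\<close>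
    have "pmult (single (trivial_path (tgt p)) c) (single p 1) \<in> I" for c
      by (rule I_mult(2)[OF pI]) (use P p path_verts(2)[of p] in \<open>auto simp del: split_paired_All\<close>)
    moreover have "pcomp (trivial_path (tgt p)) p = p" by (simp add: pcomp_def)
    ultimately have "single p c \<in> I" for c by (simp add: pmult_single)
    then show "single p 1 \<in> M" using P p by (auto simp: M_def)
  qed
  ultimately have "I \<subseteq> M" unfolding P(2) by (intro I.genideal_minimal)
  then show ?thesis by (auto simp: term_closed_def M_def)
qed

end

section \<open>Characters and derivations\<close>

lemma arrow_path_sel [simp]:
  "src (arrow_path Q a) = tail Q a" "arrs (arrow_path Q a) = [a]" "tgt (arrow_path Q a) = head Q a"
  by (simp_all add: arrow_path_def)

lemma short_path_eq_simps [simp]: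
  "trivial_path u = trivial_path v \<longleftrightarrow> u = v"
  "arrow_path Q a = arrow_path Q b \<longleftrightarrow> a = b"
  "trivial_path u \<noteq> arrow_path Q a" "arrow_path Q a \<noteq> trivial_path u"
  by (auto simp: trivial_path_def arrow_path_def)

text \<open>As in \<^const>\<open>Hom_to_field\<close>, functionals are extended by 0 outside the carrier.\<close>

definition functionals :: "('k::field, 'x, 'm) module_scheme \<Rightarrow> ('x \<Rightarrow> 'k) set" where
  "functionals R = {F. (\<forall>x\<in>carrier R. \<forall>y\<in>carrier R. F (x \<oplus>\<^bsub>R\<^esub> y) = F x + F y) \<and>
     (\<forall>c. \<forall>x\<in>carrier R. F (c \<odot>\<^bsub>R\<^esub> x) = c * F x) \<and> (\<forall>x. x \<notin> carrier R \<longrightarrow> F x = 0)}"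

definition characters :: "('k::field, 'x, 'm) module_scheme \<Rightarrow> ('x \<Rightarrow> 'k) set" where
  "characters R = {\<chi> \<in> functionals R. \<chi> \<one>\<^bsub>R\<^esub> = 1 \<and>
     (\<forall>x\<in>carrier R. \<forall>y\<in>carrier R. \<chi> (x \<otimes>\<^bsub>R\<^esub> y) = \<chi> x * \<chi> y)}"

text \<open>Derivations into the one-dimensional bimodule on which the algebra acts through
  \<open>\<chi>\<close> from the left and through \<open>\<psi>\<close> from the right.\<close>

definition derivations :: "('k::field, 'x, 'm) module_scheme \<Rightarrow> ('x \<Rightarrow> 'k) \<Rightarrow> ('x \<Rightarrow> 'k) \<Rightarrow> ('x \<Rightarrow> 'k) set" where
  "derivations R \<chi> \<psi> = {D \<in> functionals R.
     \<forall>x\<in>carrier R. \<forall>y\<in>carrier R. D (x \<otimes>\<^bsub>R\<^esub> y) = \<chi> x * D y + D x * \<psi> y}"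

lemma (in fin_digraph) lookup_one:
  "lookup \<one>\<^bsub>path_algebra G\<^esub> p = (if p \<in> trivial_path ` verts G then 1 else 0)"
proof -
  have "lookup \<one>\<^bsub>path_algebra G\<^esub> p = (\<Sum>v\<in>verts G. if trivial_path v = p then 1 else 0)"
    by (simp add: path_algebra_def lookup_sum lookup_single_if)
  also have "\<dots> = (\<Sum>q\<in>trivial_path ` verts G. if q = p then 1 else 0)"
    by (subst sum.reindex) (simp_all add: inj_on_def)
  finally show ?thesis by (simp only: sum.delta[OF finite_imageI[OF finite_verts]])
qed

section \<open>Cosets of an admissible ideal, characters and derivations of the quotient\<close>

context bound_algebra
begin

abbreviation A :: "('k, ('v, 'a) qpath \<Rightarrow>\<^sub>0 'k) module" where "A \<equiv> path_algebra Q"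
abbreviation R :: "('k, (('v, 'a) qpath \<Rightarrow>\<^sub>0 'k) set) module" where "R \<equiv> bound_quiver_algebra Q I"
abbreviation cls :: "(('v, 'a) qpath \<Rightarrow>\<^sub>0 'k) \<Rightarrow> (('v, 'a) qpath \<Rightarrow>\<^sub>0 'k) set" where "cls f \<equiv> I +>\<^bsub>A\<^esub> f"
abbreviation vert :: "'v \<Rightarrow> ('v, 'a) qpath \<Rightarrow>\<^sub>0 'k" where "vert v \<equiv> single (trivial_path v) 1"
abbreviation arrow :: "'a \<Rightarrow> ('v, 'a) qpath \<Rightarrow>\<^sub>0 'k" where "arrow a \<equiv> single (arrow_path Q a) 1"

lemma quotient_record:
  "carrier R = carrier (A Quot I)" "(\<otimes>\<^bsub>R\<^esub>) = (\<otimes>\<^bsub>A Quot I\<^esub>)" "(\<oplus>\<^bsub>R\<^esub>) = (\<oplus>\<^bsub>A Quot I\<^esub>)"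
  "\<one>\<^bsub>R\<^esub> = \<one>\<^bsub>A Quot I\<^esub>" "\<zero>\<^bsub>R\<^esub> = \<zero>\<^bsub>A Quot I\<^esub>"
  "c \<odot>\<^bsub>R\<^esub> X = (\<Union>x\<in>X. cls (c \<odot>\<^bsub>A\<^esub> x))"
  by (simp_all add: quotient_algebra_def ring.extend_def module.fields_def)

lemma carrier_R: "X \<in> carrier R \<longleftrightarrow> (\<exists>f\<in>carrier A. X = cls f)"
  unfolding quotient_record FactRing_def A_RCOSETS_def RCOSETS_def a_r_coset_def by auto

lemma cls_closed: "f \<in> carrier A \<Longrightarrow> cls f \<in> carrier R"
  unfolding carrier_R by blast

lemma cls_add: "f \<in> carrier A \<Longrightarrow> g \<in> carrier A \<Longrightarrow> cls f \<oplus>\<^bsub>R\<^esub> cls g = cls (f + g)"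
  using ring_hom_add[OF I.rcos_ring_hom, of f g] by (simp add: quotient_record)

lemma cls_mult: "f \<in> carrier A \<Longrightarrow> g \<in> carrier A \<Longrightarrow> cls f \<otimes>\<^bsub>R\<^esub> cls g = cls (pmult f g)"
  using ring_hom_mult[OF I.rcos_ring_hom, of f g] by (simp add: quotient_record)

lemma cls_one: "\<one>\<^bsub>R\<^esub> = cls \<one>\<^bsub>A\<^esub>"
  using ring_hom_one[OF I.rcos_ring_hom] by (simp add: quotient_record)

lemma cls_zero: "\<zero>\<^bsub>R\<^esub> = I"
  by (simp add: quotient_record FactRing_def)

lemma in_cls_iff: "g \<in> cls f \<longleftrightarrow> (\<exists>i\<in>I. g = i + f)"
  by (auto simp: a_r_coset_def r_coset_def)

lemma cls_add_ideal:
  assumes "i \<in> I" "f \<in> carrier A"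
  shows "cls (i + f) = cls f"
proof -
  have "i + f \<in> cls f" using assms in_cls_iff by blast
  then show ?thesis
    using I.a_repr_independence[of "i + f" I f] assms I.a_subgroup by auto
qed

lemma cls_self: "f \<in> carrier A \<Longrightarrow> f \<in> cls f"
  unfolding in_cls_iff using subgroup.one_closed[OF I.a_subgroup] by (intro bexI[of _ 0]) simp_all

lemma one_closed: "\<one>\<^bsub>A\<^esub> \<in> carrier A"
  by (rule I.one_closed)

lemma smult_closed: "f \<in> carrier A \<Longrightarrow> c \<odot>\<^bsub>A\<^esub> f \<in> carrier A"
  by (auto simp: in_keys_iff subset_iff)

text \<open>Scaling by \<open>c\<close> is multiplication by the ring element \<open>c\<close> times
  the unit.\<close>

lemma smult_ideal: "i \<in> I \<Longrightarrow> c \<odot>\<^bsub>A\<^esub> i \<in> I"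
proof -
  assume i: "i \<in> I"
  have "pmult (c \<odot>\<^bsub>A\<^esub> \<one>\<^bsub>A\<^esub>) i \<in> I"
    by (rule I_mult(2)[OF i]) (use smult_closed[OF one_closed] in simp)
  moreover have "pmult \<one>\<^bsub>A\<^esub> i = i" using I.l_one[of i] I.a_Hcarr[OF i] by simp
  ultimately show ?thesis by (simp add: pmult_smult_left)
qed

lemma cls_smult:
  assumes "f \<in> carrier A"
  shows "c \<odot>\<^bsub>R\<^esub> cls f = cls (c \<odot>\<^bsub>A\<^esub> f)"
proof -
  have "cls (c \<odot>\<^bsub>A\<^esub> x) = cls (c \<odot>\<^bsub>A\<^esub> f)" if x: "x \<in> cls f" for x
  proof -
    obtain i where i: "i \<in> I" "x = i + f" using x in_cls_iff by blast
    have "c \<odot>\<^bsub>A\<^esub> x = c \<odot>\<^bsub>A\<^esub> i + c \<odot>\<^bsub>A\<^esub> f"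
      by (rule poly_mapping_eqI) (simp add: i(2) lookup_add algebra_simps)
    then show ?thesis using cls_add_ideal[OF smult_ideal[OF i(1)] smult_closed[OF assms]] by simp
  qed
  then have "(\<Union>x\<in>cls f. cls (c \<odot>\<^bsub>A\<^esub> x)) = (\<Union>x\<in>cls f. cls (c \<odot>\<^bsub>A\<^esub> f))" by (rule SUP_cong[OF HOL.refl])
  moreover have "cls f \<noteq> {}" using cls_self[OF assms] by blast
  ultimately show ?thesis by (simp add: quotient_record)
qed

text \<open>The coefficient is read off an arbitrary representative. For paths of length below two
  this is well defined, since an admissible ideal has no such terms; outside the carrier the value
  is 0, as for all members of \<open>functionals\<close>.\<close>

definition coefficient :: "('v, 'a) qpath \<Rightarrow> (('v, 'a) qpath \<Rightarrow>\<^sub>0 'k) set \<Rightarrow> 'k" where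
  "coefficient p X = (if X \<in> carrier R then lookup (SOME f. f \<in> X) p else 0)"

lemma coefficient_cls:
  assumes "length (arrs p) < 2" "f \<in> carrier A"
  shows "coefficient p (cls f) = lookup f p"
proof -
  have "(SOME f'. f' \<in> cls f) \<in> cls f" using cls_self[OF assms(2)] by (rule someI)
  then obtain i where "i \<in> I" "(SOME f'. f' \<in> cls f) = i + f" using in_cls_iff by blast
  then show ?thesis
    using I_lookup[OF _ assms(1)] cls_closed[OF assms(2)] by (simp add: coefficient_def lookup_add)
qed

lemma coefficient_linear:
  assumes "length (arrs p) < 2"
  shows "coefficient p \<in> functionals R"
proof -
  have "f + g \<in> carrier A" if "f \<in> carrier A" "g \<in> carrier A" for f g :: "('v, 'a) qpath \<Rightarrow>\<^sub>0 'k"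
    using I.a_closed[OF that] by simp
  then show ?thesis
    unfolding functionals_def
    using coefficient_cls[OF assms] smult_closed
    by (auto simp: carrier_R cls_add cls_smult lookup_add simp del: path_algebra_simps(1)) (simp add: coefficient_def carrier_R)
qed

abbreviation vertex_char where "vertex_char v \<equiv> coefficient (trivial_path v)"

lemma vertex_char_cls: "f \<in> carrier A \<Longrightarrow> vertex_char v (cls f) = lookup f (trivial_path v)"
  by (rule coefficient_cls) simp_all

lemma arrow_coefficient_cls:
  "f \<in> carrier A \<Longrightarrow> coefficient (arrow_path Q a) (cls f) = lookup f (arrow_path Q a)"
  by (rule coefficient_cls) (simp_all add: arrow_path_def)

lemma mult_closed: "f \<in> carrier A \<Longrightarrow> g \<in> carrier A \<Longrightarrow> pmult f g \<in> carrier A"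
  using I.m_closed[of f g] by simp

lemma vertex_char: "v \<in> verts Q \<Longrightarrow> vertex_char v \<in> characters R"
  unfolding characters_def
  by (auto simp: coefficient_linear cls_one vertex_char_cls one_closed lookup_one carrier_R cls_mult mult_closed
    lookup_pmult_trivial simp del: path_algebra_simps(1)) (simp add: lookup_pmult_trivial)

lemma vert_closed: "v \<in> verts Q \<Longrightarrow> vert v \<in> carrier A"
  and arrow_closed: "a \<in> arcs Q \<Longrightarrow> arrow a \<in> carrier A"
  by simp_all

lemma arrow_power:
  assumes "f \<in> arrow_ideal_power Q i" "g \<in> arrow_ideal_power Q j"
  shows "pmult f g \<in> (arrow_ideal_power Q (i + j) :: (('v, 'a) qpath \<Rightarrow>\<^sub>0 'k) set)"
proof -
  have "i + j \<le> length (arrs r)" if "r \<in> keys (pmult f g)" for r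
    using that
  proof (rule keys_pmult)
    fix p q assume "p \<in> keys f" "q \<in> keys g" "r = pcomp p q"
    moreover from this have "i \<le> length (arrs p)" "j \<le> length (arrs q)"
      using assms unfolding arrow_ideal_power_def by blast+
    ultimately show "i + j \<le> length (arrs r)" by simp
  qed
  then show ?thesis using assms mult_closed[of f g] by (auto simp: arrow_ideal_power_def)
qed

lemma functional_expand:
  assumes F: "F \<in> functionals R" and f: "f \<in> carrier A"
  shows "F (cls f) = (\<Sum>p\<in>keys f. lookup f p * F (cls (single p 1)))"
proof -
  have add: "F (cls (g + h)) = F (cls g) + F (cls h)" if "g \<in> carrier A" "h \<in> carrier A" for g h
    using F that cls_closed[OF that(1)] cls_closed[OF that(2)]
    by (simp add: functionals_def cls_add[OF that, symmetric])
  have "F (cls f) = (\<Sum>p\<in>keys f. F (cls (single p (lookup f p))))"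
    by (rule path_algebra_additive_expand[OF add f])
  also have "\<dots> = (\<Sum>p\<in>keys f. lookup f p * F (cls (single p 1)))"
  proof (rule sum.cong[OF HOL.refl])
    fix p assume "p \<in> keys f"
    then have p: "single p 1 \<in> carrier A" using f by auto
    have "single p (lookup f p) = lookup f p \<odot>\<^bsub>A\<^esub> single p 1"
      by (rule poly_mapping_eqI) (simp add: lookup_single_if)
    then show "F (cls (single p (lookup f p)))
        = lookup f p * F (cls (single p 1))"
      using F cls_closed[OF p] by (simp add: functionals_def cls_smult[OF p, symmetric])
  qed
  finally show ?thesis .
qed

lemma functional_zero:
  assumes F: "F \<in> functionals R" and "f \<in> I"
  shows "F (cls f) = 0"
proof -
  have "cls f = cls 0" using cls_add_ideal[OF assms(2), of 0] by simp
  then show ?thesis using functional_expand[OF F, of 0] by simp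
qed

lemma functional_eqI:
  assumes "F \<in> functionals R" "G \<in> functionals R"
    and "\<And>p. p \<in> paths Q \<Longrightarrow> F (cls (single p 1)) = G (cls (single p 1))"
  shows "F = G"
proof (rule ext)
  fix X show "F X = G X"
  proof (cases "X \<in> carrier R")
    case True
    then obtain f where f: "f \<in> carrier A" "X = cls f" by (auto simp: carrier_R)
    show ?thesis
      unfolding f(2) functional_expand[OF assms(1) f(1)] functional_expand[OF assms(2) f(1)]
      by (rule sum.cong) (use f(1) assms(3) in auto)
  qed (use assms(1,2) in \<open>auto simp: functionals_def\<close>)
qed

text \<open>A sufficiently high power of the path lies in the ideal, so the value of the character
  is a nilpotent element of a field.\<close>

lemma char_path:
  assumes \<chi>: "\<chi> \<in> characters R" and p: "p \<in> paths Q" "arrs p \<noteq> []"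
  shows "\<chi> (cls (single p 1)) = 0"
proof -
  let ?x = "single p 1 :: ('v, 'a) qpath \<Rightarrow>\<^sub>0 'k"
  obtain m where m: "arrow_ideal_power Q m \<subseteq> I" using admissible by (auto simp: admissible_def)
  have x: "?x \<in> arrow_ideal_power Q 1" using p by (cases "arrs p") (auto simp: arrow_ideal_power_def)
  have xc: "?x \<in> carrier A" using p by simp
  have lin: "\<chi> \<in> functionals R" using \<chi> by (simp add: characters_def)
  \<comment> \<open>The iterate is the power with exponent \<open>Suc n\<close>, so its terms have
    length at least \<open>Suc n\<close>.\<close>
  have "((pmult ?x ^^ n) ?x \<in> arrow_ideal_power Q (Suc n)) \<and>
      \<chi> (cls ((pmult ?x ^^ n) ?x)) = \<chi> (cls ?x) ^ Suc n" for n
  proof (induction n)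
    case (Suc n)
    let ?y = "(pmult ?x ^^ n) ?x"
    have yc: "?y \<in> carrier A" using Suc by (simp add: arrow_ideal_power_def)
    have "pmult ?x ?y \<in> arrow_ideal_power Q (Suc (Suc n))" using arrow_power[OF x] Suc by force
    moreover have "\<chi> (cls (pmult ?x ?y)) = \<chi> (cls ?x) * \<chi> (cls ?y)"
      using \<chi> cls_closed[OF xc] cls_closed[OF yc] by (simp add: characters_def cls_mult[OF xc yc, symmetric])
    ultimately show ?case using Suc by simp
  qed (use x in simp)
  note power = this[of m]
  have "arrow_ideal_power Q (Suc m) \<subseteq> (arrow_ideal_power Q m :: (('v, 'a) qpath \<Rightarrow>\<^sub>0 'k) set)"
    unfolding arrow_ideal_power_def using Suc_leD by blast
  then have "(pmult ?x ^^ m) ?x \<in> I" "\<chi> (cls ((pmult ?x ^^ m) ?x)) = \<chi> (cls ?x) ^ Suc m"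
    using power m by blast+
  then have "\<chi> (cls ?x) ^ Suc m = 0" using functional_zero[OF lin] by simp
  then show ?thesis by auto
qed

lemma path_cases:
  assumes "p \<in> paths Q"
  obtains v where "v \<in> verts Q" "p = trivial_path v" | "arrs p \<noteq> []"
  using path_empty_eq[OF assms] path_verts[OF assms] by metis

text \<open>A character kills paths of positive length and sends the orthogonal idempotents
  \<open>vert v\<close> to orthogonal idempotents of a field. They cannot all go to 0, since the
  unit goes to 1; so exactly one goes to 1, and its vertex determines the character.\<close>

lemma vertex_chars: "bij_betw vertex_char (verts Q) (characters R)"
proof (rule bij_betw_imageI)
  show "inj_on vertex_char (verts Q)"
  proof (rule inj_onI)
    fix v w assume vw: "v \<in> verts Q" "w \<in> verts Q" "vertex_char v = vertex_char w"
    have "vertex_char v (cls (vert v)) = vertex_char w (cls (vert v))" using vw by simp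
    then show "v = w"
      using vertex_char_cls[OF vert_closed[OF vw(1)]]
      by (simp add: lookup_single_if trivial_path_def split: if_splits)
  qed
  show "vertex_char ` verts Q = characters R"
  proof
    show "vertex_char ` verts Q \<subseteq> characters R" using vertex_char by blast
    show "characters R \<subseteq> vertex_char ` verts Q"
    proof
      fix \<chi> assume \<chi>: "\<chi> \<in> characters R"
      then have lin: "\<chi> \<in> functionals R" by (simp add: characters_def)
      define c where "c v = \<chi> (cls (vert v))" for v
      have prod: "c v * c w = (if v = w then c v else 0)" if v: "v \<in> verts Q" and w: "w \<in> verts Q" for v w
      proof -
        have "c v * c w = \<chi> (cls (pmult (vert v) (vert w)))"
          using \<chi> cls_closed[OF vert_closed[OF v]] cls_closed[OF vert_closed[OF w]]
          by (simp add: c_def characters_def cls_mult[OF vert_closed[OF v] vert_closed[OF w], symmetric])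
        also have "pmult (vert v) (vert w) = (if v = w then vert v else 0)"
          by (simp add: pmult_single pcomp_def trivial_path_def)
        finally show ?thesis using functional_expand[OF lin, of 0] by (simp add: c_def)
      qed
      have "\<exists>v\<in>verts Q. c v \<noteq> 0"
      proof (rule ccontr)
        assume "\<not> (\<exists>v\<in>verts Q. c v \<noteq> 0)"
        then have "\<chi> (cls (single p 1)) = 0" if "p \<in> paths Q" for p
          using that char_path[OF \<chi> that] by (elim path_cases) (auto simp: c_def)
        then have "\<chi> (cls \<one>\<^bsub>A\<^esub>) = 0"
          unfolding functional_expand[OF lin one_closed] using one_closed by (intro sum.neutral) auto
        moreover have "\<chi> (cls \<one>\<^bsub>A\<^esub>) = 1" using \<chi> by (simp add: characters_def cls_one)
        ultimately show False by simp
      qed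
      then obtain v where v: "v \<in> verts Q" "c v \<noteq> 0" by blast
      have cv: "c v = 1" using prod[OF v(1) v(1)] v(2) by simp
      have "\<chi> = vertex_char v"
      proof (rule functional_eqI[OF lin coefficient_linear])
        fix p assume p: "p \<in> paths Q"
        then have pc: "single p 1 \<in> carrier A" by simp
        from p show "\<chi> (cls (single p 1)) = vertex_char v (cls (single p 1))"
        proof (rule path_cases)
          fix w assume "w \<in> verts Q" "p = trivial_path w"
          then show ?thesis using prod[OF v(1), of w] cv vertex_char_cls[OF pc, of v]
            by (cases "w = v") (auto simp: c_def lookup_single_if)
        next
          assume "arrs p \<noteq> []"
          then show ?thesis using char_path[OF \<chi> p] vertex_char_cls[OF pc, of v]
            by (auto simp: lookup_single_if)
        qed
      qed simp
      then show "\<chi> \<in> vertex_char ` verts Q" using v by blast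
    qed
  qed
qed

text \<open>
  These derivations modulo the inner ones, which are the multiples of
  \<open>vertex_char v - vertex_char w\<close>, form the first extension group of two simple modules.
\<close>

lemma derivation_dim:
  assumes v: "v \<in> verts Q" and w: "w \<in> verts Q"
  shows "fun_dim (derivations R (vertex_char w) (vertex_char v)) =
    card {a \<in> arcs Q. tail Q a = v \<and> head Q a = w} + (if v = w then 0 else 1)"
proof -
  let ?D = "derivations R (vertex_char w) (vertex_char v)"
  let ?arrows = "{a \<in> arcs Q. tail Q a = v \<and> head Q a = w}"
  \<comment> \<open>\<open>Some a\<close> indexes the coefficient of an arrow \<open>a\<close>, and
    \<open>None\<close> the inner derivation \<open>vertex_char v - vertex_char w\<close>, which
    vanishes for \<open>v = w\<close>. The points \<open>x\<close> are chosen so that evaluation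
    there is dual to \<open>b\<close>.\<close>
  define K where "K = Some ` ?arrows \<union> (if v = w then {} else {None})"
  define x where "x i = (case i of None \<Rightarrow> cls (vert v) | Some a \<Rightarrow> cls (arrow a))" for i
  define b where "b i = (case i of None \<Rightarrow> (\<lambda>X. vertex_char v X - vertex_char w X)
    | Some a \<Rightarrow> coefficient (arrow_path Q a))" for i
  have len: "length (arrs (arrow_path Q a)) < 2" "length (arrs (trivial_path u)) < 2" for a u
    by simp_all
  have lin: "b i \<in> functionals R" for i
    using coefficient_linear[OF len(1)] coefficient_linear[OF len(2), of v] coefficient_linear[OF len(2), of w]
    by (cases i) (auto simp: b_def functionals_def algebra_simps)
  have bD: "b i \<in> ?D" if "i \<in> K" for i
  proof -
    have "b i (cls f \<otimes>\<^bsub>R\<^esub> cls g) = vertex_char w (cls f) * b i (cls g) + b i (cls f) * vertex_char v (cls g)"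
      if f: "f \<in> carrier A" and g: "g \<in> carrier A" for f g
    proof (cases i)
      case None
      then show ?thesis
        using f g v w by (simp add: b_def cls_mult[OF f g] vertex_char_cls[OF f] vertex_char_cls[OF g]
            vertex_char_cls[OF mult_closed[OF f g]] lookup_pmult_trivial algebra_simps)
    next
      case (Some a)
      then have "a \<in> arcs Q" "tail Q a = v" "head Q a = w" using \<open>i \<in> K\<close> by (auto simp: K_def split: if_splits)
      then show ?thesis
        using f g lookup_pmult_arrow[of f g a]
        by (simp add: Some b_def cls_mult[OF f g] vertex_char_cls[OF f] vertex_char_cls[OF g]
            arrow_coefficient_cls[OF f] arrow_coefficient_cls[OF g] arrow_coefficient_cls[OF mult_closed[OF f g]])
    qed
    then show ?thesis
      unfolding derivations_def using lin by (auto simp: carrier_R simp del: path_algebra_simps(1))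
  qed
  have dual: "b i (x j) = (if i = j then 1 else 0)" if "i \<in> K" "j \<in> K" for i j
  proof (cases j)
    case None
    then have "v \<noteq> w" using that by (auto simp: K_def split: if_splits)
    then show ?thesis
      using None by (cases i) (auto simp: b_def x_def vertex_char_cls[OF vert_closed[OF v]]
          arrow_coefficient_cls[OF vert_closed[OF v]] lookup_single_if)
  next
    case (Some a)
    then have a: "a \<in> arcs Q" using that by (auto simp: K_def split: if_splits)
    then show ?thesis
      using Some by (cases i) (auto simp: b_def x_def vertex_char_cls[OF arrow_closed[OF a]]
          arrow_coefficient_cls[OF arrow_closed[OF a]] lookup_single_if)
  qed
  have finK: "finite K" by (simp add: K_def)
  have expand: "D X = (\<Sum>i\<in>K. D (x i) * b i X)" if D: "D \<in> ?D" for D X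
  proof -
    have linD: "D \<in> functionals R" using D by (simp add: derivations_def)
    define E where "E X = (\<Sum>i\<in>K. D (x i) * b i X)" for X
    have linE: "E \<in> functionals R"
      using lin unfolding E_def functionals_def
      by (auto simp: sum.distrib algebra_simps sum_distrib_left)
    have leib: "D (cls (pmult f g)) = lookup f (trivial_path w) * D (cls g)
        + D (cls f) * lookup g (trivial_path v)" if f: "f \<in> carrier A" and g: "g \<in> carrier A" for f g
      using D cls_closed[OF f] cls_closed[OF g]
      by (simp add: derivations_def cls_mult[OF f g, symmetric] vertex_char_cls[OF f] vertex_char_cls[OF g])
    have D0: "D (cls 0) = 0" using functional_expand[OF linD, of 0] by simp
    \<comment> \<open>Idempotence of \<open>vert u\<close> forces the value 0 unless exactly one of
      \<open>u = v\<close> and \<open>u = w\<close> holds. For distinct \<open>v\<close> and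
      \<open>w\<close> the vanishing product of \<open>vert w\<close> and \<open>vert v\<close>
      makes the two remaining values opposite.\<close>
    have Dv: "D (cls (vert u)) = (if v = w then 0 else if u = v then D (cls (vert v))
        else if u = w then - D (cls (vert v)) else 0)" if u: "u \<in> verts Q" for u
    proof -
      have "pmult (vert u) (vert u) = vert u" by (simp add: pmult_single pcomp_def trivial_path_def)
      then have 1: "D (cls (vert u)) = (if u = w then 1 else 0) * D (cls (vert u)) + D (cls (vert u)) * (if u = v then 1 else 0)"
        using leib[OF vert_closed[OF u] vert_closed[OF u]] by (simp add: lookup_single_if)
      have 2: "D (cls (vert w)) + D (cls (vert v)) = 0" if "v \<noteq> w"
      proof -
        have "pmult (vert w) (vert v) = 0" using that by (simp add: pmult_single)
        then show ?thesis
          using leib[OF vert_closed[OF w] vert_closed[OF v]] D0 by (simp add: lookup_single_if add.commute)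
      qed
      show ?thesis using 1 2 by (auto simp: eq_neg_iff_add_eq_0 split: if_splits)
    qed
    \<comment> \<open>Multiplication by the trivial path at either end reproduces the arrow; the
      Leibniz rule then gives 0 unless the arrow goes from \<open>v\<close> to
      \<open>w\<close>.\<close>
    have Da: "D (cls (arrow a)) = 0" if a: "a \<in> arcs Q" and ne: "tail Q a \<noteq> v \<or> head Q a \<noteq> w" for a
    proof -
      have na: "trivial_path u \<noteq> arrow_path Q a" "arrow_path Q a \<noteq> trivial_path u" for u
        by (simp_all add:)
      have th: "tail Q a \<in> verts Q" "head Q a \<in> verts Q" using a by simp_all
      have "pmult (arrow a) (vert (tail Q a)) = arrow a" "pmult (vert (head Q a)) (arrow a) = arrow a"
        by (simp_all add: pmult_single pcomp_def) (simp_all add: arrow_path_def)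
      then have "D (cls (arrow a)) = D (cls (arrow a)) * (if tail Q a = v then 1 else 0)"
          "D (cls (arrow a)) = (if head Q a = w then 1 else 0) * D (cls (arrow a))"
        using leib[OF arrow_closed[OF a] vert_closed[OF th(1)]] leib[OF vert_closed[OF th(2)] arrow_closed[OF a]]
        by (simp_all add: lookup_single_if)
      then show ?thesis using ne by (auto split: if_splits)
    qed
    have "D = E"
    proof (rule functional_eqI[OF linD linE])
      fix p assume p: "p \<in> paths Q"
      then have pc: "single p 1 \<in> carrier A" by simp
      consider u where "u \<in> verts Q" "p = trivial_path u" | a where "a \<in> arcs Q" "p = arrow_path Q a"
        | "2 \<le> length (arrs p)"
      proof (cases "arrs p")
        case Nil
        then show ?thesis using that(1) path_empty_eq[OF p] path_verts(1)[OF p] by blast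
      next
        case (Cons a as)
        then show ?thesis using that(2,3) path_single_eq[OF p, of a] by (cases as) auto
      qed
      then show "D (cls (single p 1)) = E (cls (single p 1))"
      proof cases
        case 1
        have na: "trivial_path u \<noteq> arrow_path Q a" for a by (simp add:)
        have "E (cls (vert u)) = (\<Sum>i\<in>(if v = w then {} else {None}). D (x i) * b i (cls (vert u)))"
          unfolding E_def
          by (rule sum.mono_neutral_right) (use finK 1 in \<open>auto simp: K_def b_def arrow_coefficient_cls[OF vert_closed] lookup_single_if split: if_splits\<close>)
        also have "\<dots> = D (cls (vert u))"
          using Dv[OF 1(1)] by (auto simp: b_def x_def vertex_char_cls[OF vert_closed[OF 1(1)]] lookup_single_if)
        finally show ?thesis unfolding 1(2) by simp
      next
        case 2
        have na: "arrow_path Q a \<noteq> trivial_path u" for u by (simp add:)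
        have "E (cls (arrow a)) = (\<Sum>i\<in>(if tail Q a = v \<and> head Q a = w then {Some a} else {}). D (x i) * b i (cls (arrow a)))"
          unfolding E_def
          by (rule sum.mono_neutral_right)
            (use finK 2 in \<open>auto simp: K_def b_def arrow_coefficient_cls[OF arrow_closed] vertex_char_cls[OF arrow_closed]
              lookup_single_if split: if_splits\<close>)
        also have "\<dots> = D (cls (arrow a))"
          using Da[OF 2(1)] by (auto simp: b_def x_def arrow_coefficient_cls[OF arrow_closed[OF 2(1)]] lookup_single_if)
        finally show ?thesis unfolding 2(2) by simp
      next
        case 3
        then obtain a bs where bs: "arrs p = a # bs" "bs \<noteq> []"
          by (cases "arrs p"; cases "tl (arrs p)") auto
        let ?q = "(head Q a, bs, tgt p) :: ('v, 'a) qpath"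
        have pa: "a \<in> arcs Q" "src p = tail Q a" "?q \<in> paths Q"
          using p bs by (auto simp: paths_iff awalk_simps)
        have pq: "p = pcomp ?q (arrow_path Q a)"
          using pa(2) bs(1) by (cases p) (simp add: arrow_path_def)
        have qc: "single ?q 1 \<in> carrier A" using pa by simp
        \<comment> \<open>Both factors have positive length, so each term of the Leibniz rule
          contains a vanishing coefficient at a trivial path.\<close>
        have "single p 1 = pmult (single ?q (1::'k)) (arrow a)"
          by (subst pq) (simp add: pmult_single)
        moreover have "?q \<noteq> trivial_path w" using bs(2) by (simp add: trivial_path_def)
        ultimately have "D (cls (single p 1)) = 0"
          using leib[OF qc arrow_closed[OF pa(1)]] by (simp add: lookup_single_if)
        moreover have "b i (cls (single p 1)) = 0" for i
          using bs by (cases i) (auto simp: b_def vertex_char_cls[OF pc] arrow_coefficient_cls[OF pc] lookup_single_if)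
        then have "E (cls (single p 1)) = 0" by (simp add: E_def)
        ultimately show ?thesis by simp
      qed
    qed
    from fun_cong[OF this, of X] show ?thesis unfolding E_def .
  qed
  have "fun_dim ?D = card K" by (rule fun_dim_eq[OF finK bD dual expand])
  also have "card K = card ?arrows + (if v = w then 0 else 1)"
    unfolding K_def by (subst card_Un_disjoint) (auto simp: card_image)
  finally show ?thesis .
qed

end

section \<open>Invariance of the Betti number under algebra isomorphisms\<close>

lemma (in quiver) walk_transport:
  assumes Q': "quiver Q'" and \<nu>: "\<nu> ` verts Q \<subseteq> verts Q'"
    and arrow: "\<forall>a\<in>arcs Q. \<exists>b\<in>arcs Q'. tail Q' b = \<nu> (tail Q a) \<and> head Q' b = \<nu> (head Q a)"
  shows "walk Q u p v \<Longrightarrow> \<exists>q. walk Q' (\<nu> u) q (\<nu> v)"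
proof (induction p arbitrary: u)
  case Nil
  then show ?case using \<nu> by (auto intro!: exI[of _ "[]"])
next
  case (Cons x p)
  obtain a b where x: "x = (a, b)" by (cases x)
  have a: "a \<in> arcs Q" and u: "u = dtail Q x" and p: "walk Q (dhead Q x) p v"
    using Cons.prems by (auto simp: x)
  obtain q where q: "walk Q' (\<nu> (dhead Q x)) q (\<nu> v)" using Cons.IH[OF p] ..
  obtain c where c: "c \<in> arcs Q'" "tail Q' c = \<nu> (tail Q a)" "head Q' c = \<nu> (head Q a)" using arrow a by blast
  have "walk Q' (\<nu> u) ((c, b) # q) (\<nu> v)"
    using c q by (cases b) (auto simp: u x)
  then show ?case ..
qed

text \<open>Arrows are counted by summing over pairs of vertices, and components depend only on
  which pairs are joined by some arrow. So the numbers of arrows suffice, and no bijection between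
  the arrows has to be chosen.\<close>

lemma betti_transport:
  assumes Q: "fin_digraph Q" and Q': "fin_digraph Q'" and \<nu>: "bij_betw \<nu> (verts Q) (verts Q')"
    and arrows: "\<And>v w. v \<in> verts Q \<Longrightarrow> w \<in> verts Q \<Longrightarrow>
      card {a \<in> arcs Q. tail Q a = v \<and> head Q a = w} = card {a \<in> arcs Q'. tail Q' a = \<nu> v \<and> head Q' a = \<nu> w}"
  shows "betti Q = betti Q'"
proof -
  interpret Q: fin_digraph Q by fact
  interpret Q': fin_digraph Q' by fact
  interpret qQ: quiver Q by unfold_locales
  interpret qQ': quiver Q' by unfold_locales
  have V: "card (verts Q) = card (verts Q')" using \<nu> by (rule bij_betw_same_card)
  have surj: "\<nu> ` verts Q = verts Q'" and inj: "inj_on \<nu> (verts Q)" using \<nu> by (auto simp: bij_betw_def)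
  have count: "card (arcs G) = (\<Sum>(v, w)\<in>verts G \<times> verts G. card {a \<in> arcs G. tail G a = v \<and> head G a = w})"
    if "fin_digraph G" for G :: "('x, 'y) pre_digraph"
  proof -
    interpret G: fin_digraph G by fact
    have "arcs G = (\<Union>vw\<in>verts G \<times> verts G. {a \<in> arcs G. tail G a = fst vw \<and> head G a = snd vw})"
      by auto
    also have "card \<dots> = (\<Sum>vw\<in>verts G \<times> verts G. card {a \<in> arcs G. tail G a = fst vw \<and> head G a = snd vw})"
      by (rule card_UN_disjoint) (auto simp: prod_eq_iff)
    finally show ?thesis by (simp add: case_prod_unfold)
  qed
  have "card (arcs Q) = (\<Sum>(v, w)\<in>verts Q \<times> verts Q. card {a \<in> arcs Q'. tail Q' a = \<nu> v \<and> head Q' a = \<nu> w})"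
    unfolding count[OF Q] by (rule sum.cong) (auto simp: arrows)
  also have "\<dots> = (\<Sum>(v, w)\<in>verts Q' \<times> verts Q'. card {a \<in> arcs Q'. tail Q' a = v \<and> head Q' a = w})"
    by (subst sum.reindex_bij_betw[OF bij_betw_map_prod[OF \<nu> \<nu>], symmetric]) (simp add: case_prod_unfold)
  also have "\<dots> = card (arcs Q')" unfolding count[OF Q'] ..
  finally have E: "card (arcs Q) = card (arcs Q')" .
  define \<mu> where "\<mu> = inv_into (verts Q) \<nu>"
  have \<mu>: "\<mu> ` verts Q' \<subseteq> verts Q" "\<And>v. v \<in> verts Q' \<Longrightarrow> \<nu> (\<mu> v) = v" "\<And>v. v \<in> verts Q \<Longrightarrow> \<mu> (\<nu> v) = v"
    using \<nu> inj surj by (auto simp: \<mu>_def inv_into_into f_inv_into_f)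
  have fwd: "\<forall>a\<in>arcs Q. \<exists>b\<in>arcs Q'. tail Q' b = \<nu> (tail Q a) \<and> head Q' b = \<nu> (head Q a)"
  proof
    fix a assume a: "a \<in> arcs Q"
    have "card {b \<in> arcs Q. tail Q b = tail Q a \<and> head Q b = head Q a} \<noteq> 0" using a by auto
    then have "card {b \<in> arcs Q'. tail Q' b = \<nu> (tail Q a) \<and> head Q' b = \<nu> (head Q a)} \<noteq> 0"
      using arrows a by simp
    then show "\<exists>b\<in>arcs Q'. tail Q' b = \<nu> (tail Q a) \<and> head Q' b = \<nu> (head Q a)"
      unfolding card_eq_0_iff by blast
  qed
  have bwd: "\<forall>a\<in>arcs Q'. \<exists>b\<in>arcs Q. tail Q b = \<mu> (tail Q' a) \<and> head Q b = \<mu> (head Q' a)"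
  proof
    fix a assume a: "a \<in> arcs Q'"
    have th: "tail Q' a \<in> verts Q'" "head Q' a \<in> verts Q'" using a by auto
    have "card {b \<in> arcs Q'. tail Q' b = tail Q' a \<and> head Q' b = head Q' a} \<noteq> 0" using a by auto
    moreover have "\<mu> (tail Q' a) \<in> verts Q" "\<mu> (head Q' a) \<in> verts Q" using th \<mu>(1) by blast+
    from arrows[OF this] have "card {b \<in> arcs Q. tail Q b = \<mu> (tail Q' a) \<and> head Q b = \<mu> (head Q' a)}
        = card {b \<in> arcs Q'. tail Q' b = tail Q' a \<and> head Q' b = head Q' a}"
      by (simp only: \<mu>(2)[OF th(1)] \<mu>(2)[OF th(2)])
    ultimately have "card {b \<in> arcs Q. tail Q b = \<mu> (tail Q' a) \<and> head Q b = \<mu> (head Q' a)} \<noteq> 0"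
      by simp
    then show "\<exists>b\<in>arcs Q. tail Q b = \<mu> (tail Q' a) \<and> head Q b = \<mu> (head Q' a)"
      unfolding card_eq_0_iff by blast
  qed
  have comp: "component_of Q' (\<nu> u) = \<nu> ` component_of Q u" if u: "u \<in> verts Q" for u
  proof
    show "\<nu> ` component_of Q u \<subseteq> component_of Q' (\<nu> u)"
      using qQ.walk_transport[OF qQ'.quiver_axioms _ fwd] surj
      by (auto simp: qQ.in_component_of_iff qQ'.in_component_of_iff)
    show "component_of Q' (\<nu> u) \<subseteq> \<nu> ` component_of Q u"
    proof
      fix v assume v: "v \<in> component_of Q' (\<nu> u)"
      then obtain p where p: "walk Q' (\<nu> u) p v" by (auto simp: qQ'.in_component_of_iff)
      then have "\<exists>q. walk Q (\<mu> (\<nu> u)) q (\<mu> v)"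
        by (rule qQ'.walk_transport[OF qQ.quiver_axioms \<mu>(1) bwd])
      then have "\<mu> v \<in> component_of Q u" using \<mu>(3)[OF u] by (simp add: qQ.in_component_of_iff)
      moreover have "\<nu> (\<mu> v) = v" using \<mu>(2) qQ'.walk_on_verts[OF p] by blast
      ultimately show "v \<in> \<nu> ` component_of Q u" by force
    qed
  qed
  have "components Q' = (`) \<nu> ` components Q"
    unfolding components_def image_image surj[symmetric] by (rule image_cong) (auto simp: comp)
  moreover have "inj_on ((`) \<nu>) (components Q)"
    by (rule inj_on_subset[OF inj_on_image_Pow[OF inj]]) (auto simp: components_def dest: subsetD[OF qQ.component_of_subset])
  ultimately have "card (components Q') = card (components Q)" by (simp add: card_image)
  then show ?thesis by (simp add: betti_def E V)
qed

lemma (in bound_algebra) closed_R: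
  "X \<in> carrier R \<Longrightarrow> Y \<in> carrier R \<Longrightarrow> X \<oplus>\<^bsub>R\<^esub> Y \<in> carrier R"
  "X \<in> carrier R \<Longrightarrow> Y \<in> carrier R \<Longrightarrow> X \<otimes>\<^bsub>R\<^esub> Y \<in> carrier R"
  "X \<in> carrier R \<Longrightarrow> c \<odot>\<^bsub>R\<^esub> X \<in> carrier R"
  "\<one>\<^bsub>R\<^esub> \<in> carrier R"
proof -
  interpret F: ring "A Quot I" by (rule I.quotient_is_ring)
  show "X \<oplus>\<^bsub>R\<^esub> Y \<in> carrier R" "X \<otimes>\<^bsub>R\<^esub> Y \<in> carrier R"
    if "X \<in> carrier R" "Y \<in> carrier R"
    using that F.a_closed F.m_closed unfolding quotient_record by blast+
  show "\<one>\<^bsub>R\<^esub> \<in> carrier R" unfolding quotient_record by (rule F.one_closed)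
  show "c \<odot>\<^bsub>R\<^esub> X \<in> carrier R" if "X \<in> carrier R"
    using that cls_closed[OF smult_closed] by (auto simp: carrier_R cls_smult simp del: path_algebra_simps(1))
qed

text \<open>
  The vertices and the numbers of arrows between them are recovered from the characters and the
  derivations, hence do not depend on the presentation.
\<close>

lemma betti_algebra_invariant:
  fixes Q :: "('v, 'a) pre_digraph" and Q' :: "('w, 'b) pre_digraph"
    and I :: "(('v, 'a) qpath \<Rightarrow>\<^sub>0 'k::field) set" and I' :: "(('w, 'b) qpath \<Rightarrow>\<^sub>0 'k) set"
  assumes "bound_algebra Q I" "bound_algebra Q' I'"
    and "alg_isomorphic (bound_quiver_algebra Q I) (bound_quiver_algebra Q' I')"
  shows "betti Q = betti Q'"
proof -
  interpret Q: bound_algebra Q I by fact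
  interpret Q': bound_algebra Q' I' by fact
  let ?R = "bound_quiver_algebra Q I" and ?S = "bound_quiver_algebra Q' I'"
  obtain h where h: "h \<in> alg_hom ?R ?S" and bij: "bij_betw h (carrier ?R) (carrier ?S)"
    using assms(3) by (auto simp: alg_isomorphic_def)
  have hh: "h \<in> ring_hom ?R ?S" and hs: "\<And>c X. X \<in> carrier ?R \<Longrightarrow> h (c \<odot>\<^bsub>?R\<^esub> X) = c \<odot>\<^bsub>?S\<^esub> h X"
    using h by (auto simp: alg_hom_def)
  note hadd = ring_hom_add[OF hh] and hmul = ring_hom_mult[OF hh] and hone = ring_hom_one[OF hh]
  have hc: "h X \<in> carrier ?S" if "X \<in> carrier ?R" for X using ring_hom_closed[OF hh that] .
  \<comment> \<open>Claims about the second algebra are reduced to elements \<open>h X\<close>. In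
    this way the laws of \<open>h\<close> also show that \<open>push\<close>, composition with its
    inverse, preserves functionals, characters and derivations.\<close>
  have surj: "(\<forall>Y\<in>carrier ?S. P Y) \<longleftrightarrow> (\<forall>X\<in>carrier ?R. P (h X))" for P
    unfolding bij_betw_imp_surj_on[OF bij, symmetric] by (simp only: ball_simps)
  note cR = Q.closed_R
  define pull :: "(_ \<Rightarrow> 'k) \<Rightarrow> _ \<Rightarrow> 'k" where "pull F = (\<lambda>X. if X \<in> carrier ?R then F (h X) else 0)" for F
  define push :: "(_ \<Rightarrow> 'k) \<Rightarrow> _ \<Rightarrow> 'k"
    where "push F = (\<lambda>Y. if Y \<in> carrier ?S then F (inv_into (carrier ?R) h Y) else 0)" for F
  have push_h: "push F (h X) = F X" if "X \<in> carrier ?R" for F X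
    using that hc bij by (simp add: push_def bij_betw_def inv_into_f_f)
  have push_out: "push F Y = 0" if "Y \<notin> carrier ?S" for F Y using that by (simp add: push_def)
  have pull_push: "pull (push F) = F" if "F \<in> functionals ?R" for F
    using that push_h by (auto simp: pull_def functionals_def)
  have lin_pull: "pull F \<in> functionals ?R" if "F \<in> functionals ?S" for F
    using that by (auto simp: functionals_def pull_def cR hadd hs hc)
  have lin_push: "push F \<in> functionals ?S" if F: "F \<in> functionals ?R" for F
    unfolding functionals_def mem_Collect_eq surj
    using F by (auto simp: hadd[symmetric] hs[symmetric] push_h cR push_out functionals_def)
  have inj: "inj_on pull (functionals ?S)"
  proof (rule inj_onI)
    fix F G assume FG: "F \<in> functionals ?S" "G \<in> functionals ?S" "pull F = pull G"
    have "\<forall>Y\<in>carrier ?S. F Y = G Y"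
      unfolding surj using fun_cong[OF FG(3)] by (simp add: pull_def) metis
    then show "F = G" using FG(1,2) by (auto simp: functionals_def fun_eq_iff)
  qed
  have char_pull: "pull \<chi> \<in> characters ?R" if "\<chi> \<in> characters ?S" for \<chi>
    using that lin_pull by (auto simp: characters_def pull_def cR hmul hone hc)
  have char_push: "push \<chi> \<in> characters ?S" if \<chi>: "\<chi> \<in> characters ?R" for \<chi>
  proof -
    have "push \<chi> \<one>\<^bsub>?S\<^esub> = 1" using push_h[OF cR(4)] \<chi> by (simp add: hone characters_def)
    then show ?thesis
      unfolding characters_def mem_Collect_eq surj
      using \<chi> lin_push by (auto simp: hmul[symmetric] push_h cR characters_def)
  qed
  have "pull ` characters ?S = characters ?R"
  proof
    show "characters ?R \<subseteq> pull ` characters ?S"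
    proof
      fix \<chi> assume "\<chi> \<in> characters ?R"
      then show "\<chi> \<in> pull ` characters ?S"
        using pull_push[of \<chi>] char_push[of \<chi>] by (auto simp: characters_def intro!: image_eqI[of _ _ "push \<chi>"])
    qed
  qed (use char_pull in blast)
  moreover have "inj_on pull (characters ?S)"
    by (rule inj_on_subset[OF inj]) (auto simp: characters_def)
  ultimately have "bij_betw pull (characters ?S) (characters ?R)" by (simp add: bij_betw_def)
  then have bij': "bij_betw (pull \<circ> Q'.vertex_char) (verts Q') (characters ?R)"
    using Q'.vertex_chars bij_betw_trans by blast
  \<comment> \<open>The vertex of \<open>Q'\<close> whose character pulls back along
    \<open>h\<close> to the character of the given vertex of \<open>Q\<close>. The map
    \<open>h\<close> itself need not send trivial paths to trivial paths.\<close>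
  define \<nu> where "\<nu> = inv_into (verts Q') (pull \<circ> Q'.vertex_char) \<circ> Q.vertex_char"
  have \<nu>: "bij_betw \<nu> (verts Q) (verts Q')"
    using bij_betw_trans[OF Q.vertex_chars bij_betw_inv_into[OF bij']] by (simp only: \<nu>_def)
  have pull_\<nu>: "pull (Q'.vertex_char (\<nu> v)) = Q.vertex_char v" if "v \<in> verts Q" for v
  proof -
    have "Q.vertex_char v \<in> (pull \<circ> Q'.vertex_char) ` verts Q'"
      using Q.vertex_char[OF that] bij_betw_imp_surj_on[OF bij'] by simp
    from f_inv_into_f[OF this] show ?thesis by (simp add: \<nu>_def)
  qed
  show ?thesis
  proof (rule betti_transport[OF Q.fin_digraph_axioms Q'.fin_digraph_axioms \<nu>])
    fix v w assume v: "v \<in> verts Q" and w: "w \<in> verts Q"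
    let ?DS = "derivations ?S (Q'.vertex_char (\<nu> w)) (Q'.vertex_char (\<nu> v))"
    let ?DR = "derivations ?R (Q.vertex_char w) (Q.vertex_char v)"
    have pv: "Q'.vertex_char (\<nu> u) (h X) = Q.vertex_char u X" if "u \<in> verts Q" "X \<in> carrier ?R" for u X
      using fun_cong[OF pull_\<nu>[OF that(1)], of X] that(2) by (simp add: pull_def)
    have "pull ` ?DS = ?DR"
    proof
      show "pull ` ?DS \<subseteq> ?DR"
        using lin_pull by (auto simp: derivations_def pull_def cR hmul hc pv[OF v] pv[OF w])
      show "?DR \<subseteq> pull ` ?DS"
      proof
        fix D assume D: "D \<in> ?DR"
        then have lin: "D \<in> functionals ?R" by (simp add: derivations_def)
        have "push D \<in> ?DS"
          unfolding derivations_def mem_Collect_eq surj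
          using D lin_push[OF lin] by (auto simp: hmul[symmetric] push_h cR pv[OF v] pv[OF w] derivations_def)
        then show "D \<in> pull ` ?DS" using pull_push[OF lin] by (metis image_eqI)
      qed
    qed
    moreover have "fun_dim (pull ` ?DS) = fun_dim ?DS"
    proof (rule fun_dim_image)
      show "Vector_Spaces.linear (\<lambda>c f x. c * f x) (\<lambda>c f x. c * f x) pull"
        by unfold_locales (auto simp: pull_def fun_eq_iff)
      show "fun_vs.subspace ?DS"
        by (rule fun_subspaceI) (auto simp: derivations_def functionals_def algebra_simps)
      show "inj_on pull ?DS" by (rule inj_on_subset[OF inj]) (auto simp: derivations_def)
    qed
    ultimately have "fun_dim ?DR = fun_dim ?DS" by simp
    \<comment> \<open>The summand for the inner derivation depends only on whether the two vertices
      coincide, so it is the same on both sides and cancels.\<close>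
    moreover have "\<nu> v \<in> verts Q'" "\<nu> w \<in> verts Q'" "\<nu> v = \<nu> w \<longleftrightarrow> v = w"
      using \<nu> v w by (auto simp: bij_betw_def inj_on_def)
    ultimately show "card {a \<in> arcs Q. tail Q a = v \<and> head Q a = w}
        = card {a \<in> arcs Q'. tail Q' a = \<nu> v \<and> head Q' a = \<nu> w}"
      using Q.derivation_dim[OF v w] Q'.derivation_dim[of "\<nu> v" "\<nu> w"] by simp
  qed
qed

section \<open>Connected algebras\<close>

text \<open>The trivial paths at the vertices of a component add up to a central idempotent.\<close>

lemma (in bound_algebra) connected_algebra_walk:
  assumes conn: "connected_algebra R"
  shows "\<forall>u\<in>verts Q. \<forall>v\<in>verts Q. \<exists>p. walk Q u p v"
proof -
  interpret q: quiver Q by unfold_locales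
  show "\<forall>u\<in>verts Q. \<forall>v\<in>verts Q. \<exists>p. walk Q u p v"
  proof (intro ballI)
    fix u v assume u: "u \<in> verts Q" and v: "v \<in> verts Q"
    let ?C = "component_of Q u"
    have CV: "?C \<subseteq> verts Q" by (rule q.component_of_subset)
    have finC: "finite ?C" by (rule finite_subset[OF CV finite_verts])
    define e where "e S = (\<Sum>v\<in>S. vert v)" for S
    have ec: "e S \<in> carrier A \<and> (\<forall>f\<in>carrier A. \<forall>r.
          lookup (pmult (e S) f) r = (if tgt r \<in> S then lookup f r else 0) \<and>
          lookup (pmult f (e S)) r = (if src r \<in> S then lookup f r else 0))"
      if "finite S" "S \<subseteq> verts Q" for S
      using that
    proof (induction S rule: finite_induct)
      case empty
      show ?case by (auto simp: e_def pmult_def)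
    next
      case (insert x S)
      have x: "vert x \<in> carrier A" using insert.prems by (intro vert_closed) simp
      have S: "e S \<in> carrier A" using insert by simp
      have eq: "e (insert x S) = vert x + e S" using insert by (simp add: e_def)
      have "pmult (e (insert x S)) f = pmult (vert x) f + pmult (e S) f"
          "pmult f (e (insert x S)) = pmult f (vert x) + pmult f (e S)"
        if "f \<in> carrier A" for f
        using I.l_distr[OF x S that] I.r_distr[OF x S that] by (simp_all add: eq)
      moreover have "e (insert x S) \<in> carrier A" using I.a_closed[OF x S] by (simp add: eq)
      ultimately show ?case
        using insert by (auto simp: lookup_add lookup_trivial_mult_left lookup_trivial_mult_right simp del: path_algebra_simps(1))
    qed
    have e_closed: "e ?C \<in> carrier A" using ec[OF finC CV] by blast
    have e_mult: "lookup (pmult (e ?C) f) r = (if tgt r \<in> ?C then lookup f r else 0)"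
      "lookup (pmult f (e ?C)) r = (if src r \<in> ?C then lookup f r else 0)" if "f \<in> carrier A" for f r
      using ec[OF finC CV] that by blast+
    have look: "lookup (e ?C) r = (if src r \<in> ?C then lookup \<one>\<^bsub>A\<^esub> r else 0)" for r
    proof -
      have "pmult \<one>\<^bsub>A\<^esub> (e ?C) = e ?C" using I.l_one[OF e_closed] by simp
      then show ?thesis using e_mult(2)[OF one_closed, of r] by simp
    qed
    \<comment> \<open>No path joins different components; this makes the idempotent central.\<close>
    have "src r \<in> ?C \<longleftrightarrow> tgt r \<in> ?C" if "r \<in> paths Q" for r
    proof -
      have "walk Q (src r) (map (\<lambda>a. (a, True)) (arrs r)) (tgt r)"
        using q.path_walk_in_walks[OF that] by (simp add: q.in_walks_iff path_walk_def)
      from q.component_of_walk[OF this] path_verts[OF that] show ?thesis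
        using q.component_of_eq q.component_of_refl by metis
    qed
    note ends = this
    have central: "pmult (e ?C) f = pmult f (e ?C)" if f: "f \<in> carrier A" for f
    proof (rule poly_mapping_eqI)
      fix r
      have "r \<in> paths Q \<or> lookup f r = 0" using f in_keys_iff[of r f] by (auto simp del: split_paired_All)
      then show "lookup (pmult (e ?C) f) r = lookup (pmult f (e ?C)) r"
        using ends[of r] by (auto simp: e_mult(1)[OF f] e_mult(2)[OF f])
    qed
    have idem: "pmult (e ?C) (e ?C) = e ?C"
      by (rule poly_mapping_eqI) (auto simp: e_mult(2)[OF e_closed] look)
    have "cls (e ?C) \<in> carrier R" by (rule cls_closed[OF e_closed])
    moreover have "cls (e ?C) \<otimes>\<^bsub>R\<^esub> cls (e ?C) = cls (e ?C)" by (simp only: cls_mult[OF e_closed e_closed] idem)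
    moreover have "\<forall>x\<in>carrier R. cls (e ?C) \<otimes>\<^bsub>R\<^esub> x = x \<otimes>\<^bsub>R\<^esub> cls (e ?C)"
      using central cls_mult[OF e_closed] cls_mult[OF _ e_closed] by (auto simp: carrier_R simp del: path_algebra_simps(1))
    ultimately have "cls (e ?C) = I \<or> cls (e ?C) = \<one>\<^bsub>R\<^esub>"
      using conn unfolding connected_algebra_def cls_zero by blast
    moreover have "cls (e ?C) \<noteq> I"
    proof
      assume "cls (e ?C) = I"
      then have "e ?C \<in> I" using cls_self[OF e_closed] by simp
      then have "lookup (e ?C) (trivial_path u) = 0" by (rule I_lookup) simp
      then show False using u q.component_of_refl[OF u] by (simp add: look lookup_one)
    qed
    ultimately have "e ?C \<in> cls \<one>\<^bsub>A\<^esub>" using cls_self[OF e_closed] by (simp add: cls_one)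
    then obtain i where i: "i \<in> I" "e ?C = i + \<one>\<^bsub>A\<^esub>" by (auto simp: in_cls_iff)
    \<comment> \<open>Elements of the ideal have coefficient 0 at trivial paths. So congruence to
      the unit gives \<open>e ?C\<close> the coefficient 1 at \<open>v\<close>, which puts
      \<open>v\<close> into the component of \<open>u\<close>.\<close>
    have "lookup i (trivial_path v) = 0" by (rule I_lookup[OF i(1)]) simp
    then have "lookup (e ?C) (trivial_path v) = 1" using v by (simp add: i(2) lookup_add lookup_one)
    then have "v \<in> ?C" by (simp add: look split: if_splits)
    then show "\<exists>p. walk Q u p v" by (simp add: q.in_component_of_iff)
  qed
qed

section \<open>Copying a bound quiver to the natural numbers\<close>

text \<open>The maximum in \<open>pi1_rank\<close> ranges over quivers on natural numbers. To be a
  candidate for it, the given presentation is relabelled along injections of its vertices and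
  arrows.\<close>

locale bound_algebra_copy = bound_algebra Q I
  for Q :: "('v, 'a) pre_digraph" and I :: "(('v, 'a) qpath \<Rightarrow>\<^sub>0 'k::field) set" +
  fixes fv :: "'v \<Rightarrow> 'w" and fa :: "'a \<Rightarrow> 'b"
  assumes fv: "inj_on fv (verts Q)" and fa: "inj_on fa (arcs Q)"
begin

definition copy :: "('w, 'b) pre_digraph" where
  "copy = \<lparr>verts = fv ` verts Q, arcs = fa ` arcs Q,
    tail = (\<lambda>n. fv (tail Q (inv_into (arcs Q) fa n))), head = (\<lambda>n. fv (head Q (inv_into (arcs Q) fa n)))\<rparr>"

lemma copy_simps [simp]:
  "verts copy = fv ` verts Q" "arcs copy = fa ` arcs Q"
  "a \<in> arcs Q \<Longrightarrow> tail copy (fa a) = fv (tail Q a)" "a \<in> arcs Q \<Longrightarrow> head copy (fa a) = fv (head Q a)"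
  using fa by (simp_all add: copy_def)

lemma fin_digraph_copy: "fin_digraph copy"
  by unfold_locales auto

sublocale copy: fin_digraph copy
  by (rule fin_digraph_copy)

definition pmap :: "('v, 'a) qpath \<Rightarrow> ('w, 'b) qpath" where
  "pmap p = (fv (src p), map fa (arrs p), fv (tgt p))"

lemma pmap_sel [simp]:
  "src (pmap p) = fv (src p)" "arrs (pmap p) = map fa (arrs p)" "tgt (pmap p) = fv (tgt p)"
  by (simp_all add: pmap_def)

lemma pmap_pcomp: "pcomp (pmap p) (pmap q) = pmap (pcomp p q)"
  by (simp add: pcomp_def pmap_def)

lemma pmap_trivial: "pmap (trivial_path v) = trivial_path (fv v)"
  by (simp add: pmap_def trivial_path_def)

lemma pmap_awalk: "awalk u p v \<Longrightarrow> copy.awalk (fv u) (map fa p) (fv v)"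
  by (induction p arbitrary: u) (auto simp: awalk_simps copy.awalk_simps)

text \<open>Consecutive arrows of a path of the copy meet at a copied vertex; injectivity of
  \<open>fv\<close> makes the original arrows meet as well.\<close>

lemma pmap_awalk_surj:
  "copy.awalk u' p' v' \<Longrightarrow> \<exists>u p v. awalk u p v \<and> u' = fv u \<and> p' = map fa p \<and> v' = fv v"
proof (induction p' arbitrary: u')
  case Nil
  then obtain u where "u \<in> verts Q" "u' = fv u" "v' = fv u" by (auto simp: copy.awalk_simps)
  then show ?case by (intro exI[of _ u] exI[of _ "[]"]) (simp add: awalk_simps)
next
  case (Cons b p')
  then obtain a where a: "a \<in> arcs Q" "b = fa a" "u' = fv (tail Q a)" "copy.awalk (fv (head Q a)) p' v'"
    by (auto simp: copy.awalk_simps)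
  from Cons.IH[OF a(4)] obtain u p v where p: "awalk u p v" "fv (head Q a) = fv u" "p' = map fa p" "v' = fv v"
    by blast
  have "u = head Q a"
    by (rule inj_onD[OF fv p(2)[symmetric]]) (use p(1) a(1) in auto)
  then have w: "awalk (tail Q a) (a # p) v" using a(1) p(1) by (simp add: awalk_simps)
  have "b # p' = map fa (a # p)" using a(2) p(3) by simp
  then show ?case
    by (intro exI[of _ "tail Q a"] exI[of _ "a # p"] exI[of _ v] conjI w a(3) p(4))
qed

lemma pmap_inj: "inj_on pmap (paths Q)"
proof (rule inj_onI)
  fix p q assume p: "p \<in> paths Q" and q: "q \<in> paths Q" and eq: "pmap p = pmap q"
  have "fv (src p) = fv (src q)" "fv (tgt p) = fv (tgt q)" using eq by (simp_all add: pmap_def)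
  then have "src p = src q" "tgt p = tgt q"
    using inj_onD[OF fv] path_verts[OF p] path_verts[OF q] by blast+
  moreover have "arrs p = arrs q"
  proof (rule map_inj_on)
    show "map fa (arrs p) = map fa (arrs q)" using eq by (simp add: pmap_def)
    have "set (arrs p) \<union> set (arrs q) \<subseteq> arcs Q" using p q by (auto simp: paths_iff)
    then show "inj_on fa (set (arrs p) \<union> set (arrs q))" using fa inj_on_subset by blast
  qed
  ultimately show "p = q" by (metis qpath_collapse)
qed

lemma pmap_image: "pmap ` paths Q = paths copy"
proof
  show "pmap ` paths Q \<subseteq> paths copy"
    by (auto simp: paths_iff copy.paths_iff pmap_awalk simp del: split_paired_All)
  show "paths copy \<subseteq> pmap ` paths Q"
  proof
    fix q assume "q \<in> paths copy"
    then have "copy.awalk (src q) (arrs q) (tgt q)" by (simp add: copy.paths_iff)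
    from pmap_awalk_surj[OF this] obtain u p v where p: "awalk u p v" "src q = fv u" "arrs q = map fa p" "tgt q = fv v"
      by blast
    have "q = pmap (u, p, v)" using p(2-4) by (simp add: pmap_def) (metis qpath_collapse)
    moreover have "(u, p, v) \<in> paths Q" using p(1) by (simp add: paths_iff)
    ultimately show "q \<in> pmap ` paths Q" by blast
  qed
qed

section \<open>Transport of the path algebra and of the ideal to the copy\<close>

abbreviation A' :: "('k, ('w, 'b) qpath \<Rightarrow>\<^sub>0 'k) module" where "A' \<equiv> path_algebra copy"

definition pm :: "(('v, 'a) qpath \<Rightarrow>\<^sub>0 'k) \<Rightarrow> ('w, 'b) qpath \<Rightarrow>\<^sub>0 'k" where
  "pm f = (\<Sum>p\<in>keys f. single (pmap p) (lookup f p))"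

lemma lookup_pm:
  assumes "f \<in> carrier A" "p \<in> paths Q"
  shows "lookup (pm f) (pmap p) = lookup f p"
proof -
  have "lookup (pm f) (pmap p) =
      (\<Sum>q\<in>keys f. if q = p then lookup f p else 0)"
    unfolding pm_def lookup_sum
  proof (rule sum.cong[OF HOL.refl])
    fix q assume "q \<in> keys f"
    then have "q \<in> paths Q" using assms(1) by auto
    from inj_on_eq_iff[OF pmap_inj this assms(2)]
    show "lookup (single (pmap q) (lookup f q)) (pmap p)
        = (if q = p then lookup f p else 0)"
      by (simp add: lookup_single_if)
  qed
  then show ?thesis by (simp add: in_keys_iff)
qed

lemma lookup_pm_0: "r \<notin> pmap ` keys f \<Longrightarrow> lookup (pm f) r = 0"
  unfolding pm_def lookup_sum by (rule sum.neutral) (auto simp: lookup_single_if)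

lemma keys_pm:
  assumes "f \<in> carrier A"
  shows "keys (pm f) = pmap ` keys f"
proof
  show "keys (pm f) \<subseteq> pmap ` keys f"
    by (rule subsetI, rule ccontr) (simp add: in_keys_iff lookup_pm_0)
  show "pmap ` keys f \<subseteq> keys (pm f)"
  proof
    fix r assume "r \<in> pmap ` keys f"
    then obtain p where p: "p \<in> keys f" "r = pmap p" by blast
    moreover have "p \<in> paths Q" using assms p(1) by auto
    ultimately show "r \<in> keys (pm f)" using lookup_pm[OF assms] by (simp add: in_keys_iff)
  qed
qed

lemma pm_closed: "f \<in> carrier A \<Longrightarrow> pm f \<in> carrier A'"
  using keys_pm[of f] pmap_image by auto

lemma copy_eqI:
  assumes "g \<in> carrier A'" "g' \<in> carrier A'"
    and "\<And>p. p \<in> paths Q \<Longrightarrow> lookup g (pmap p) = lookup g' (pmap p)"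
  shows "g = g'"
proof (rule poly_mapping_eqI)
  fix r show "lookup g r = lookup g' r"
  proof (cases "r \<in> paths copy")
    case True
    then obtain p where "p \<in> paths Q" "r = pmap p" unfolding pmap_image[symmetric] by blast
    then show ?thesis using assms(3) by simp
  next
    case False
    then have "r \<notin> keys g" "r \<notin> keys g'" using assms(1,2) by auto
    then show ?thesis by (simp add: in_keys_iff)
  qed
qed

lemma add_closed: "f \<in> carrier A \<Longrightarrow> g \<in> carrier A \<Longrightarrow> f + g \<in> carrier A"
  using I.a_closed[of f g] by simp

lemma copy_add_closed: "f \<in> carrier A' \<Longrightarrow> g \<in> carrier A' \<Longrightarrow> f + g \<in> carrier A'"
  using Poly_Mapping.keys_add[of f g] by auto

lemma pm_add:
  assumes "f \<in> carrier A" "g \<in> carrier A"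
  shows "pm (f + g) = pm f + pm g"
  by (rule copy_eqI[OF pm_closed[OF add_closed[OF assms]] copy_add_closed[OF pm_closed[OF assms(1)] pm_closed[OF assms(2)]]])
    (simp only: lookup_pm[OF add_closed[OF assms]] lookup_pm[OF assms(1)] lookup_pm[OF assms(2)] lookup_add)

lemma copy_mult_closed: "f \<in> carrier A' \<Longrightarrow> g \<in> carrier A' \<Longrightarrow> pmult f g \<in> carrier A'"
  using copy.pmult_closed[of f g] by simp

lemma pm_mult:
  assumes f: "f \<in> carrier A" and g: "g \<in> carrier A"
  shows "pm (pmult f g) = pmult (pm f) (pm g)"
proof (rule copy_eqI[OF pm_closed[OF mult_closed[OF assms]] copy_mult_closed[OF pm_closed[OF f] pm_closed[OF g]]])
  fix r assume r: "r \<in> paths Q"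
  have fp: "p \<in> paths Q" if "p \<in> keys f" for p using f that by auto
  have gp: "p \<in> paths Q" if "p \<in> keys g" for p using g that by auto
  have injf: "inj_on pmap (keys f)" by (rule inj_on_subset[OF pmap_inj]) (use f in simp)
  have injg: "inj_on pmap (keys g)" by (rule inj_on_subset[OF pmap_inj]) (use g in simp)
  have "lookup (pmult (pm f) (pm g)) (pmap r) =
    (\<Sum>p\<in>pmap ` keys f. \<Sum>q\<in>pmap ` keys g.
      if src p = tgt q \<and> pcomp p q = pmap r then lookup (pm f) p * lookup (pm g) q else 0)"
    by (rule lookup_pmult) (simp_all add: keys_pm[OF f] keys_pm[OF g])
  also have "\<dots> = (\<Sum>p\<in>keys f. \<Sum>q\<in>keys g.
      if src (pmap p) = tgt (pmap q) \<and> pcomp (pmap p) (pmap q) = pmap r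
      then lookup (pm f) (pmap p) * lookup (pm g) (pmap q) else 0)"
    by (simp only: sum.reindex[OF injf] sum.reindex[OF injg] o_def)
  also have "\<dots> = (\<Sum>p\<in>keys f. \<Sum>q\<in>keys g.
      if src p = tgt q \<and> pcomp p q = r then lookup f p * lookup g q else 0)"
  proof (intro sum.cong HOL.refl)
    fix p q assume p: "p \<in> keys f" and q: "q \<in> keys g"
    have "src (pmap p) = tgt (pmap q) \<longleftrightarrow> src p = tgt q"
      using path_verts[OF fp[OF p]] path_verts[OF gp[OF q]] fv by (auto dest: inj_onD)
    moreover have "pcomp (pmap p) (pmap q) = pmap r \<longleftrightarrow> pcomp p q = r" if "src p = tgt q"
      unfolding pmap_pcomp
      using inj_on_eq_iff[OF pmap_inj pcomp_in_paths[OF fp[OF p] gp[OF q] that] r] .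
    ultimately show "(if src (pmap p) = tgt (pmap q) \<and> pcomp (pmap p) (pmap q) = pmap r
        then lookup (pm f) (pmap p) * lookup (pm g) (pmap q) else 0)
      = (if src p = tgt q \<and> pcomp p q = r then lookup f p * lookup g q else 0)"
      unfolding lookup_pm[OF f fp[OF p]] lookup_pm[OF g gp[OF q]] by (cases "src p = tgt q") simp_all
  qed
  also have "\<dots> = lookup (pmult f g) r"
    by (rule lookup_pmult[symmetric]) simp_all
  finally show "lookup (pm (pmult f g)) (pmap r) = lookup (pmult (pm f) (pm g)) (pmap r)"
    using lookup_pm[OF mult_closed[OF assms] r] by simp
qed

lemma pm_single:
  assumes "p \<in> paths Q"
  shows "pm (single p c) = single (pmap p) c"
  by (simp add: pm_def)

lemma pm_smult:
  assumes f: "f \<in> carrier A"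
  shows "pm (c \<odot>\<^bsub>A\<^esub> f) = c \<odot>\<^bsub>A'\<^esub> pm f"
proof (rule copy_eqI[OF pm_closed[OF smult_closed[OF f]]])
  show "c \<odot>\<^bsub>A'\<^esub> pm f \<in> carrier A'"
    using pm_closed[OF f] by (auto simp: in_keys_iff subset_iff simp del: split_paired_All)
qed (simp add: lookup_pm[OF f] lookup_pm[OF smult_closed[OF f]])

lemma pm_one: "pm \<one>\<^bsub>A\<^esub> = \<one>\<^bsub>A'\<^esub>"
proof -
  have "\<one>\<^bsub>A'\<^esub> \<in> carrier A'" by (auto simp: in_keys_iff copy.lookup_one split: if_splits)
  then show ?thesis
  proof (rule copy_eqI[OF pm_closed[OF one_closed]])
    fix p assume p: "p \<in> paths Q"
    have "pmap p \<in> trivial_path ` fv ` verts Q \<longleftrightarrow> pmap p \<in> pmap ` trivial_path ` verts Q"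
      by (simp add: image_image pmap_trivial)
    also have "\<dots> \<longleftrightarrow> p \<in> trivial_path ` verts Q"
      by (rule inj_on_image_mem_iff[OF pmap_inj p]) auto
    finally show "lookup (pm \<one>\<^bsub>A\<^esub>) (pmap p) = lookup \<one>\<^bsub>A'\<^esub> (pmap p)"
      by (simp add: lookup_pm[OF one_closed p] lookup_one copy.lookup_one del: split_paired_All)
  qed
qed

lemma pm_bij: "bij_betw pm (carrier A) (carrier A')"
proof (rule bij_betw_imageI)
  show "inj_on pm (carrier A)"
  proof (rule inj_onI)
    fix f g assume f: "f \<in> carrier A" and g: "g \<in> carrier A" and eq: "pm f = pm g"
    show "f = g"
    proof (rule poly_mapping_eqI)
      fix p show "lookup f p = lookup g p"
      proof (cases "p \<in> paths Q")
        case True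
        then show ?thesis using lookup_pm[OF f True] lookup_pm[OF g True] eq by simp
      next
        case False
        then have "p \<notin> keys f" "p \<notin> keys g" using f g by auto
        then show ?thesis by (simp add: in_keys_iff)
      qed
    qed
  qed
  show "pm ` carrier A = carrier A'"
  proof
    show "pm ` carrier A \<subseteq> carrier A'" using pm_closed by blast
    show "carrier A' \<subseteq> pm ` carrier A"
    proof
      fix g assume g: "g \<in> carrier A'"
      have "(\<Sum>r\<in>S. single r (lookup g r)) \<in> pm ` carrier A" if "finite S" "S \<subseteq> paths copy" for S
        using that
      proof (induction S rule: finite_induct)
        case empty
        show ?case by (intro image_eqI[of _ _ 0]) (simp_all add: pm_def)
      next
        case (insert r S)
        then obtain f where f: "f \<in> carrier A" "(\<Sum>r\<in>S. single r (lookup g r)) = pm f" by auto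
        obtain p where p: "p \<in> paths Q" "r = pmap p" using insert.prems pmap_image by blast
        then have s: "single p (lookup g r) \<in> carrier A" by simp
        have "(\<Sum>r\<in>insert r S. single r (lookup g r)) = pm (single p (lookup g r) + f)"
          using insert.hyps f(2) pm_add[OF s f(1)] by (simp add: pm_single[OF p(1)] p(2))
        then show ?case using add_closed[OF s f(1)] by blast
      qed
      from this[of "keys g"] show "g \<in> pm ` carrier A" using g by (simp add: poly_mapping_sum_single)
    qed
  qed
qed

lemma pm_ring_iso: "pm \<in> ring_iso A A'"
  by (rule ring_iso_memI) (use pm_closed pm_mult pm_add pm_one pm_bij in simp_all)

lemma ring_copy: "ring A'"
proof -
  \<comment> \<open>The ring transported along an isomorphism has the image of zero as its zero, and
    here that is already the zero of \<open>A'\<close>.\<close>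
  have "A'\<lparr>zero := pm \<zero>\<^bsub>A\<^esub>\<rparr> = A'" by (simp add: path_algebra_def pm_def)
  then show ?thesis using I.ring_iso_imp_img_ring[OF pm_ring_iso] by (simp only:)
qed

lemma pm_surj: "g \<in> carrier A' \<Longrightarrow> \<exists>f\<in>carrier A. g = pm f"
  using pm_bij unfolding bij_betw_def by blast

lemma I_carrier: "f \<in> I \<Longrightarrow> f \<in> carrier A"
  by (rule I.a_Hcarr)

lemma ideal_copy: "ideal (pm ` I) A'"
proof (rule idealI[OF ring_copy])
  interpret R': ring A' by (rule ring_copy)
  have hom: "pm \<in> hom (add_monoid A) (add_monoid A')"
    using pm_closed pm_add by (auto simp: hom_def simp del: path_algebra_simps(1))
  interpret h: group_hom "add_monoid A" "add_monoid A'" pm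
    by (intro group_hom.intro group_hom_axioms.intro hom I.a_group R'.a_group)
  show "subgroup (pm ` I) (add_monoid A')"
    by (rule h.subgroup_img_is_subgroup[OF I.a_subgroup])
  fix a x assume "a \<in> pm ` I" "x \<in> carrier A'"
  then obtain i f where i: "i \<in> I" "a = pm i" and f: "f \<in> carrier A" "x = pm f" using pm_surj by blast
  show "x \<otimes>\<^bsub>A'\<^esub> a \<in> pm ` I" "a \<otimes>\<^bsub>A'\<^esub> x \<in> pm ` I"
    using I_mult[OF i(1), of f] f(1) pm_mult[OF f(1) I_carrier[OF i(1)]] pm_mult[OF I_carrier[OF i(1)] f(1)]
    by (auto simp: i(2) f(2) intro: image_eqI[OF HOL.sym])
qed

lemma admissible_copy: "admissible copy (pm ` I)"
proof -
  obtain m where m: "m \<ge> 2" "arrow_ideal_power Q m \<subseteq> I" using admissible by (auto simp: admissible_def)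
  have "pm i \<in> arrow_ideal_power copy 2" if "i \<in> I" for i
    using pm_closed[OF I_carrier[OF that]] keys_pm[OF I_carrier[OF that]] I_length[OF that]
    by (auto simp: arrow_ideal_power_def simp del: split_paired_All)
  moreover have "arrow_ideal_power copy m \<subseteq> pm ` I"
  proof
    fix g :: "('w, 'b) qpath \<Rightarrow>\<^sub>0 'k" assume g: "g \<in> arrow_ideal_power copy m"
    then have "g \<in> carrier A'" by (simp add: arrow_ideal_power_def)
    then obtain f where f: "f \<in> carrier A" "g = pm f" using pm_surj by blast
    have "m \<le> length (arrs p)" if p: "p \<in> keys f" for p
    proof -
      have "pmap p \<in> keys g" using keys_pm[OF f(1)] p f(2) by blast
      then have "m \<le> length (arrs (pmap p))" using g unfolding arrow_ideal_power_def by blast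
      then show ?thesis by simp
    qed
    then have "f \<in> arrow_ideal_power Q m" using f(1) by (simp add: arrow_ideal_power_def)
    then show "g \<in> pm ` I" using m(2) f(2) by blast
  qed
  ultimately show ?thesis using ideal_copy m(1) unfolding admissible_def by blast
qed

sublocale C: bound_algebra copy "pm ` I"
  by (intro bound_algebra.intro fin_digraph_copy bound_algebra_axioms.intro admissible_copy)

lemma term_closed_copy:
  assumes "term_closed I"
  shows "term_closed (pm ` I)"
  unfolding term_closed_def
proof (intro ballI allI)
  fix g r c assume "g \<in> pm ` I" and r: "r \<in> keys g"
  then obtain f where f: "f \<in> I" "g = pm f" by blast
  then obtain p where p: "p \<in> keys f" "r = pmap p" using r keys_pm[OF I_carrier[OF f(1)]] by blast
  have pp: "p \<in> paths Q" using I_keys[OF f(1)] p(1) by blast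
  have "single p c \<in> I" using assms f(1) p(1) unfolding term_closed_def by blast
  then have "pm (single p c) \<in> pm ` I" by blast
  then show "single r c \<in> pm ` I" by (simp only: pm_single[OF pp] p(2))
qed

lemma pm_cls:
  assumes f: "f \<in> carrier A"
  shows "pm ` cls f = C.cls (pm f)"
proof
  show "pm ` cls f \<subseteq> C.cls (pm f)"
  proof
    fix g assume "g \<in> pm ` cls f"
    then obtain i where i: "i \<in> I" "g = pm (i + f)" by (auto simp: in_cls_iff)
    then have "g = pm i + pm f" using pm_add[OF I_carrier[OF i(1)] f] by simp
    then show "g \<in> C.cls (pm f)" using i(1) C.in_cls_iff by blast
  qed
  show "C.cls (pm f) \<subseteq> pm ` cls f"
  proof
    fix g assume "g \<in> C.cls (pm f)"
    then obtain i where i: "i \<in> I" "g = pm i + pm f" by (auto simp: C.in_cls_iff)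
    then have "g = pm (i + f)" using pm_add[OF I_carrier[OF i(1)] f] by simp
    moreover have "i + f \<in> cls f" using i(1) in_cls_iff by blast
    ultimately show "g \<in> pm ` cls f" by blast
  qed
qed

lemma alg_isomorphic_copy: "alg_isomorphic R C.R"
  unfolding alg_isomorphic_def
proof
  have carr: "X \<subseteq> carrier A" if "X \<in> carrier R" for X
    using that I_carrier add_closed by (auto simp: carrier_R in_cls_iff simp del: path_algebra_simps(1))
  show "bij_betw ((`) pm) (carrier R) (carrier C.R)"
  proof (rule bij_betw_imageI)
    show "inj_on ((`) pm) (carrier R)"
      by (rule inj_on_subset[OF inj_on_image_Pow[OF bij_betw_imp_inj_on[OF pm_bij]]]) (use carr in blast)
    show "(`) pm ` carrier R = carrier C.R"
    proof (rule Set.set_eqI)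
      fix Y
      have "Y \<in> (`) pm ` carrier R \<longleftrightarrow> (\<exists>f\<in>carrier A. Y = pm ` cls f)"
        unfolding image_iff by (metis carrier_R)
      also have "\<dots> \<longleftrightarrow> (\<exists>f\<in>carrier A. Y = C.cls (pm f))"
        by (intro bex_cong HOL.refl) (simp only: pm_cls)
      also have "\<dots> \<longleftrightarrow> (\<exists>g\<in>carrier A'. Y = C.cls g)"
        unfolding bij_betw_imp_surj_on[OF pm_bij, symmetric] by (simp only: bex_simps)
      finally show "Y \<in> (`) pm ` carrier R \<longleftrightarrow> Y \<in> carrier C.R" unfolding C.carrier_R .
    qed
  qed
  show "(`) pm \<in> alg_hom R C.R"
    unfolding alg_hom_def
  proof (intro CollectI conjI ring_hom_memI allI ballI)
    fix X assume "X \<in> carrier R"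
    then obtain f where f: "f \<in> carrier A" "X = cls f" using carrier_R by blast
    show "pm ` X \<in> carrier C.R" using f pm_cls C.cls_closed pm_closed by metis
    show "pm ` (c \<odot>\<^bsub>R\<^esub> X) = c \<odot>\<^bsub>C.R\<^esub> pm ` X" for c
      by (simp only: f(2) cls_smult[OF f(1)] pm_cls[OF f(1)] pm_cls[OF smult_closed[OF f(1)]]
          C.cls_smult[OF pm_closed[OF f(1)]] pm_smult[OF f(1)])
    fix Y assume "Y \<in> carrier R"
    then obtain g where g: "g \<in> carrier A" "Y = cls g" using carrier_R by blast
    show "pm ` (X \<otimes>\<^bsub>R\<^esub> Y) = pm ` X \<otimes>\<^bsub>C.R\<^esub> pm ` Y"
      by (simp only: f(2) g(2) cls_mult[OF f(1) g(1)] pm_cls[OF f(1)] pm_cls[OF g(1)] pm_cls[OF mult_closed[OF f(1) g(1)]]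
          C.cls_mult[OF pm_closed[OF f(1)] pm_closed[OF g(1)]] pm_mult[OF f(1) g(1)])
    show "pm ` (X \<oplus>\<^bsub>R\<^esub> Y) = pm ` X \<oplus>\<^bsub>C.R\<^esub> pm ` Y"
      by (simp only: f(2) g(2) cls_add[OF f(1) g(1)] pm_cls[OF f(1)] pm_cls[OF g(1)] pm_cls[OF add_closed[OF f(1) g(1)]]
          C.cls_add[OF pm_closed[OF f(1)] pm_closed[OF g(1)]] pm_add[OF f(1) g(1)])
  next
    show "pm ` \<one>\<^bsub>R\<^esub> = \<one>\<^bsub>C.R\<^esub>"
      by (simp only: cls_one C.cls_one pm_cls[OF one_closed] pm_one)
  qed
qed

end

section \<open>The rank of a monomial algebra\<close>

lemma (in bound_algebra) pi1_rank_le: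
  "int (fun_dim (Hom_to_field (pi1 Q I) :: (_ \<Rightarrow> 'k) set)) \<le> betti Q"
proof -
  interpret q: quiver Q by unfold_locales
  obtain F where F: "spanning_forest Q F" using q.exists_spanning_forest finite_arcs by blast
  interpret forested_quiver Q I F
    by (intro forested_quiver.intro bound_quiver fin_digraph_axioms forested_quiver_axioms.intro F)
  show ?thesis
    using Hom_to_field_dim_le[where 'c = 'k] q.betti_eq_card[OF finite_verts finite_arcs F] by simp
qed

lemma (in bound_algebra) pi1_rank_eq_betti:
  assumes "term_closed I"
  shows "int (fun_dim (Hom_to_field (pi1 Q I) :: (_ \<Rightarrow> 'k) set)) = betti Q"
proof -
  interpret q: quiver Q by unfold_locales
  obtain F where F: "spanning_forest Q F" using q.exists_spanning_forest finite_arcs by blast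
  interpret free_forested_quiver Q I F
    by (intro free_forested_quiver.intro forested_quiver.intro free_bound_quiver assms bound_quiver
        fin_digraph_axioms forested_quiver_axioms.intro F)
  show ?thesis
    using Hom_to_field_dim[where 'c = 'k] q.betti_eq_card[OF finite_verts finite_arcs F] by simp
qed

text \<open>Every presentation has the same Betti number, which bounds the dimension it contributes.
  The copy on natural numbers has a term-closed ideal again and attains the bound.\<close>

lemma (in bound_algebra) pi1_rank:
  assumes tc: "term_closed I"
  shows "int (pi1_rank R) = betti Q"
proof -
  obtain fv :: "'v \<Rightarrow> nat" where fv: "inj_on fv (verts Q)"
    using finite_imp_inj_to_nat_seg[OF finite_verts] by blast
  obtain fa :: "'a \<Rightarrow> nat" where fa: "inj_on fa (arcs Q)"
    using finite_imp_inj_to_nat_seg[OF finite_arcs] by blast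
  interpret N: bound_algebra_copy Q I fv fa
    by unfold_locales (rule fv, rule fa)
  define S where "S = {fun_dim (Hom_to_field (pi1 Q' I') :: (_ \<Rightarrow> 'k) set)
     | (Q' :: (nat, nat) pre_digraph) (I' :: ((nat, nat) qpath \<Rightarrow>\<^sub>0 'k) set).
     fin_digraph Q' \<and> admissible Q' I' \<and> alg_isomorphic R (bound_quiver_algebra Q' I')}"
  have le: "int d \<le> betti Q" if dS: "d \<in> S" for d
  proof -
    obtain Q' :: "(nat, nat) pre_digraph" and I' :: "((nat, nat) qpath \<Rightarrow>\<^sub>0 'k) set"
      where d: "d = fun_dim (Hom_to_field (pi1 Q' I') :: (_ \<Rightarrow> 'k) set)"
        and Q': "fin_digraph Q'" "admissible Q' I'" and iso: "alg_isomorphic R (bound_quiver_algebra Q' I')"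
      using dS unfolding S_def by blast
    have b: "bound_algebra Q' I'" using Q' by (simp add: bound_algebra_def bound_algebra_axioms_def)
    have "betti Q = betti Q'" by (rule betti_algebra_invariant[OF bound_algebra_axioms b iso])
    then show ?thesis using bound_algebra.pi1_rank_le[OF b] by (simp add: d)
  qed
  let ?d = "fun_dim (Hom_to_field (pi1 N.copy (N.pm ` I)) :: (_ \<Rightarrow> 'k) set)"
  have dS: "?d \<in> S"
    unfolding S_def using N.fin_digraph_copy N.admissible_copy N.alg_isomorphic_copy by blast
  have "int ?d = betti N.copy" by (rule N.C.pi1_rank_eq_betti[OF N.term_closed_copy[OF tc]])
  also have "\<dots> = betti Q"
    by (rule betti_algebra_invariant[OF bound_algebra_axioms N.C.bound_algebra_axioms N.alg_isomorphic_copy, symmetric])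
  finally have d: "int ?d = betti Q" .
  have "d \<le> ?d" if "d \<in> S" for d using le[OF that] d by simp
  \<comment> \<open>\<open>S\<close> is finite because its members are bounded by \<open>?d\<close>,
    so \<open>Max\<close> is a genuine maximum.\<close>
  then have "Max S = ?d"
    using dS by (intro Max_eqI) (auto intro: finite_subset[of S "{..?d}"])
  then show ?thesis using d unfolding pi1_rank_def S_def[symmetric] by simp
qed

theorem proposition6p18:
  fixes QA QB T :: "('v, 'a) pre_digraph"
    and IA IB :: "(('v, 'a) qpath \<Rightarrow>\<^sub>0 'k::alg_closed_field) set"
  assumes "monomial QA IA"
    and "connected_algebra (bound_quiver_algebra QA IA)"
    and "monomial QB IB"
    and "quiver_subalgebra QB IB QA IA"
    and "extending_maximal_tree QA QB T"
  shows "betti (relative_quiver QA QB T) = betti QA - betti QB \<and>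
    (pi1_ab_inclusion QB QA IA \<in> mon (pi1_ab QB IB) (pi1_ab QA IA) \<and>
      pi1_ab (relative_quiver QA QB T) {0 :: ('v, 'a) qpath \<Rightarrow>\<^sub>0 'k}
        \<cong> pi1_ab QA IA Mod (pi1_ab_inclusion QB QA IA ` carrier (pi1_ab QB IB))) \<and>
    int (fun_dim (Hom_to_field
          (pi1 (relative_quiver QA QB T) {0 :: ('v, 'a) qpath \<Rightarrow>\<^sub>0 'k}) :: (_ \<Rightarrow> 'k) set))
      = int (pi1_rank (bound_quiver_algebra QA IA)) - int (pi1_rank (bound_quiver_algebra QB IB))"
proof -
  let ?R = "relative_quiver QA QB T" and ?Z = "{0 :: ('v, 'a) qpath \<Rightarrow>\<^sub>0 'k}"
  interpret A: bound_algebra QA IA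
    using assms(1) by (simp add: monomial_def bound_algebra_def bound_algebra_axioms_def)
  interpret B: bound_algebra QB IB
    using assms(3) by (simp add: monomial_def bound_algebra_def bound_algebra_axioms_def)
  have tA: "term_closed IA" using A.term_closed assms(1) by (simp add: monomial_def)
  have tB: "term_closed IB" using B.term_closed assms(3) by (simp add: monomial_def)
  have span: "spanning QB QA" using assms(4) by (simp add: quiver_subalgebra_def)
  then have sub: "subgraph QB QA" by (simp add: spanning_def)
  have arcsT: "arcs T \<subseteq> arcs QA"
    using assms(5) by (auto simp: extending_maximal_tree_def maximal_tree_def pre_digraph.max_subgraph_def subgraph_def)
  note forests = extending_maximal_tree_forests[OF A.wf_digraph_axioms span
      A.connected_algebra_walk[OF assms(2)] assms(5)]
  have arcsR: "arcs ?R = arcs QA - arcs QB \<union> arcs T" and vertsR: "verts ?R = verts QA"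
    by (simp_all add: relative_quiver_def)
  interpret wR: wf_digraph ?R by (rule forests(3))
  interpret R: fin_digraph ?R
    by unfold_locales (simp_all add: arcsR vertsR finite_subset[OF arcsT A.finite_arcs])
  interpret qA: quiver QA by unfold_locales
  interpret qB: quiver QB by unfold_locales
  interpret qR: quiver ?R by unfold_locales
  \<comment> \<open>Taking the part of \<open>T\<close> inside \<open>QB\<close> as the forest of
    \<open>QB\<close> is the compatibility under which the coordinates of both groups are
    comparable.\<close>
  interpret S: forested_subquiver QA QB IA IB "arcs T" "arcs T \<inter> arcs QB"
    by (intro forested_subquiver.intro free_forested_quiver.intro forested_quiver.intro A.free_bound_quiver tA
        B.free_bound_quiver tB A.bound_quiver B.bound_quiver A.fin_digraph_axioms B.fin_digraph_axioms
        forested_quiver_axioms.intro forests forested_subquiver_axioms.intro sub HOL.refl)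
  have fR: "free_bound_quiver ?R ?Z" by (rule qR.free_bound_quiver_zero)
  interpret F: free_forested_quiver ?R ?Z "arcs T"
    by (intro free_forested_quiver.intro forested_quiver.intro fR free_bound_quiver.axioms(1)[OF fR]
        R.fin_digraph_axioms forested_quiver_axioms.intro forests)
  have KR: "arcs ?R - arcs T = (arcs QA - arcs T) - (arcs QB - arcs T \<inter> arcs QB)"
    by (auto simp: arcsR)
  have bA: "betti QA = int (card (arcs QA - arcs T))"
    by (rule qA.betti_eq_card[OF A.finite_verts A.finite_arcs forests(1)])
  have bB: "betti QB = int (card (arcs QB - arcs T \<inter> arcs QB))"
    by (rule qB.betti_eq_card[OF B.finite_verts B.finite_arcs forests(2)])
  have bR: "betti ?R = int (card (arcs ?R - arcs T))"
    by (rule qR.betti_eq_card[OF R.finite_verts R.finite_arcs forests(4)])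
  have betti: "betti ?R = betti QA - betti QB"
    unfolding bA bB bR KR using S.KB_subset card_mono[OF _ S.KB_subset]
    by (subst card_Diff_subset) (simp_all add: of_nat_diff)
  have "pi1_ab ?R ?Z \<cong> int_functions (arcs ?R - arcs T)" by (rule F.pi1_ab_iso)
  also have "int_functions (arcs ?R - arcs T) \<cong> pi1_ab QA IA Mod (pi1_ab_inclusion QB QA IA ` carrier (pi1_ab QB IB))"
    unfolding KR by (rule S.pi1_ab_quotient_iso)
  finally have "pi1_ab ?R ?Z \<cong> pi1_ab QA IA Mod (pi1_ab_inclusion QB QA IA ` carrier (pi1_ab QB IB))" .
  moreover have "int (fun_dim (Hom_to_field (pi1 ?R ?Z) :: (_ \<Rightarrow> 'k) set)) = betti ?R"
    using F.Hom_to_field_dim[where 'c = 'k] bR by simp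
  ultimately show ?thesis
    using betti S.pi1_ab_inclusion_mon A.pi1_rank[OF tA] B.pi1_rank[OF tB] by simp
qed

end
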